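(* For each $n=1,\dots,N$ let $\mu_n$, $I_n$ and $K$ be positive integers such that $\mu_n<\mu_n+K<I_n'$, where $I_n'=\min\{I_n,\,I_1\cdots I_{n-1}I_{n+1}\cdots I_N\}$. For $\beta>1$ and $\gamma>1$, suppose that $$p=1-\sum_{n=1}^N\left(\frac{1}{4(\gamma^2-1)\sqrt{\pi\max\{I_n'-\mu_n,\mu_n+K\}\gamma^2}}\left(\frac{2\gamma^2}{e^{\gamma^2-1}}\right)^2+\frac{1}{\sqrt{2\pi(K+1)}}\left(\frac{e}{K+1}\right)^{K+1}+\frac{1}{4(\gamma^2-1)\sqrt{\pi I_n\gamma^2}}\left(\frac{2\gamma^2}{e^{\gamma^2-1}}\right)^2\right)$$ is nonnegative. For a given tensor $\mathcal{A}\in\mathbb{R}^{I_1\times I_2\times\dots\times I_N}$ and an integer $q\geq 1$, let $\mathbf{Q}_1,\dots,\mathbf{Q}_N$ be the orthonormal matrices produced by the randomized T-HOSVD algorithm with power scheme (described in the context) applied to $\mathcal{A}$ with multilinear rank $\{\mu_1,\dots,\mu_N\}$, oversampling parameter $K$ and power $q$, and let $\widehat{\mathcal{A}}=\mathcal{A}\times_1(\mathbf{Q}_1\mathbf{Q}_1^\top)\times_2(\mathbf{Q}_2\mathbf{Q}_2^\top)\cdots\times_N(\mathbf{Q}_N\mathbf{Q}_N^\top)$. Then $$\|\mathcal{A}-\widehat{\mathcal{A}}\|_F\leq 2\sum_{n=1}^N\left(\lambda_n\Delta_{\mu_n+1}(\mathbf{A}_{(n)},q)+\Delta_{\mu_n+1}(\mathbf{A}_{(n)})\right)$$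 holds with probability at least $p$, where $$\lambda_n=\frac{\left(\sqrt{\max\{I_n'-\mu_n,\mu_n+K\}}+\sqrt{I_n}\right)\sqrt{2(\mu_n+K)}\,\gamma\beta}{\sigma_{\mu_n}(\mathbf{A}_{(n)})^{2q-1}}.$$
   Context: $\sigma_i(\cdot)$ is the $i$th largest singular value; $\|\cdot\|_F$ is the Frobenius norm of a matrix or tensor. A matrix $\mathbf{Q}$ is orthonormal if $\mathbf{Q}^\top\mathbf{Q}$ is the identity. $\mathbf{A}_{(n)}\in\mathbb{R}^{I_n\times I_1\cdots I_{n-1}I_{n+1}\cdots I_N}$ is the mode-$n$ unfolding of $\mathcal{A}$ (its columns are the mode-$n$ fibers), and $\mathcal{A}\times_n\mathbf{B}$ is the mode-$n$ product, with entries $\sum_{i_n}a_{i_1\dots i_n\dots i_N}b_{j i_n}$. A standard Gaussian matrix has i.i.d. $N(0,1)$ entries. Notation: $\Delta_{\mu_n+1}(\mathbf{A}_{(n)})=\left(\sum_{i=\mu_n+1}^{I_n'}\sigma_i(\mathbf{A}_{(n)})^{2}\right)^{1/2}$ and $\Delta_{\mu_n+1}(\mathbf{A}_{(n)},q)=\left(\sum_{i=\mu_n+1}^{I_n'}\sigma_i(\mathbf{A}_{(n)})^{4q}\right)^{1/2}$. Randomized T-HOSVD algorithm with power scheme: for each $n=1,\dots,N$, generate a standard Gaussian matrix $\mathbf{G}_n\in\mathbb{R}^{I_n\times(\mu_n+K)}$; compute $\mathbf{C}_n=(\mathbf{A}_{(n)}\mathbf{A}_{(n)}^\top)^q\mathbf{G}_n$;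 find an orthonormal $\mathbf{Q}_n\in\mathbb{R}^{I_n\times\mu_n}$ for which there exists $\mathbf{R}_n\in\mathbb{R}^{\mu_n\times(\mu_n+K)}$ with $\|\mathbf{Q}_n\mathbf{R}_n-\mathbf{C}_n\|_F\leq\left(\sum_{k=\mu_n+1}^{\mu_n+K}\sigma_k(\mathbf{C}_n)^2\right)^{1/2}$ (for example, the first $\mu_n$ left singular vectors of $\mathbf{C}_n$). *)

theory Defs
  imports "HOL-Probability.Probability" "Jordan_Normal_Form.Char_Poly"
begin

text \<open>
  The \<open>i\<close>-th largest singular value, counted from \<open>i = 1\<close>: the square root of the \<open>i\<close>-th largest
  eigenvalue of \<open>B\<^sup>T B\<close>, eigenvalues taken with multiplicity as the roots of the characteristic
  polynomial (all of them real, since \<open>B\<^sup>T B\<close> is symmetric). Meaningful for \<open>1 \<le> i \<le> dim_col B\<close>.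
\<close>
definition sing_val :: "nat \<Rightarrow> real mat \<Rightarrow> real" where
  "sing_val i B =
     sqrt (rev (sorted_list_of_multiset (proots (char_poly (transpose_mat B * B)))) ! (i - 1))"

definition frob_norm :: "real mat \<Rightarrow> real" where
  "frob_norm B = sqrt (\<Sum>i<dim_row B. \<Sum>j<dim_col B. (B $$ (i, j))\<^sup>2)"

text \<open>\<open>B\<close> need not be square.\<close>
definition orthonormal_mat :: "real mat \<Rightarrow> bool" where
  "orthonormal_mat B \<longleftrightarrow> transpose_mat B * B = 1\<^sub>m (dim_col B)"

text \<open>
  A tensor of order \<open>N\<close> and size \<open>I 1 \<times> \<dots> \<times> I N\<close> is a function on multi-indices. Modes are numbered
  from 1, entries within a mode from 0 (as for matrices); only the values on
  \<open>tensor_idx N I\<close> matter.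
\<close>
type_synonym tensor = "(nat \<Rightarrow> nat) \<Rightarrow> real"

definition tensor_idx :: "nat \<Rightarrow> (nat \<Rightarrow> nat) \<Rightarrow> (nat \<Rightarrow> nat) set" where
  "tensor_idx N I = (\<Pi>\<^sub>E n\<in>{1..N}. {..<I n})"

definition tensor_norm :: "nat \<Rightarrow> (nat \<Rightarrow> nat) \<Rightarrow> tensor \<Rightarrow> real" where
  "tensor_norm N I A = sqrt (\<Sum>i\<in>tensor_idx N I. (A i)\<^sup>2)"

definition codim :: "nat \<Rightarrow> (nat \<Rightarrow> nat) \<Rightarrow> nat \<Rightarrow> nat" where
  "codim N I n = (\<Prod>m\<in>{1..N} - {n}. I m)"

definition min_dim :: "nat \<Rightarrow> (nat \<Rightarrow> nat) \<Rightarrow> nat \<Rightarrow> nat" where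
  "min_dim N I n = min (I n) (codim N I n)"

text \<open>
  The columns of the mode-\<open>n\<close> unfolding are ordered with the first mode varying fastest: column \<open>c\<close>
  is the fiber at the multi-index whose entries other than the \<open>n\<close>-th are the mixed-radix digits
  of \<open>c\<close>.
\<close>
definition unfolding_mat :: "nat \<Rightarrow> (nat \<Rightarrow> nat) \<Rightarrow> tensor \<Rightarrow> nat \<Rightarrow> real mat" where
  "unfolding_mat N I A n = Matrix.mat (I n) (codim N I n)
     (\<lambda>(r, c). A (\<lambda>m\<in>{1..N}. if m = n then r
                              else (c div (\<Prod>l\<in>{1..<m} - {n}. I l)) mod I m))"

definition mode_prod :: "nat \<Rightarrow> tensor \<Rightarrow> real mat \<Rightarrow> tensor" where
  "mode_prod n A B = (\<lambda>i. \<Sum>k<dim_col B. A (i(n := k)) * B $$ (i n, k))"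

definition project_tensor :: "nat \<Rightarrow> tensor \<Rightarrow> (nat \<Rightarrow> real mat) \<Rightarrow> tensor" where
  "project_tensor N A Q = fold (\<lambda>n T. mode_prod n T (Q n * transpose_mat (Q n))) [1..<Suc N] A"

text \<open>\<open>tail_norm B k\<close> is \<open>\<Delta>\<^sub>k(B)\<close> and \<open>tail_norm_pow B k q\<close> is \<open>\<Delta>\<^sub>k(B, q)\<close>.\<close>
definition tail_norm :: "real mat \<Rightarrow> nat \<Rightarrow> real" where
  "tail_norm B k = sqrt (\<Sum>i = k..min (dim_row B) (dim_col B). sing_val i B ^ 2)"

definition tail_norm_pow :: "real mat \<Rightarrow> nat \<Rightarrow> nat \<Rightarrow> real" where
  "tail_norm_pow B k q = sqrt (\<Sum>i = k..min (dim_row B) (dim_col B). sing_val i B ^ (4 * q))"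

definition standard_gaussian_mat :: "'w measure \<Rightarrow> nat \<Rightarrow> nat \<Rightarrow> ('w \<Rightarrow> real mat) \<Rightarrow> bool" where
  "standard_gaussian_mat M m l G \<longleftrightarrow>
     (\<forall>\<omega>\<in>space M. G \<omega> \<in> carrier_mat m l) \<and>
     prob_space.indep_vars M (\<lambda>_. borel) (\<lambda>(i, j) \<omega>. G \<omega> $$ (i, j)) ({..<m} \<times> {..<l}) \<and>
     (\<forall>i<m. \<forall>j<l. distributed M lborel (\<lambda>\<omega>. G \<omega> $$ (i, j)) std_normal_density)"

definition random_mat :: "'w measure \<Rightarrow> nat \<Rightarrow> nat \<Rightarrow> ('w \<Rightarrow> real mat) \<Rightarrow> bool" where
  "random_mat M m l Q \<longleftrightarrow>
     (\<forall>\<omega>\<in>space M. Q \<omega> \<in> carrier_mat m l) \<and>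
     (\<forall>i<m. \<forall>j<l. (\<lambda>\<omega>. Q \<omega> $$ (i, j)) \<in> borel_measurable M)"

text \<open>
  \<open>Q\<close> is an admissible factor with \<open>r\<close> columns for the sketch \<open>(B B\<^sup>T)\<^sup>q G\<close> of \<open>B\<close>. The
  algorithm does not determine \<open>Q\<close>, so this is a relation.
\<close>
definition power_sketch_factor ::
  "real mat \<Rightarrow> nat \<Rightarrow> nat \<Rightarrow> nat \<Rightarrow> real mat \<Rightarrow> real mat \<Rightarrow> bool" where
  "power_sketch_factor B r K q G Q \<longleftrightarrow>
     (let C = (B * transpose_mat B) ^\<^sub>m q * G in
        Q \<in> carrier_mat (dim_row B) r \<and> orthonormal_mat Q \<and>
        (\<exists>R \<in> carrier_mat r (r + K).
           frob_norm (Q * R - C) \<le> sqrt (\<Sum>k = r + 1..r + K. (sing_val k C)\<^sup>2)))"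

text \<open>
  \<open>Q 1, \<dots>, Q N\<close> are outputs of the randomized T-HOSVD algorithm with power scheme, driven by the
  Gaussian matrices \<open>G 1, \<dots>, G N\<close>. Nothing is required about the joint law of the \<open>G n\<close>; in
  particular they may be independent.
\<close>
definition randomized_thosvd_power ::
  "'w measure \<Rightarrow> nat \<Rightarrow> (nat \<Rightarrow> nat) \<Rightarrow> tensor \<Rightarrow> (nat \<Rightarrow> nat) \<Rightarrow> nat \<Rightarrow> nat \<Rightarrow>
   (nat \<Rightarrow> 'w \<Rightarrow> real mat) \<Rightarrow> (nat \<Rightarrow> 'w \<Rightarrow> real mat) \<Rightarrow> bool" where
  "randomized_thosvd_power M N I A \<mu> K q G Q \<longleftrightarrow>
     (\<forall>n\<in>{1..N}.
        standard_gaussian_mat M (I n) (\<mu> n + K) (G n) \<and>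
        random_mat M (I n) (\<mu> n) (Q n) \<and>
        (\<forall>\<omega>\<in>space M. power_sketch_factor (unfolding_mat N I A n) (\<mu> n) K q (G n \<omega>) (Q n \<omega>)))"

end

theory Submission
  imports Defs
begin

text \<open>
  Let \<open>B\<close> be an unfolding, \<open>B B\<^sup>T = U diag(\<tau>) U\<^sup>T\<close>, and \<open>W = U\<^sup>T G\<close> with upper \<open>\<mu>\<close> rows
  \<open>W\<^sub>1\<close> and lower rows \<open>W\<^sub>2\<close>. By the Eckart-Young bound the residual of the sketch \<open>C = U diag(\<tau>\<^sup>q) W\<close> is at
  most \<open>X = \<parallel>diag(\<tau>\<^sub>2\<^sup>q) W\<^sub>2\<parallel>\<close>; cancelling \<open>W\<^sub>1\<close>, whose smallest singular value is \<open>s\<close>, gives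
  \<open>\<parallel>B - Q Q\<^sup>T B\<parallel> \<le> 2 X / (s \<sigma>\<^sub>\<mu>\<^bsup>2q - 1\<^esup>) + \<Delta>\<close>. Telescoping over the modes reduces the tensor
  error to the sum of these.

  Since \<open>X / s\<close> has to exceed \<open>\<Delta>(q)\<close> times a constant that leaves a factor \<open>2\<surd>2\<close> of slack over its
  typical size, one bounds its tail directly instead of bounding \<open>W\<^sub>1\<close> and \<open>W\<^sub>2\<close> separately; the
  middle term of the failure probability alone then suffices. The smallest singular value is probed
  by an independent Gaussian vector \<open>h\<close>: the minimum of \<open>\<parallel>W\<^sub>1\<^sup>T z\<parallel>\<close> on \<open>\<langle>z, h\<rangle> = 1\<close> is, after a
  rotation, \<open>1 / \<parallel>h\<parallel>\<close> times the distance of one Gaussian row from the span of the others, a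
  chi variable with \<open>K + 1\<close> degrees of freedom, while for the minimizing direction \<open>x\<close> the number
  \<open>\<langle>x, h\<rangle>\<close> is a standard Gaussian, whose Laplace-type integral \<open>E exp (- k\<^sup>2 / (2 g\<^sup>2))\<close> is at least
  \<open>exp (- k) / 2\<close>.
\<close>

section \<open>Spectral theorem and singular values\<close>

text \<open>The smallest singular value is a minimum under the quadratic condition |z| = 1, attained
  in a direction that depends on the matrix. The probe replaces this by the linear condition <z, h>
  = 1, under which the minimum is explicit. A supremum over all \<open>z\<close> dominates the value
  at any direction, so no direction has to be selected measurably. The exponential parameter is
  tuned by minimising exp(a) / a^k over \<open>a\<close>. The minimum is at
  \<open>a = k = K + 1\<close>, which produces the factor (e / (K + 1))^(K + 1) of the middle term.
  With \<open>l = \<mu> + K\<close> columns, the two moments that remain cost at most l^(k/2) and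
  (sqrt e * l)^(k/2), against a squared threshold of at least 8 l^2. The surplus (sqrt e / 8)^(k/2)
  has to pay for the factor 2 of the Laplace integral and for the square root in the middle term,
  which it does from k = 3 on. The case \<open>K = 1\<close> is excluded numerically: there the
  middle term exceeds 1/2, there are at least two modes, and so \<open>p\<close> would be
  negative.\<close>

lemmas scalar_prod_lessThan = scalar_prod_def lessThan_atLeast0

text \<open>Reflection in the hyperplane orthogonal to the difference of \<open>v\<close> and the
  first unit vector: it exchanges the two, so \<open>v\<close> becomes column 0. A symmetric
  involution is its own inverse, convenient for the deflation below. If \<open>v\<close> is the
  first unit vector, there is no such hyperplane, hence the case split.\<close>

lemma unit_vector_householder:
  fixes v :: "nat \<Rightarrow> real"
  assumes n: "0 < n" and v: "(\<Sum>i<n. (v i)\<^sup>2) = 1"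
  obtains H where "H \<in> carrier_mat n n" "H\<^sup>T = H" "H * H = 1\<^sub>m n" "\<And>i. i < n \<Longrightarrow> H $$ (i, 0) = v i"
proof (cases "\<forall>i<n. v i = (if i = 0 then 1 else 0)")
  case True
  show ?thesis
    by (rule that[of "1\<^sub>m n"]) (use True n in auto)
next
  case False
  define w where "w i = v i - (if i = 0 then 1 else 0)" for i
  define s where "s = (\<Sum>i<n. (w i)\<^sup>2)"
  from False obtain i where "i < n" "w i \<noteq> 0" by (auto simp: w_def)
  then have s: "s > 0" unfolding s_def by (intro sum_pos2[of _ i]) auto
  have v1: "(\<Sum>i<n. v i * (if i = 0 then 1 else 0)) = v 0"
    using n by (simp add: sum.delta if_distrib cong: if_cong)
  have d1: "(\<Sum>i<n. (if i = 0 then 1 else 0::real)\<^sup>2) = 1"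
    using n by (simp add: if_distrib[of "\<lambda>x. x\<^sup>2"] sum.delta cong: if_cong)
  have "s = (\<Sum>i<n. (v i)\<^sup>2 - 2 * (v i * (if i = 0 then 1 else 0)) + (if i = 0 then 1 else 0::real)\<^sup>2)"
    unfolding s_def w_def by (intro sum.cong refl) (simp add: power2_eq_square algebra_simps)
  also have "\<dots> = 2 - 2 * v 0"
    unfolding sum.distrib sum_subtractf v1 d1 v sum_distrib_left[symmetric] by simp
  finally have s2: "s = 2 - 2 * v 0" .
  define H where "H = Matrix.mat n n (\<lambda>(i, j). (if i = j then 1 else 0) - 2 * w i * w j / s)"
  have H: "H \<in> carrier_mat n n" by (simp add: H_def)
  have HT: "H\<^sup>T = H" by (rule eq_matI) (auto simp: H_def)
  have HH: "H * H = 1\<^sub>m n"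
  proof (rule eq_matI)
    fix i j assume ij: "i < dim_row (1\<^sub>m n :: real mat)" "j < dim_col (1\<^sub>m n :: real mat)"
    then have i: "i < n" and j: "j < n" by auto
    have "(H * H) $$ (i, j) = (\<Sum>k<n. ((if i = k then 1 else 0) - 2 * w i * w k / s)
        * ((if k = j then 1 else 0) - 2 * w k * w j / s))"
      using i j by (simp add: H_def scalar_prod_def lessThan_atLeast0 mult.assoc)
    also have "\<dots> = (\<Sum>k<n. (if k = i then (if i = j then 1 else 0) - 2 * w i * w j / s else 0)
        - (if k = j then 2 * w i * w j / s else 0) + (4 * w i * w j / s\<^sup>2) * (w k)\<^sup>2)"
      by (intro sum.cong refl) (auto simp: algebra_simps power2_eq_square)
    also have "\<dots> = (if i = j then 1 else 0) - 4 * w i * w j / s + (4 * w i * w j / s\<^sup>2) * s"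
      unfolding sum.distrib sum_subtractf sum_distrib_left[symmetric] s_def[symmetric]
      using i j by (simp add: sum.delta)
    also have "\<dots> = 1\<^sub>m n $$ (i, j)"
      using i j s by (simp add: power2_eq_square)
    finally show "(H * H) $$ (i, j) = 1\<^sub>m n $$ (i, j)" .
  qed (simp_all add: H_def)
  have "H $$ (i, 0) = v i" if "i < n" for i
  proof -
    have "H $$ (i, 0) = (if i = 0 then 1 else 0) - 2 * w i * (v 0 - 1) / s"
      using that n by (simp add: H_def w_def)
    also have "2 * w i * (v 0 - 1) / s = - w i"
      using s by (simp add: s2 field_simps)
    finally show ?thesis by (simp add: w_def)
  qed
  then show ?thesis using that H HT HH by blast
qed

lemma hermitian_eigenvalue_real:
  fixes A :: "real mat"
  assumes A: "A \<in> carrier_mat n n" and sym: "A\<^sup>T = A"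
    and ev: "eigenvector (map_mat complex_of_real A) v e"
  shows "cnj e = e"
proof -
  have v: "v \<in> carrier_vec n" and v0: "v \<noteq> 0\<^sub>v n"
    and Av: "map_mat complex_of_real A *\<^sub>v v = e \<cdot>\<^sub>v v"
    using ev A by (auto simp: eigenvector_def)
  have Aij: "A $$ (i, j) = A $$ (j, i)" if "i < n" "j < n" for i j
    using that A sym by (metis carrier_matD index_transpose_mat(1))
  have row: "e * v $ i = (\<Sum>j<n. of_real (A $$ (i, j)) * v $ j)" if "i < n" for i
  proof -
    have "e * v $ i = (e \<cdot>\<^sub>v v) $ i" using that v by simp
    also have "\<dots> = (map_mat complex_of_real A *\<^sub>v v) $ i" by (simp add: Av)
    finally show ?thesis using that v A by (simp add: scalar_prod_lessThan)
  qed
  define S where "S = (\<Sum>i<n. v $ i * cnj (v $ i))"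
  have "e * S = (\<Sum>i<n. \<Sum>j<n. of_real (A $$ (i, j)) * v $ j * cnj (v $ i))"
    unfolding S_def sum_distrib_left
    by (intro sum.cong refl) (simp add: mult.assoc[symmetric] row sum_distrib_right)
  also have "\<dots> = (\<Sum>j<n. v $ j * (\<Sum>i<n. of_real (A $$ (j, i)) * cnj (v $ i)))"
    by (subst sum.swap) (auto simp: sum_distrib_left Aij ac_simps intro!: sum.cong)
  also have "\<dots> = (\<Sum>j<n. v $ j * cnj (e * v $ j))"
    by (intro sum.cong refl) (simp add: row)
  also have "\<dots> = cnj e * S"
    by (simp add: S_def sum_distrib_left ac_simps)
  finally have "e * S = cnj e * S" .
  moreover have "S \<noteq> 0"
  proof -
    have "S = of_real (\<Sum>i<n. (cmod (v $ i))\<^sup>2)"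
      unfolding S_def of_real_sum by (intro sum.cong refl) (simp only: complex_norm_square)
    moreover obtain i where "i < n" "v $ i \<noteq> 0" using v v0 by (metis eq_vecI carrier_vecD index_zero_vec)
    then have "(\<Sum>i<n. (cmod (v $ i))\<^sup>2) > 0" by (intro sum_pos2[of _ i]) auto
    ultimately show ?thesis by (simp only: of_real_eq_0_iff)
  qed
  ultimately show ?thesis by simp
qed

text \<open>Over the complex numbers the polynomial splits; its roots are eigenvalues of a symmetric
  real matrix, hence real, and the injective embedding of real polynomials brings the factorisation
  back.\<close>

lemma symmetric_char_poly_splits:
  fixes A :: "real mat"
  assumes A: "A \<in> carrier_mat n n" and sym: "A\<^sup>T = A"
  obtains es where "char_poly A = (\<Prod>e\<leftarrow>es. [:- e, 1:])" "length es = n"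
proof -
  interpret poly_hom: map_poly_inj_idom_hom complex_of_real ..
  let ?C = "map_mat complex_of_real A"
  have C: "?C \<in> carrier_mat n n" using A by simp
  obtain as where as: "char_poly ?C = (\<Prod>a\<leftarrow>as. [:- a, 1:])" "length as = n"
    using char_poly_factorized[OF C] by blast
  have re: "of_real (Re a) = a" if "a \<in> set as" for a
  proof -
    have "poly (char_poly ?C) a = 0"
      unfolding as using that by (induction as) auto
    then have "eigenvalue ?C a" using eigenvalue_root_char_poly[OF C] by simp
    then obtain v where "eigenvector ?C v a" by (auto simp: eigenvalue_def)
    then have "cnj a = a" by (rule hermitian_eigenvalue_real[OF A sym])
    then show ?thesis by (metis complex_cnj_cancel_iff Reals_cnj_iff complex_is_Real_iff of_real_Re)
  qed
  have "map_poly complex_of_real (char_poly A) = (\<Prod>a\<leftarrow>as. [:- a, 1:])"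
    using of_real_hom.char_poly_hom[OF A] as by metis
  also have "\<dots> = (\<Prod>a\<leftarrow>as. map_poly complex_of_real [:- Re a, 1:])"
    by (intro arg_cong[where f = prod_list] map_cong refl) (simp add: re of_real_hom.map_poly_pCons_hom)
  also have "\<dots> = map_poly complex_of_real (\<Prod>e\<leftarrow>map Re as. [:- e, 1:])"
    by (simp add: poly_hom.hom_prod_list o_def)
  finally have "char_poly A = (\<Prod>e\<leftarrow>map Re as. [:- e, 1:])"
    by (rule poly_hom.injectivity)
  then show ?thesis using that[of "map Re as"] as by simp
qed

text \<open>Deflation along a given list of roots. The list is arbitrary so that the order on the
  diagonal can be prescribed: later it is the decreasing list from which \<open>sing_val\<close>
  reads.\<close>

lemma real_symmetric_spectral:
  fixes A :: "real mat"
  assumes "A \<in> carrier_mat n n" "A\<^sup>T = A" "char_poly A = (\<Prod>e\<leftarrow>es. [:- e, 1:])"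
  shows "\<exists>U \<in> carrier_mat n n. U\<^sup>T * U = 1\<^sub>m n \<and> A = U * mat_diag n (\<lambda>i. es ! i) * U\<^sup>T"
  using assms
proof (induction es arbitrary: n A)
  case Nil
  then have "n = 0" using degree_monic_char_poly[of A n] by simp
  then show ?case using Nil by (intro bexI[of _ "1\<^sub>m n"]) auto
next
  case (Cons e es n A)
  note A = Cons.prems(1) and sym = Cons.prems(2)
  have cp: "char_poly A = [:- e, 1:] * (\<Prod>e\<leftarrow>es. [:- e, 1:])" using Cons.prems by simp
  have "poly (char_poly A) e = 0" unfolding cp by simp
  then have "eigenvalue A e" using eigenvalue_root_char_poly[OF A] by simp
  then obtain x where x: "x \<in> carrier_vec n" "x \<noteq> 0\<^sub>v n" "A *\<^sub>v x = e \<cdot>\<^sub>v x"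
    using A by (auto simp: eigenvalue_def eigenvector_def)
  obtain i0 where i0: "i0 < n" "vec_index x i0 \<noteq> 0"
    using x by (metis eq_vecI carrier_vecD index_zero_vec)
  define c where "c = sqrt (\<Sum>i<n. (vec_index x i)\<^sup>2)"
  have c: "c > 0" unfolding c_def using i0
    by (intro real_sqrt_gt_zero sum_pos2[of _ i0]) auto
  define v where "v i = vec_index x i / c" for i
  have v1: "(\<Sum>i<n. (v i)\<^sup>2) = 1"
  proof -
    have "(\<Sum>i<n. (v i)\<^sup>2) = (\<Sum>i<n. (vec_index x i)\<^sup>2) / c\<^sup>2"
      by (simp add: v_def power_divide sum_divide_distrib)
    also have "(\<Sum>i<n. (vec_index x i)\<^sup>2) = c\<^sup>2"
      by (simp add: c_def sum_nonneg)
    finally show ?thesis using c by simp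
  qed
  have Av: "(\<Sum>j<n. A $$ (i, j) * v j) = e * v i" if "i < n" for i
  proof -
    have "(\<Sum>j<n. A $$ (i, j) * vec_index x j) = vec_index (A *\<^sub>v x) i"
      using that A x(1) by (simp add: scalar_prod_lessThan)
    also have "\<dots> = e * vec_index x i" using that x by simp
    finally show ?thesis using c by (simp add: v_def sum_divide_distrib[symmetric])
  qed
  from i0 have n0: "0 < n" by simp
  obtain H where H: "H \<in> carrier_mat n n" "H\<^sup>T = H" "H * H = 1\<^sub>m n"
    and Hv: "\<And>i. i < n \<Longrightarrow> H $$ (i, 0) = v i"
    using unit_vector_householder[OF n0 v1] by blast
  \<comment> \<open>Column 0 of \<open>H\<close> is the eigenvector, so conjugation turns column 0
    of \<open>A\<close> into \<open>e\<close> times the first unit vector. Symmetry does the same to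
    row 0, and a block of size 1 splits off.\<close>
  define B where "B = H * A * H"
  have B: "B \<in> carrier_mat n n" using A H by (simp add: B_def)
  have BT: "B\<^sup>T = B" using A H sym unfolding B_def
    by (simp add: transpose_mult[of _ n n _ n])
  have B0: "B $$ (i, 0) = (if i = 0 then e else 0)" if "i < n" for i
  proof -
    have *: "H * A * H = H * (A * H)" using A H by simp
    have AH: "(A * H) $$ (j, 0) = e * H $$ (j, 0)" if "j < n" for j
      using that A H n0 Av[OF that] by (simp add: scalar_prod_lessThan Hv)
    have "B $$ (i, 0) = (\<Sum>j<n. H $$ (i, j) * (A * H) $$ (j, 0))"
      unfolding B_def * using that A H n0
      by (subst index_mult_mat) (auto simp: scalar_prod_lessThan)
    also have "\<dots> = e * (\<Sum>j<n. H $$ (i, j) * H $$ (j, 0))"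
      by (simp add: AH sum_distrib_left ac_simps)
    also have "(\<Sum>j<n. H $$ (i, j) * H $$ (j, 0)) = (H * H) $$ (i, 0)"
      using that H(1) n0 by (simp add: scalar_prod_lessThan)
    finally show ?thesis using that n0 H(3) by simp
  qed
  have B0': "B $$ (0, i) = (if i = 0 then e else 0)" if "i < n" for i
    using B0[OF that] BT B that n0 by (metis carrier_matD index_transpose_mat(1))
  obtain m where n: "n = Suc m" using n0 by (cases n) auto
  define A3 where "A3 = Matrix.mat m m (\<lambda>(i, j). B $$ (Suc i, Suc j))"
  have A3: "A3 \<in> carrier_mat m m" by (simp add: A3_def)
  have A3T: "A3\<^sup>T = A3"
  proof (rule eq_matI)
    fix i j assume "i < dim_row A3" "j < dim_col A3"
    then have "i < m" "j < m" by (auto simp: A3_def)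
    moreover from this have "B $$ (Suc j, Suc i) = B $$ (Suc i, Suc j)"
      using BT B n by (metis Suc_less_eq carrier_matD index_transpose_mat(1))
    ultimately show "A3\<^sup>T $$ (i, j) = A3 $$ (i, j)" by (simp add: A3_def)
  qed (auto simp: A3_def)
  define E where "E = Matrix.mat 1 1 (\<lambda>_. e)"
  have E: "E \<in> carrier_mat 1 1" by (simp add: E_def)
  have Bblk: "B = four_block_mat E (0\<^sub>m 1 m) (0\<^sub>m m 1) A3"
  proof (rule eq_matI)
    fix i j assume "i < dim_row (four_block_mat E (0\<^sub>m 1 m) (0\<^sub>m m 1) A3)"
      "j < dim_col (four_block_mat E (0\<^sub>m 1 m) (0\<^sub>m m 1) A3)"
    then have "i < n" "j < n" by (auto simp: n E_def A3_def)
    then show "B $$ (i, j) = four_block_mat E (0\<^sub>m 1 m) (0\<^sub>m m 1) A3 $$ (i, j)"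
      using B0[of i] B0'[of j] by (cases i; cases j) (auto simp: n E_def A3_def)
  qed (use B n in \<open>auto simp: E_def A3_def\<close>)
  have "similar_mat_wit A B H H"
  proof (rule similar_mat_witI[OF H(3) H(3) _ A B H(1) H(1)])
    have "H * B * H = (H * H) * A * (H * H)"
      using A H(1) by (simp add: B_def assoc_mult_mat[of _ n n _ n _ n])
    also have "\<dots> = A" unfolding H(3) using A by simp
    finally show "A = H * B * H" by simp
  qed
  then have "char_poly A = char_poly B"
    using char_poly_similar unfolding similar_mat_def by blast
  also have "\<dots> = char_poly E * char_poly A3"
    unfolding Bblk by (rule char_poly_four_block_zeros_col[OF E _ A3]) simp
  also have "char_poly E = [:- e, 1:]"
    by (simp add: E_def char_poly_defs det_def sign_def)
  finally have "char_poly A3 = (\<Prod>e\<leftarrow>es. [:- e, 1:])"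
    unfolding cp by (metis mult_cancel_left pCons_eq_0_iff zero_neq_one)
  from Cons.IH[OF A3 A3T this] obtain U where U: "U \<in> carrier_mat m m" "U\<^sup>T * U = 1\<^sub>m m"
    and A3U: "A3 = U * mat_diag m (\<lambda>i. es ! i) * U\<^sup>T" by blast
  define P where "P = four_block_mat (1\<^sub>m 1) (0\<^sub>m 1 m) (0\<^sub>m m 1) U"
  have P: "P \<in> carrier_mat n n" unfolding P_def n
    using four_block_carrier_mat[of "1\<^sub>m 1" 1 1 U m m] U by simp
  have PT: "P\<^sup>T = four_block_mat (1\<^sub>m 1) (0\<^sub>m 1 m) (0\<^sub>m m 1) U\<^sup>T" unfolding P_def
    by (subst transpose_four_block_mat[of _ 1 1 _ m _ m]) (use U in auto)
  have one: "four_block_mat (1\<^sub>m 1) (0\<^sub>m 1 m) (0\<^sub>m m 1) (1\<^sub>m m) = (1\<^sub>m n :: real mat)"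
    unfolding n by (rule eq_matI) auto
  have PTP: "P\<^sup>T * P = 1\<^sub>m n"
    unfolding PT unfolding P_def
    by (subst mult_four_block_mat[of _ 1 1 _ m _ m _ _ 1 _ m]) (use U one in auto)
  define D where "D = mat_diag n (\<lambda>i. (e # es) ! i)"
  have D: "D = four_block_mat E (0\<^sub>m 1 m) (0\<^sub>m m 1) (mat_diag m (\<lambda>i. es ! i))"
    unfolding D_def n by (rule eq_matI) (auto simp: mat_diag_def E_def)
  have PD: "P * D = four_block_mat E (0\<^sub>m 1 m) (0\<^sub>m m 1) (U * mat_diag m (\<lambda>i. es ! i))"
    unfolding D P_def
    by (subst mult_four_block_mat[of _ 1 1 _ m _ m _ _ 1 _ m])
       (use U E in \<open>auto simp: mult_carrier_mat[of _ m m _ m] left_mult_zero_mat[of _ m m]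
         right_mult_zero_mat[of _ m m]\<close>)
  have B_PDP: "B = P * D * P\<^sup>T"
    unfolding PD PT Bblk A3U
    by (subst mult_four_block_mat[of _ 1 1 _ m _ m _ _ 1 _ m])
       (use U E in \<open>auto simp: mult_carrier_mat[of _ m m _ m] left_mult_zero_mat[of _ m m]
         right_mult_zero_mat[of _ m m]\<close>)
  have Dc: "D \<in> carrier_mat n n" by (simp add: D_def)
  have HP: "H * P \<in> carrier_mat n n" using H P by simp
  have HPT: "(H * P)\<^sup>T = P\<^sup>T * H" using H P by (simp add: transpose_mult[of _ n n _ n])
  have PTc: "P\<^sup>T \<in> carrier_mat n n" using P by simp
  have "(H * P)\<^sup>T * (H * P) = P\<^sup>T * ((H * H) * P)"
    unfolding HPT using H(1) P PTc by (simp add: assoc_mult_mat[of _ n n _ n _ n])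
  then have 1: "(H * P)\<^sup>T * (H * P) = 1\<^sub>m n" using H P PTP by simp
  have "A = (H * H) * A * (H * H)" using A H by simp
  also have "\<dots> = H * B * H"
    unfolding B_def using A H(1) by (simp add: assoc_mult_mat[of _ n n _ n _ n])
  also have "\<dots> = H * P * D * (H * P)\<^sup>T"
    unfolding B_PDP HPT using H(1) P PTc Dc by (simp add: assoc_mult_mat[of _ n n _ n _ n])
  finally show ?case using 1 HP unfolding D_def by blast
qed

text \<open>Sylvester's identity from one block matrix \<open>M\<close>: clearing its lower left
  block from the right leaves the characteristic matrix of \<open>A * B\<close>, clearing it from
  the left, after scaling by the indeterminate, that of \<open>B * A\<close>. It links
  \<open>B\<^sup>T * B\<close>, which defines singular values, with \<open>B * B\<^sup>T\<close>,
  which the sketch uses.\<close>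

lemma char_poly_mult_commute:
  fixes A B :: "real mat"
  assumes A: "A \<in> carrier_mat m n" and B: "B \<in> carrier_mat n m"
  shows "[:0, 1:] ^ n * char_poly (A * B) = [:0, 1:] ^ m * char_poly (B * A)"
proof -
  let ?X = "[:0, 1:] :: real poly"
  let ?c = "map_mat (\<lambda>a. [:a:] :: real poly)"
  let ?n = "map_mat (\<lambda>a. [:- a:] :: real poly)"
  have c: "?c A \<in> carrier_mat m n" "?n B \<in> carrier_mat n m" "?c B \<in> carrier_mat n m" using A B by auto
  have sumpoly: "[:\<Sum>i\<in>S. f i:] = (\<Sum>i\<in>S. [:f i:] :: real poly)" for f :: "nat \<Rightarrow> real" and S
    proof (induction S rule: infinite_finite_induct)
    case (insert x F)
    have "[:f x + sum f F:] = [:f x:] + [:sum f F:]" by simp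
    then show ?case using insert by (metis sum.insert)
  qed auto
  define M where "M = four_block_mat (?X \<cdot>\<^sub>m 1\<^sub>m m) (?c A) (?c B) (1\<^sub>m n)"
  define L where "L = four_block_mat (1\<^sub>m m) (0\<^sub>m m n) (?n B) (1\<^sub>m n)"
  define L' where "L' = four_block_mat (1\<^sub>m m) (0\<^sub>m m n) (?n B) (?X \<cdot>\<^sub>m 1\<^sub>m n)"
  have M: "M \<in> carrier_mat (m + n) (m + n)" unfolding M_def by (rule four_block_carrier_mat) auto
  have L: "L \<in> carrier_mat (m + n) (m + n)" unfolding L_def by (rule four_block_carrier_mat) auto
  have L': "L' \<in> carrier_mat (m + n) (m + n)" unfolding L'_def by (rule four_block_carrier_mat) auto
  have cpAB: "?X \<cdot>\<^sub>m 1\<^sub>m m + ?c A * ?n B = char_poly_matrix (A * B)"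
    by (rule eq_matI) (use A B in \<open>auto simp: char_poly_matrix_def scalar_prod_def sumpoly sum_negf[symmetric] mult.commute\<close>)
  have cpBA: "?n B * ?c A + ?X \<cdot>\<^sub>m 1\<^sub>m n = char_poly_matrix (B * A)"
    by (rule eq_matI) (use A B in \<open>auto simp: char_poly_matrix_def scalar_prod_def sumpoly sum_negf[symmetric] mult.commute\<close>)
  have cpm: "char_poly_matrix (A * B) \<in> carrier_mat m m" "char_poly_matrix (B * A) \<in> carrier_mat n n"
    using A B by (auto intro!: char_poly_matrix_closed)
  have zero1: "?c B + ?n B = 0\<^sub>m n m" by (rule eq_matI) (use B in auto)
  have zero3: "[:0, 1:] \<cdot>\<^sub>m (?n B) + [:0, 1:] \<cdot>\<^sub>m (?c B) = 0\<^sub>m n m" by (rule eq_matI) (use B in auto)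
  have zero2: "?n B * (?X \<cdot>\<^sub>m 1\<^sub>m m) + (?X \<cdot>\<^sub>m 1\<^sub>m n) * ?c B = 0\<^sub>m n m"
    using c by (simp add: mult_smult_distrib[of _ n m _ m] mult_smult_assoc_mat[of _ n n _ m] zero3)
  have M_L: "M * L = four_block_mat (char_poly_matrix (A * B)) (?c A) (0\<^sub>m n m) (1\<^sub>m n)"
    unfolding M_def L_def
    by (subst mult_four_block_mat[of _ m m _ n _ n _ _ m _ n]) (use c zero1 cpAB in auto)
  have L_M: "L' * M = four_block_mat (?X \<cdot>\<^sub>m 1\<^sub>m m) (?c A) (0\<^sub>m n m) (char_poly_matrix (B * A))"
    unfolding M_def L'_def
    by (subst mult_four_block_mat[of _ m m _ n _ n _ _ m _ n]) (use c zero2 cpBA in auto)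
  have "det M * det L = char_poly (A * B)"
    unfolding det_mult[OF M L, symmetric] M_L char_poly_def
    by (subst det_four_block_mat_lower_left_zero[of _ m _ n]) (use c cpm in auto)
  moreover have "det L = 1" unfolding L_def
    by (subst det_four_block_mat_upper_right_zero[of _ m _ n]) (use c in auto)
  moreover have "det L' * det M = ?X ^ m * char_poly (B * A)"
    unfolding det_mult[OF L' M, symmetric] L_M char_poly_def
    by (subst det_four_block_mat_lower_left_zero[of _ m _ n]) (use c cpm in \<open>auto simp: det_smult\<close>)
  moreover have "det L' = ?X ^ n" unfolding L'_def
    by (subst det_four_block_mat_upper_right_zero[of _ m _ n]) (use c in \<open>auto simp: det_smult\<close>)
  ultimately show ?thesis by simp
qed

section \<open>Orthogonal families and quadratic forms\<close>

lemma sum_rotate: "(\<Sum>a\<in>A. \<Sum>r\<in>B. \<Sum>s\<in>C. f a r s) = (\<Sum>r\<in>B. \<Sum>s\<in>C. \<Sum>a\<in>A. f a r s)"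
  by (subst sum.swap) (intro sum.cong refl sum.swap)

text \<open>The index set is arbitrary so that pairs, the entries of a matrix, can serve as indices.
  Demanding the row and the column relations together makes transposition immediate.\<close>

definition orthogonal_fam :: "'i set \<Rightarrow> ('i \<Rightarrow> 'i \<Rightarrow> real) \<Rightarrow> bool" where
  "orthogonal_fam J u \<longleftrightarrow>
     (\<forall>i\<in>J. \<forall>j\<in>J. (\<Sum>r\<in>J. u i r * u j r) = (if i = j then 1 else 0)) \<and>
     (\<forall>r\<in>J. \<forall>s\<in>J. (\<Sum>i\<in>J. u i r * u i s) = (if r = s then 1 else 0))"

lemma orthogonal_fam_transpose: "orthogonal_fam J u \<Longrightarrow> orthogonal_fam J (\<lambda>i r. u r i)"
  by (auto simp: orthogonal_fam_def)

lemma orthogonal_fam_inverse: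
  assumes "orthogonal_fam J u" and "finite J" and "i \<in> J"
  shows "(\<Sum>r\<in>J. u i r * (\<Sum>j\<in>J. u j r * x j)) = x i"
proof -
  have "(\<Sum>r\<in>J. u i r * (\<Sum>j\<in>J. u j r * x j)) = (\<Sum>j\<in>J. x j * (\<Sum>r\<in>J. u i r * u j r))"
    unfolding sum_distrib_left by (subst sum.swap) (simp add: ac_simps)
  also have "\<dots> = (\<Sum>j\<in>J. if j = i then x i else 0)"
    using assms by (intro sum.cong refl) (auto simp: orthogonal_fam_def)
  finally show ?thesis using assms by (simp add: sum.delta)
qed

lemma orthogonal_fam_parseval:
  assumes "orthogonal_fam J u" and "finite J"
  shows "(\<Sum>i\<in>J. (\<Sum>r\<in>J. u i r * x r)\<^sup>2) = (\<Sum>r\<in>J. (x r)\<^sup>2)"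
proof -
  have "(\<Sum>i\<in>J. (\<Sum>r\<in>J. u i r * x r)\<^sup>2) = (\<Sum>i\<in>J. \<Sum>r\<in>J. x r * (u i r * (\<Sum>s\<in>J. u i s * x s)))"
    by (simp add: power2_eq_square sum_distrib_right ac_simps)
  also have "\<dots> = (\<Sum>r\<in>J. x r * (\<Sum>i\<in>J. u i r * (\<Sum>s\<in>J. u i s * x s)))"
    unfolding sum_distrib_left[of "x _"] by (rule sum.swap)
  also have "\<dots> = (\<Sum>r\<in>J. (x r)\<^sup>2)"
    using orthogonal_fam_inverse[OF orthogonal_fam_transpose[OF assms(1)] assms(2)]
    by (simp add: power2_eq_square)
  finally show ?thesis .
qed

lemma orthogonal_fam_of_mat:
  assumes U: "U \<in> carrier_mat n n" and UU: "U\<^sup>T * U = 1\<^sub>m n"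
  shows "orthogonal_fam {..<n} (\<lambda>i r. U $$ (r, i))"
proof -
  have UT: "U\<^sup>T \<in> carrier_mat n n" using U by simp
  have UU': "U * U\<^sup>T = 1\<^sub>m n" by (rule mat_mult_left_right_inverse[OF UT U UU])
  have "(\<Sum>r<n. U $$ (r, i) * U $$ (r, j)) = (U\<^sup>T * U) $$ (i, j)" if "i < n" "j < n" for i j
    using that U by (simp add: scalar_prod_lessThan)
  moreover have "(\<Sum>i<n. U $$ (r, i) * U $$ (s, i)) = (U * U\<^sup>T) $$ (r, s)" if "r < n" "s < n" for r s
    using that U by (simp add: scalar_prod_lessThan)
  ultimately show ?thesis by (simp add: orthogonal_fam_def UU UU')
qed

lemma mult_diag_mult_index:
  fixes P :: "real mat"
  assumes "P \<in> carrier_mat a n" "R \<in> carrier_mat n b" "i < a" "j < b"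
  shows "(P * mat_diag n t * R) $$ (i, j) = (\<Sum>k<n. t k * P $$ (i, k) * R $$ (k, j))"
  using assms by (simp add: mat_diag_mult_right[of _ a n] scalar_prod_def lessThan_atLeast0 ac_simps)

text \<open>The form depends on \<open>B\<close> only through its Gram matrix. One diagonalisation
  therefore serves all matrices sharing a Gram matrix, as the sketch and its rotated version
  do.\<close>

lemma gram_quadratic_form:
  fixes B U :: "real mat"
  assumes B: "B \<in> carrier_mat m n" and U: "U \<in> carrier_mat n n"
    and eq: "B\<^sup>T * B = U * mat_diag n t * U\<^sup>T"
  shows "(\<Sum>a<m. (\<Sum>r<n. B $$ (a, r) * z r)\<^sup>2) = (\<Sum>k<n. t k * (\<Sum>r<n. U $$ (r, k) * z r)\<^sup>2)"
proof -
  have UT: "U\<^sup>T \<in> carrier_mat n n" using U by simp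
  have "(\<Sum>a<m. (\<Sum>r<n. B $$ (a, r) * z r)\<^sup>2)
      = (\<Sum>a<m. \<Sum>r<n. \<Sum>s<n. z r * z s * (B $$ (a, r) * B $$ (a, s)))"
    by (simp add: power2_eq_square sum_product ac_simps)
  also have "\<dots> = (\<Sum>r<n. \<Sum>s<n. z r * z s * (\<Sum>a<m. B $$ (a, r) * B $$ (a, s)))"
    unfolding sum_distrib_left by (rule sum_rotate)
  also have "\<dots> = (\<Sum>r<n. \<Sum>s<n. z r * z s * (\<Sum>k<n. t k * U $$ (r, k) * U $$ (s, k)))"
  proof (intro sum.cong refl)
    fix r s assume rs: "r \<in> {..<n}" "s \<in> {..<n}"
    have "(\<Sum>a<m. B $$ (a, r) * B $$ (a, s)) = (B\<^sup>T * B) $$ (r, s)"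
      using rs B by (simp add: scalar_prod_lessThan)
    also have "\<dots> = (\<Sum>k<n. t k * U $$ (r, k) * U $$ (s, k))"
      unfolding eq using rs U by (subst mult_diag_mult_index[OF U UT]) auto
    finally show "z r * z s * (\<Sum>a<m. B $$ (a, r) * B $$ (a, s))
      = z r * z s * (\<Sum>k<n. t k * U $$ (r, k) * U $$ (s, k))" by simp
  qed
  also have "\<dots> = (\<Sum>k<n. \<Sum>r<n. \<Sum>s<n. t k * ((U $$ (r, k) * z r) * (U $$ (s, k) * z s)))"
    unfolding sum_distrib_left by (subst sum_rotate) (simp add: ac_simps)
  also have "\<dots> = (\<Sum>k<n. t k * (\<Sum>r<n. U $$ (r, k) * z r)\<^sup>2)"
    unfolding power2_eq_square unfolding sum_product unfolding sum_distrib_left ..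
  finally show ?thesis .
qed

section \<open>Decreasing eigenvalues and singular values\<close>

definition eigenvalues_desc :: "real mat \<Rightarrow> real list" where
  "eigenvalues_desc A = rev (sorted_list_of_multiset (proots (char_poly A)))"

lemma sing_val_eigenvalues_desc: "sing_val i B = sqrt (eigenvalues_desc (B\<^sup>T * B) ! (i - 1))"
  by (simp add: sing_val_def eigenvalues_desc_def)

lemma sorted_eigenvalues_desc: "sorted_wrt (\<ge>) (eigenvalues_desc A)"
  by (simp add: eigenvalues_desc_def sorted_wrt_rev)

lemma proots_linear_factors: "proots (\<Prod>e\<leftarrow>es. [:- e, 1:] :: real poly) = mset es"
proof (induction es)
  case (Cons e es)
  have "(\<Prod>e\<leftarrow>es. [:- e, 1:] :: real poly) \<noteq> 0" by (auto simp: prod_list_zero_iff)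
  then show ?case using Cons by (simp add: proots_mult del: mult_pCons_left)
qed simp

lemma eigenvalues_desc_props:
  fixes A :: "real mat"
  assumes A: "A \<in> carrier_mat n n" and sym: "A\<^sup>T = A"
  shows "length (eigenvalues_desc A) = n"
    and "char_poly A = (\<Prod>e\<leftarrow>eigenvalues_desc A. [:- e, 1:])"
    and "mset (eigenvalues_desc A) = proots (char_poly A)"
proof -
  obtain es where es: "char_poly A = (\<Prod>e\<leftarrow>es. [:- e, 1:])" "length es = n"
    using symmetric_char_poly_splits[OF A sym] .
  show m: "mset (eigenvalues_desc A) = proots (char_poly A)"
    by (simp add: eigenvalues_desc_def)
  then have ms: "mset (eigenvalues_desc A) = mset es"
    unfolding es(1) proots_linear_factors .
  then show "length (eigenvalues_desc A) = n" using es(2) by (metis size_mset)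
  show "char_poly A = (\<Prod>e\<leftarrow>eigenvalues_desc A. [:- e, 1:])"
    unfolding es(1) prod_mset_prod_list[symmetric] using ms by (metis mset_map)
qed

lemma gram_spectral:
  fixes B :: "real mat"
  assumes B: "B \<in> carrier_mat m d"
  obtains V where "V \<in> carrier_mat d d" "V\<^sup>T * V = 1\<^sub>m d"
    "B\<^sup>T * B = V * mat_diag d (\<lambda>i. eigenvalues_desc (B\<^sup>T * B) ! i) * V\<^sup>T"
proof -
  have G: "B\<^sup>T * B \<in> carrier_mat d d" using B by simp
  have sym: "(B\<^sup>T * B)\<^sup>T = B\<^sup>T * B" using B by (simp add: transpose_mult[of _ d m _ d])
  show ?thesis
    using real_symmetric_spectral[OF G sym eigenvalues_desc_props(2)[OF G sym]] that by blast
qed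

lemma eigenvalues_desc_gram_nonneg:
  fixes B :: "real mat"
  assumes B: "B \<in> carrier_mat m d" and i: "i < d"
  shows "0 \<le> eigenvalues_desc (B\<^sup>T * B) ! i"
proof -
  define t where "t i = eigenvalues_desc (B\<^sup>T * B) ! i" for i
  obtain V where V: "V \<in> carrier_mat d d" "V\<^sup>T * V = 1\<^sub>m d"
    and eq: "B\<^sup>T * B = V * mat_diag d t * V\<^sup>T" using gram_spectral[OF B] unfolding t_def by blast
  have "(\<Sum>a<m. (\<Sum>r<d. B $$ (a, r) * V $$ (r, i))\<^sup>2) = (\<Sum>k<d. t k * (\<Sum>r<d. V $$ (r, k) * V $$ (r, i))\<^sup>2)"
    by (rule gram_quadratic_form[OF B V(1) eq])
  also have "\<dots> = (\<Sum>k<d. if k = i then t i else 0)"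
    using orthogonal_fam_of_mat[OF V] i by (intro sum.cong refl) (auto simp: orthogonal_fam_def)
  also have "\<dots> = t i" using i by simp
  finally have "t i = (\<Sum>a<m. (\<Sum>r<d. B $$ (a, r) * V $$ (r, i))\<^sup>2)" ..
  then show ?thesis unfolding t_def by (simp add: sum_nonneg)
qed

lemma sing_val_sq:
  assumes B: "B \<in> carrier_mat m d" and i: "i < d"
  shows "(sing_val (Suc i) B)\<^sup>2 = eigenvalues_desc (B\<^sup>T * B) ! i" "0 \<le> sing_val (Suc i) B"
  using eigenvalues_desc_gram_nonneg[OF assms] by (simp_all add: sing_val_eigenvalues_desc)

lemma sing_val_antimono:
  assumes B: "B \<in> carrier_mat m d" and ij: "i \<le> j" "j < d"
  shows "sing_val (Suc j) B \<le> sing_val (Suc i) B"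
proof -
  have G: "B\<^sup>T * B \<in> carrier_mat d d" using B by simp
  have sym: "(B\<^sup>T * B)\<^sup>T = B\<^sup>T * B" using B by (simp add: transpose_mult[of _ d m _ d])
  have "eigenvalues_desc (B\<^sup>T * B) ! j \<le> eigenvalues_desc (B\<^sup>T * B) ! i"
    using ij eigenvalues_desc_props(1)[OF G sym] sorted_eigenvalues_desc[of "B\<^sup>T * B"]
    by (cases "i = j") (auto simp: sorted_wrt_iff_nth_less)
  then show ?thesis by (simp add: sing_val_eigenvalues_desc)
qed

lemma proots_X_power: "proots ([:0, 1:] ^ n :: real poly) = replicate_mset n 0"
  unfolding proots_power proots_linear_factor by simp

text \<open>By Sylvester's identity the two eigenvalue lists, padded with \<open>d\<close> and
  \<open>m\<close> zeros respectively, are equal as multisets. Since Gram matrices have nonnegative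
  eigenvalues, the padded lists are still decreasing, so they agree entry by entry.\<close>

lemma left_singular_vectors:
  fixes B :: "real mat"
  assumes B: "B \<in> carrier_mat m d"
  obtains U \<tau> where "U \<in> carrier_mat m m" "U\<^sup>T * U = 1\<^sub>m m"
    "B * B\<^sup>T = U * mat_diag m \<tau> * U\<^sup>T"
    "\<And>i. i < m \<Longrightarrow> 0 \<le> \<tau> i" "\<And>i j. i \<le> j \<Longrightarrow> j < m \<Longrightarrow> \<tau> j \<le> \<tau> i"
    "\<And>i. i < min m d \<Longrightarrow> \<tau> i = (sing_val (Suc i) B)\<^sup>2"
    "\<And>i. min m d \<le> i \<Longrightarrow> i < m \<Longrightarrow> \<tau> i = 0"
proof -
  have BT: "B\<^sup>T \<in> carrier_mat d m" using B by simp
  have BTT: "(B\<^sup>T)\<^sup>T = B" by simp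
  define e1 where "e1 = eigenvalues_desc (B * B\<^sup>T)"
  define e2 where "e2 = eigenvalues_desc (B\<^sup>T * B)"
  obtain U where U: "U \<in> carrier_mat m m" "U\<^sup>T * U = 1\<^sub>m m"
    "B * B\<^sup>T = U * mat_diag m (\<lambda>i. e1 ! i) * U\<^sup>T"
    using gram_spectral[OF BT] unfolding BTT e1_def by blast
  have G1: "B * B\<^sup>T \<in> carrier_mat m m" "(B * B\<^sup>T)\<^sup>T = B * B\<^sup>T"
    using B by (auto simp: transpose_mult[of _ m d _ m])
  have G2: "B\<^sup>T * B \<in> carrier_mat d d" "(B\<^sup>T * B)\<^sup>T = B\<^sup>T * B"
    using B by (auto simp: transpose_mult[of _ d m _ d])
  have len: "length e1 = m" "length e2 = d"
    unfolding e1_def e2_def using eigenvalues_desc_props(1)[OF G1] eigenvalues_desc_props(1)[OF G2] by auto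
  have nn1: "0 \<le> e1 ! i" if "i < m" for i
    using eigenvalues_desc_gram_nonneg[OF BT, of i] that by (simp add: e1_def)
  have nn2: "0 \<le> e2 ! i" if "i < d" for i
    using eigenvalues_desc_gram_nonneg[OF B, of i] that by (simp add: e2_def)
  have s1: "sorted_wrt (\<ge>) e1" and s2: "sorted_wrt (\<ge>) e2"
    by (simp_all add: e1_def e2_def sorted_eigenvalues_desc)
  have nz: "char_poly (B * B\<^sup>T) \<noteq> 0" "char_poly (B\<^sup>T * B) \<noteq> 0"
    using degree_monic_char_poly[OF G1(1)] degree_monic_char_poly[OF G2(1)] by auto
  have "proots ([:0, 1:] ^ d * char_poly (B * B\<^sup>T)) = proots ([:0, 1:] ^ m * char_poly (B\<^sup>T * B))"
    using char_poly_mult_commute[OF B BT] by simp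
  then have ms: "replicate_mset d 0 + mset e1 = replicate_mset m 0 + mset e2"
    using nz by (simp add: proots_mult proots_X_power e1_def e2_def
        eigenvalues_desc_props(3)[OF G1] eigenvalues_desc_props(3)[OF G2])
  have srt: "sorted_wrt (\<ge>) (e1 @ replicate d 0)" "sorted_wrt (\<ge>) (e2 @ replicate m 0)"
    using s1 s2 nn1 nn2 len by (auto simp: sorted_wrt_append in_set_conv_nth sorted_wrt_iff_nth_less[of _ "replicate _ _"])
  have "sorted (rev (e1 @ replicate d 0))" "sorted (rev (e2 @ replicate m 0))"
    using srt by (simp_all only: sorted_wrt_rev)
  moreover have "mset (rev (e2 @ replicate m 0)) = mset (rev (e1 @ replicate d 0))"
    using ms by (simp add: union_commute)
  ultimately have "rev (e1 @ replicate d 0) = rev (e2 @ replicate m 0)"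
    by (metis properties_for_sort sorted_sort_id)
  then have eq: "e1 @ replicate d 0 = e2 @ replicate m 0" by (simp only: rev_is_rev_conv)
  have nth_eq: "(e1 @ replicate d 0) ! i = (e2 @ replicate m 0) ! i" for i by (simp only: eq)
  have a: "e1 ! i = (sing_val (Suc i) B)\<^sup>2" if "i < min m d" for i
    using that nth_eq[of i] len by (simp add: nth_append sing_val_sq[OF B] e2_def)
  have b: "e1 ! i = 0" if "min m d \<le> i" "i < m" for i
    using that nth_eq[of i] len by (simp add: nth_append split: if_splits)
  have mono: "e1 ! j \<le> e1 ! i" if "i \<le> j" "j < m" for i j
    using that s1 len by (cases "i = j") (auto simp: sorted_wrt_iff_nth_less)
  show ?thesis by (rule that[OF U nn1 mono a b])
qed

section \<open>Deterministic range finder bound\<close>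

text \<open>Replaces Gram-Schmidt: the given vectors are the rows of a \<open>d\<close> by
  \<open>m\<close> matrix, and the decreasing eigenvalues of its Gram matrix vanish from position
  \<open>d\<close> on. An eigenvector for the eigenvalue 0 is orthogonal to every row.\<close>

lemma orthogonal_fam_kernel:
  fixes a :: "nat \<Rightarrow> nat \<Rightarrow> real"
  obtains u where "orthogonal_fam {..<m} u" "\<And>i j. d \<le> i \<Longrightarrow> i < m \<Longrightarrow> j < d \<Longrightarrow> (\<Sum>r<m. u i r * a j r) = 0"
proof -
  define B where "B = Matrix.mat d m (\<lambda>(j, r). a j r)"
  have B: "B \<in> carrier_mat d m" by (simp add: B_def)
  obtain U \<tau> where U: "U \<in> carrier_mat m m" "U\<^sup>T * U = 1\<^sub>m m"
    and eq: "B\<^sup>T * (B\<^sup>T)\<^sup>T = U * mat_diag m \<tau> * U\<^sup>T"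
    and \<tau>0: "\<And>i. min m d \<le> i \<Longrightarrow> i < m \<Longrightarrow> \<tau> i = 0"
    using left_singular_vectors[of "B\<^sup>T" m d] B by (metis transpose_carrier_mat)
  have orth: "orthogonal_fam {..<m} (\<lambda>i r. U $$ (r, i))" by (rule orthogonal_fam_of_mat[OF U])
  have "(\<Sum>r<m. U $$ (r, i) * a j r) = 0" if i: "d \<le> i" "i < m" and j: "j < d" for i j
  proof -
    have "(\<Sum>j<d. (\<Sum>r<m. B $$ (j, r) * U $$ (r, i))\<^sup>2)
        = (\<Sum>k<m. \<tau> k * (\<Sum>r<m. U $$ (r, k) * U $$ (r, i))\<^sup>2)"
      using eq by (intro gram_quadratic_form[OF B U(1)]) simp
    also have "\<dots> = (\<Sum>k<m. if k = i then \<tau> i else 0)"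
      using orth i by (intro sum.cong refl) (auto simp: orthogonal_fam_def)
    also have "\<dots> = 0" using i \<tau>0 by (simp add: sum.delta)
    finally have "\<forall>j<d. (\<Sum>r<m. B $$ (j, r) * U $$ (r, i))\<^sup>2 = 0"
      by (subst (asm) sum_nonneg_eq_0_iff) auto
    then show ?thesis using j by (simp add: B_def ac_simps)
  qed
  then show ?thesis using that orth by blast
qed

text \<open>Ky Fan: the sum of the smallest eigenvalues of a Gram matrix is bounded by its trace on the
  kernel of the first \<open>\<mu>\<close> rows of \<open>E\<close>.\<close>

lemma sing_val_tail_le:
  fixes C E :: "real mat"
  assumes C: "C \<in> carrier_mat m l" and E: "E \<in> carrier_mat m l" and CE: "C\<^sup>T * C = E\<^sup>T * E"
    and \<mu>: "\<mu> \<le> l" "\<mu> \<le> m"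
  shows "(\<Sum>k = \<mu> + 1..l. (sing_val k C)\<^sup>2) \<le> (\<Sum>a\<in>{\<mu>..<m}. \<Sum>r<l. (E $$ (a, r))\<^sup>2)"
proof -
  define t where "t i = eigenvalues_desc (C\<^sup>T * C) ! i" for i
  obtain V where V: "V \<in> carrier_mat l l" "V\<^sup>T * V = 1\<^sub>m l"
    and eq: "C\<^sup>T * C = V * mat_diag l t * V\<^sup>T" using gram_spectral[OF C] unfolding t_def by blast
  have oV: "orthogonal_fam {..<l} (\<lambda>i r. V $$ (r, i))" by (rule orthogonal_fam_of_mat[OF V])
  have ts: "t i = (sing_val (Suc i) C)\<^sup>2" if "i < l" for i
    using sing_val_sq[OF C that] by (simp add: t_def)
  have t_mono: "t j \<le> t i" if "i \<le> j" "j < l" for i j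
    using that sing_val_antimono[OF C that] sing_val_sq(2)[OF C, of j] by (simp add: ts power_mono)
  obtain z where z: "orthogonal_fam {..<l} z"
    and zE: "\<And>i j. \<mu> \<le> i \<Longrightarrow> i < l \<Longrightarrow> j < \<mu> \<Longrightarrow> (\<Sum>r<l. z i r * E $$ (j, r)) = 0"
    using orthogonal_fam_kernel[of l \<mu> "\<lambda>j r. E $$ (j, r)"] by blast
  \<comment> \<open>\<open>w k\<close> is the share of the \<open>k\<close>-th eigenvector that lies
    in the span of the \<open>z i\<close> with \<open>i \<ge> \<mu>\<close>: a weight between 0 and
    1, with total \<open>l - \<mu>\<close>. The trace on that span is the sum of
    \<open>t k * w k\<close>.\<close>
  define w where "w k = (\<Sum>i\<in>{\<mu>..<l}. (\<Sum>r<l. V $$ (r, k) * z i r)\<^sup>2)" for k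
  have w1: "w k \<le> 1" if "k < l" for k
  proof -
    have "w k \<le> (\<Sum>i<l. (\<Sum>r<l. z i r * V $$ (r, k))\<^sup>2)"
      unfolding w_def by (subst mult.commute) (intro sum_mono2, auto)
    also have "\<dots> = (\<Sum>r<l. V $$ (r, k) * V $$ (r, k))"
      unfolding orthogonal_fam_parseval[OF z finite_lessThan] by (simp add: power2_eq_square)
    also have "\<dots> = 1" using oV that by (auto simp: orthogonal_fam_def)
    finally show ?thesis .
  qed
  have w0: "0 \<le> w k" for k by (simp add: w_def sum_nonneg)
  have wsum: "(\<Sum>k<l. w k) = real l - real \<mu>"
  proof -
    have "(\<Sum>k<l. w k) = (\<Sum>i\<in>{\<mu>..<l}. \<Sum>r<l. (z i r)\<^sup>2)"
      unfolding w_def by (subst sum.swap) (simp add: orthogonal_fam_parseval[OF oV finite_lessThan])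
    also have "\<dots> = (\<Sum>i\<in>{\<mu>..<l}. 1)"
      using z by (intro sum.cong refl) (auto simp: orthogonal_fam_def power2_eq_square)
    finally show ?thesis using \<mu> by simp
  qed
  have split: "(\<Sum>k<l. f k) = (\<Sum>k<\<mu>. f k) + (\<Sum>k\<in>{\<mu>..<l}. f k)" for f :: "nat \<Rightarrow> real"
    using \<mu>(1) sum.atLeastLessThan_concat[of 0 \<mu> l f] by (simp add: lessThan_atLeast0)
  have tail: "(\<Sum>k\<in>{\<mu>..<l}. t k) \<le> (\<Sum>k<l. t k * w k)"
  proof (cases "\<mu> < l")
    case True
    \<comment> \<open>\<open>t \<mu>\<close> separates the head eigenvalues from the tail ones. The
      weight missing in the tail equals the weight present in the head, so moving it across this
      level can only lower the sum.\<close>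
    define T where "T = t \<mu>"
    have a: "(\<Sum>k<\<mu>. T * w k) \<le> (\<Sum>k<\<mu>. t k * w k)"
      using t_mono True w0 by (intro sum_mono mult_right_mono) (auto simp: T_def)
    have b: "(\<Sum>k\<in>{\<mu>..<l}. t k * (1 - w k)) \<le> (\<Sum>k\<in>{\<mu>..<l}. T * (1 - w k))"
      using t_mono w1 by (intro sum_mono mult_right_mono) (auto simp: T_def)
    have "(\<Sum>k<l. w k) = (\<Sum>k\<in>{\<mu>..<l}. 1)" using wsum \<mu> by simp
    then have "(\<Sum>k<\<mu>. w k) = (\<Sum>k\<in>{\<mu>..<l}. 1 - w k)"
      unfolding split sum_subtractf by simp
    then have c: "(\<Sum>k<\<mu>. T * w k) = (\<Sum>k\<in>{\<mu>..<l}. T * (1 - w k))"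
      by (simp add: sum_distrib_left[symmetric])
    have "(\<Sum>k\<in>{\<mu>..<l}. t k) = (\<Sum>k\<in>{\<mu>..<l}. t k * (1 - w k)) + (\<Sum>k\<in>{\<mu>..<l}. t k * w k)"
      unfolding sum.distrib[symmetric] by (simp add: algebra_simps)
    also have "\<dots> \<le> (\<Sum>k<l. t k * w k)" unfolding split using a b c by linarith
    finally show ?thesis .
  next
    case False
    then have "{\<mu>..<l} = {}" by simp
    moreover have "0 \<le> (\<Sum>k<l. t k * w k)" using w0 by (auto intro!: sum_nonneg simp: ts)
    ultimately show ?thesis by simp
  qed
  have "(\<Sum>k = \<mu> + 1..l. (sing_val k C)\<^sup>2) = (\<Sum>k\<in>{\<mu>..<l}. t k)"
    by (rule sum.reindex_bij_witness[of _ Suc "\<lambda>k. k - 1"]) (auto simp: ts)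
  also note tail
  also have "(\<Sum>k<l. t k * w k) = (\<Sum>i\<in>{\<mu>..<l}. \<Sum>k<l. t k * (\<Sum>r<l. V $$ (r, k) * z i r)\<^sup>2)"
    unfolding w_def sum_distrib_left by (rule sum.swap)
  also have "\<dots> = (\<Sum>i\<in>{\<mu>..<l}. \<Sum>a<m. (\<Sum>r<l. E $$ (a, r) * z i r)\<^sup>2)"
    using eq CE by (intro sum.cong refl gram_quadratic_form[OF E V(1), symmetric]) simp
  also have "\<dots> = (\<Sum>i\<in>{\<mu>..<l}. \<Sum>a\<in>{\<mu>..<m}. (\<Sum>r<l. z i r * E $$ (a, r))\<^sup>2)"
  proof (rule sum.cong[OF refl])
    fix i assume i: "i \<in> {\<mu>..<l}"
    have "(\<Sum>a<m. (\<Sum>r<l. E $$ (a, r) * z i r)\<^sup>2) = (\<Sum>a<m. (\<Sum>r<l. z i r * E $$ (a, r))\<^sup>2)"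
      by (simp add: ac_simps)
    \<comment> \<open>The remaining \<open>z i\<close> are orthogonal to the first
      \<open>\<mu>\<close> rows of \<open>E\<close>, which therefore drop out.\<close>
    also have "\<dots> = (\<Sum>a\<in>{\<mu>..<m}. (\<Sum>r<l. z i r * E $$ (a, r))\<^sup>2)"
      using i zE by (intro sum.mono_neutral_right) (auto simp: not_le)
    finally show "(\<Sum>a<m. (\<Sum>r<l. E $$ (a, r) * z i r)\<^sup>2) = (\<Sum>a\<in>{\<mu>..<m}. (\<Sum>r<l. z i r * E $$ (a, r))\<^sup>2)" .
  qed
  also have "\<dots> = (\<Sum>a\<in>{\<mu>..<m}. \<Sum>i\<in>{\<mu>..<l}. (\<Sum>r<l. z i r * E $$ (a, r))\<^sup>2)"
    by (rule sum.swap)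
  also have "\<dots> \<le> (\<Sum>a\<in>{\<mu>..<m}. \<Sum>i<l. (\<Sum>r<l. z i r * E $$ (a, r))\<^sup>2)"
    by (intro sum_mono sum_mono2) auto
  also have "\<dots> = (\<Sum>a\<in>{\<mu>..<m}. \<Sum>r<l. (E $$ (a, r))\<^sup>2)"
    by (simp add: orthogonal_fam_parseval[OF z finite_lessThan])
  finally show ?thesis .
qed

section \<open>Frobenius norm and orthogonal projections\<close>

lemma frob_norm_sq: "(frob_norm X)\<^sup>2 = (\<Sum>i<dim_row X. \<Sum>j<dim_col X. (X $$ (i, j))\<^sup>2)"
  by (simp add: frob_norm_def sum_nonneg)

lemma frob_norm_nonneg: "0 \<le> frob_norm X"
  by (simp add: frob_norm_def sum_nonneg)

lemma frob_norm_L2: "frob_norm X = L2_set (\<lambda>x. X $$ x) ({..<dim_row X} \<times> {..<dim_col X})"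
  by (simp add: frob_norm_def L2_set_def sum.cartesian_product)

lemma frob_norm_triangle:
  assumes "X \<in> carrier_mat m n" "Y \<in> carrier_mat m n"
  shows "frob_norm (X + Y) \<le> frob_norm X + frob_norm Y"
proof -
  have "frob_norm (X + Y) = L2_set (\<lambda>x. X $$ x + Y $$ x) ({..<m} \<times> {..<n})"
    unfolding frob_norm_L2 using assms by (intro L2_set_cong) auto
  also have "\<dots> \<le> frob_norm X + frob_norm Y"
    unfolding frob_norm_L2 using assms L2_set_triangle_ineq[of "\<lambda>x. X $$ x" "\<lambda>x. Y $$ x"] by simp
  finally show ?thesis .
qed

lemma frob_norm_uminus:
  assumes "X \<in> carrier_mat m n" shows "frob_norm (- X) = frob_norm X"
  unfolding frob_norm_def using assms by (intro arg_cong[where f = sqrt] sum.cong) auto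

lemma frob_norm_sq_gram: "(frob_norm X)\<^sup>2 = (\<Sum>j<dim_col X. (X\<^sup>T * X) $$ (j, j))"
  unfolding frob_norm_sq by (subst sum.swap)
    (simp add: scalar_prod_lessThan power2_eq_square)

lemma orthonormal_mult_frob_norm:
  assumes U: "U \<in> carrier_mat a b" "U\<^sup>T * U = 1\<^sub>m b" and X: "X \<in> carrier_mat b n"
  shows "(U * X)\<^sup>T * (U * X) = X\<^sup>T * X" "frob_norm (U * X) = frob_norm X"
proof -
  have "(U * X)\<^sup>T * (U * X) = X\<^sup>T * ((U\<^sup>T * U) * X)"
    using U(1) X by (simp add: transpose_mult[of _ a b _ n] assoc_mult_mat[of _ n b _ a _ n]
        assoc_mult_mat[of _ b a _ b _ n] mult_carrier_mat[of _ a b _ n])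
  then show *: "(U * X)\<^sup>T * (U * X) = X\<^sup>T * X" using U X by simp
  have "(frob_norm (U * X))\<^sup>2 = (frob_norm X)\<^sup>2"
    unfolding frob_norm_sq_gram * using U X by simp
  then show "frob_norm (U * X) = frob_norm X"
    using frob_norm_nonneg by (metis power2_eq_iff_nonneg)
qed

text \<open>Pythagoras, column by column: \<open>X\<close> is the sum of \<open>Y = N * X\<close>
  and \<open>Z = Q * Q\<^sup>T * X\<close>, and \<open>Z\<^sup>T * Y = 0\<close>.\<close>

lemma residual_projection:
  fixes Q :: "real mat"
  assumes Q: "Q \<in> carrier_mat m r" "orthonormal_mat Q"
  defines "N \<equiv> 1\<^sub>m m - Q * Q\<^sup>T"
  shows "N \<in> carrier_mat m m" "N * Q = 0\<^sub>m m r"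
    "X \<in> carrier_mat m n \<Longrightarrow> frob_norm (N * X) \<le> frob_norm X"
    "X \<in> carrier_mat m n \<Longrightarrow> frob_norm (Q * Q\<^sup>T * X) \<le> frob_norm X"
proof -
  have QQ: "Q\<^sup>T * Q = 1\<^sub>m r" using Q by (auto simp: orthonormal_mat_def)
  have c: "Q\<^sup>T \<in> carrier_mat r m" "Q * Q\<^sup>T \<in> carrier_mat m m" using Q by auto
  show N: "N \<in> carrier_mat m m" using c by (auto simp: N_def)
  have "N * Q = 1\<^sub>m m * Q - (Q * Q\<^sup>T) * Q"
    unfolding N_def using c Q(1) by (intro minus_mult_distrib_mat) auto
  also have "(Q * Q\<^sup>T) * Q = Q * (Q\<^sup>T * Q)" using c Q(1) by (intro assoc_mult_mat) auto
  finally show NQ: "N * Q = 0\<^sub>m m r" unfolding QQ using Q by simp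
  have both: "frob_norm (N * X) \<le> frob_norm X \<and> frob_norm (Q * Q\<^sup>T * X) \<le> frob_norm X"
    if X: "X \<in> carrier_mat m n"
  proof -
  define Y where "Y = N * X"
  define Z where "Z = Q * (Q\<^sup>T * X)"
  have Y: "Y \<in> carrier_mat m n" and Z: "Z \<in> carrier_mat m n"
    using N X Q c unfolding Y_def Z_def by auto
  have "Y = 1\<^sub>m m * X - (Q * Q\<^sup>T) * X"
    unfolding Y_def N_def using c X by (intro minus_mult_distrib_mat) auto
  also have QQX: "(Q * Q\<^sup>T) * X = Z" unfolding Z_def using c X Q(1) by (intro assoc_mult_mat) auto
  finally have YX: "Y = X - Z" using X by simp
  have QY: "Q\<^sup>T * Y = 0\<^sub>m r n"
  proof -
    have "Q\<^sup>T * Y = Q\<^sup>T * X - Q\<^sup>T * Z" unfolding YX using c X Z by (intro mult_minus_distrib_mat) auto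
    also have "Q\<^sup>T * Z = (Q\<^sup>T * Q) * (Q\<^sup>T * X)"
      unfolding Z_def using c X Q(1) by (intro assoc_mult_mat[symmetric]) auto
    finally show ?thesis unfolding QQ using c X by simp
  qed
  have "Z\<^sup>T = (Q\<^sup>T * X)\<^sup>T * Q\<^sup>T" unfolding Z_def using c X Q(1) by (intro transpose_mult) auto
  then have "Z\<^sup>T * Y = (Q\<^sup>T * X)\<^sup>T * (Q\<^sup>T * Y)"
    using c X Q(1) Y by (simp add: assoc_mult_mat[of _ n r _ m _ n] mult_carrier_mat[of _ r m _ n])
  then have ZY: "Z\<^sup>T * Y = 0\<^sub>m n n"
    unfolding QY using c X by (simp add: right_mult_zero_mat[of _ n r] mult_carrier_mat[of _ r m _ n])
  have cross: "(\<Sum>i<m. Z $$ (i, j) * Y $$ (i, j)) = 0" if "j < n" for j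
  proof -
    have "(\<Sum>i<m. Z $$ (i, j) * Y $$ (i, j)) = (Z\<^sup>T * Y) $$ (j, j)"
      using that Z Y by (simp add: scalar_prod_lessThan)
    then show ?thesis using that by (simp add: ZY)
  qed
  have Xij: "X $$ (i, j) = Y $$ (i, j) + Z $$ (i, j)" if "i < m" "j < n" for i j
    unfolding YX using that X Z by simp
  have "(frob_norm X)\<^sup>2 = (\<Sum>j<n. \<Sum>i<m. (Y $$ (i, j) + Z $$ (i, j))\<^sup>2)"
    unfolding frob_norm_sq using X by (subst sum.swap) (simp add: Xij)
  also have "\<dots> = (\<Sum>j<n. (\<Sum>i<m. (Y $$ (i, j))\<^sup>2) + (\<Sum>i<m. (Z $$ (i, j))\<^sup>2))"
  proof (rule sum.cong[OF refl])
    fix j assume "j \<in> {..<n}"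
    then have j: "j < n" by simp
    have "(\<Sum>i<m. (Y $$ (i, j) + Z $$ (i, j))\<^sup>2)
        = (\<Sum>i<m. (Y $$ (i, j))\<^sup>2 + (Z $$ (i, j))\<^sup>2 + 2 * (Z $$ (i, j) * Y $$ (i, j)))"
      by (simp add: power2_eq_square algebra_simps)
    also have "\<dots> = (\<Sum>i<m. (Y $$ (i, j))\<^sup>2) + (\<Sum>i<m. (Z $$ (i, j))\<^sup>2)"
      unfolding sum.distrib sum_distrib_left[symmetric] cross[OF j] by simp
    finally show "(\<Sum>i<m. (Y $$ (i, j) + Z $$ (i, j))\<^sup>2) = (\<Sum>i<m. (Y $$ (i, j))\<^sup>2) + (\<Sum>i<m. (Z $$ (i, j))\<^sup>2)" .
  qed
  also have "\<dots> = (frob_norm Y)\<^sup>2 + (frob_norm Z)\<^sup>2"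
    unfolding frob_norm_sq sum.distrib using Y Z
    by (simp add: sum.swap[of _ "{..<m}" "{..<n}"])
  finally have "(frob_norm Y)\<^sup>2 \<le> (frob_norm X)\<^sup>2" "(frob_norm Z)\<^sup>2 \<le> (frob_norm X)\<^sup>2" by simp_all
  then show ?thesis
    unfolding QQX Y_def[symmetric] using frob_norm_nonneg by (meson power2_le_imp_le)
  qed
  then show "X \<in> carrier_mat m n \<Longrightarrow> frob_norm (N * X) \<le> frob_norm X"
    "X \<in> carrier_mat m n \<Longrightarrow> frob_norm (Q * Q\<^sup>T * X) \<le> frob_norm X" by blast+
qed

lemma pow_mat_diag_conj:
  fixes U :: "real mat"
  assumes U: "U \<in> carrier_mat m m" "U\<^sup>T * U = 1\<^sub>m m" and S: "S = U * mat_diag m t * U\<^sup>T"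
  shows "S ^\<^sub>m q = U * mat_diag m (\<lambda>i. t i ^ q) * U\<^sup>T"
proof -
  have UT: "U\<^sup>T \<in> carrier_mat m m" using U by simp
  have UU: "U * U\<^sup>T = 1\<^sub>m m" by (rule mat_mult_left_right_inverse[OF UT U(1) U(2)])
  have Sc: "S \<in> carrier_mat m m" unfolding S using U UT by (auto intro!: mult_carrier_mat[of _ m m _ m])
  show ?thesis
  proof (induction q)
    case 0
    then show ?case using U UU Sc by simp
  next
    case (Suc q)
    have "S ^\<^sub>m Suc q = U * mat_diag m (\<lambda>i. t i ^ q) * U\<^sup>T * (U * mat_diag m t * U\<^sup>T)"
      using Suc by (simp add: S)
    also have "\<dots> = U * (mat_diag m (\<lambda>i. t i ^ q) * ((U\<^sup>T * U) * (mat_diag m t * U\<^sup>T)))"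
      using U(1) UT by (simp add: assoc_mult_mat[of _ m m _ m _ m] mult_carrier_mat[of _ m m _ m])
    also have "\<dots> = U * ((mat_diag m (\<lambda>i. t i ^ q) * mat_diag m t) * U\<^sup>T)"
      unfolding U(2) using UT
      by (simp add: assoc_mult_mat[of _ m m _ m _ m] left_mult_one_mat[of _ m m] mult_carrier_mat[of _ m m _ m] del: mat_diag_diag)
    also have "\<dots> = U * mat_diag m (\<lambda>i. t i ^ Suc q) * U\<^sup>T"
      using U(1) UT by (simp add: assoc_mult_mat[of _ m m _ m _ m] mult.commute)
    finally show ?case .
  qed
qed

text \<open>The residuals are kept separately for each left singular vector, as
  \<open>\<nu> i\<close>: the sketch controls those with \<open>i < r\<close>, and for the others
  \<open>\<nu> i \<le> 1\<close> is enough. The 4 is the square of 2, since the residual of the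
  sketch and the removal of the lower rows each cost one \<open>frob_norm E2\<close>.\<close>

lemma range_finder_residual:
  fixes B Q G U :: "real mat" and \<tau> :: "nat \<Rightarrow> real"
  assumes B: "B \<in> carrier_mat m d" and G: "G \<in> carrier_mat m (r + K)"
    and U: "U \<in> carrier_mat m m" "U\<^sup>T * U = 1\<^sub>m m"
    and BB: "B * B\<^sup>T = U * mat_diag m \<tau> * U\<^sup>T"
    and \<tau>: "\<And>i. i < m \<Longrightarrow> 0 \<le> \<tau> i"
    and r: "r + K \<le> m"
    and alg: "power_sketch_factor B r K q G Q"
    and s: "0 < s"
    and lower: "\<And>x. s\<^sup>2 * (\<Sum>i<r. (x i)\<^sup>2) \<le> (\<Sum>j<r + K. (\<Sum>i<r. x i * (U\<^sup>T * G) $$ (i, j))\<^sup>2)"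
  obtains \<nu> where "\<And>i. i < m \<Longrightarrow> 0 \<le> \<nu> i" "\<And>i. i < m \<Longrightarrow> \<nu> i \<le> 1"
    "(frob_norm (B - Q * Q\<^sup>T * B))\<^sup>2 = (\<Sum>i<m. \<tau> i * \<nu> i)"
    "s\<^sup>2 * (\<Sum>i<r. \<tau> i ^ (2 * q) * \<nu> i)
      \<le> 4 * (\<Sum>i\<in>{r..<m}. \<Sum>j<r + K. \<tau> i ^ (2 * q) * ((U\<^sup>T * G) $$ (i, j))\<^sup>2)"
proof -
  define l where "l = r + K"
  define W where "W = U\<^sup>T * G"
  define C where "C = (B * B\<^sup>T) ^\<^sub>m q * G"
  define N where "N = 1\<^sub>m m - Q * Q\<^sup>T"
  define E where "E = Matrix.mat m l (\<lambda>(i, j). \<tau> i ^ q * W $$ (i, j))"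
  define E1 where "E1 = Matrix.mat m l (\<lambda>(i, j). if i < r then \<tau> i ^ q * W $$ (i, j) else 0)"
  define E2 where "E2 = Matrix.mat m l (\<lambda>(i, j). if i < r then 0 else \<tau> i ^ q * W $$ (i, j))"
  define X2 where "X2 = (\<Sum>i\<in>{r..<m}. \<Sum>j<l. \<tau> i ^ (2 * q) * (W $$ (i, j))\<^sup>2)"
  define P where "P = N * U"
  define \<nu> where "\<nu> i = (\<Sum>a<m. (P $$ (a, i))\<^sup>2)" for i
  have UT: "U\<^sup>T \<in> carrier_mat m m" and W: "W \<in> carrier_mat m l"
    using U G by (auto simp: W_def l_def)
  have E: "E \<in> carrier_mat m l" "E1 \<in> carrier_mat m l" "E2 \<in> carrier_mat m l"
    by (auto simp: E_def E1_def E2_def)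
  have E12: "E = E1 + E2" by (rule eq_matI) (auto simp: E_def E1_def E2_def)
  from alg obtain R where Q: "Q \<in> carrier_mat m r" "orthonormal_mat Q" and R: "R \<in> carrier_mat r l"
    and QR: "frob_norm (Q * R - C) \<le> sqrt (\<Sum>k = r + 1..l. (sing_val k C)\<^sup>2)"
    using B unfolding power_sketch_factor_def C_def l_def by (auto simp: Let_def)
  note N = residual_projection[OF Q, folded N_def]
  have diagW: "mat_diag m (\<lambda>i. \<tau> i ^ q) * W = E"
    by (rule eq_matI) (use W in \<open>auto simp: E_def mat_diag_mult_left[OF W]\<close>)
  have CUE: "C = U * E"
  proof -
    have "C = U * mat_diag m (\<lambda>i. \<tau> i ^ q) * U\<^sup>T * G"
      unfolding C_def using pow_mat_diag_conj[OF U BB] by simp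
    also have "\<dots> = U * (mat_diag m (\<lambda>i. \<tau> i ^ q) * (U\<^sup>T * G))"
      using U(1) UT G by (simp add: assoc_mult_mat[of _ m m _ m _ m] assoc_mult_mat[of _ m m _ m _ "r + K"]
          mult_carrier_mat[of _ m m _ m] mult_carrier_mat[of _ m m _ "r + K"])
    finally show ?thesis unfolding W_def[symmetric] diagW .
  qed
  have C: "C \<in> carrier_mat m l" unfolding CUE using U E by simp
  have CC: "C\<^sup>T * C = E\<^sup>T * E" unfolding CUE by (rule orthonormal_mult_frob_norm[OF U E(1)])
  have E2sq: "(frob_norm E2)\<^sup>2 = X2"
  proof -
    have "(frob_norm E2)\<^sup>2 = (\<Sum>i<m. if i < r then 0 else \<Sum>j<l. \<tau> i ^ (2 * q) * (W $$ (i, j))\<^sup>2)"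
      unfolding frob_norm_sq by (auto simp: E2_def power_mult_distrib power_mult[symmetric] mult.commute intro!: sum.cong)
    also have "\<dots> = X2" unfolding X2_def
      by (rule sum.mono_neutral_cong_right) auto
    finally show ?thesis .
  qed
  have tail: "(\<Sum>k = r + 1..l. (sing_val k C)\<^sup>2) \<le> X2"
  proof -
    have "(\<Sum>k = r + 1..l. (sing_val k C)\<^sup>2) \<le> (\<Sum>a\<in>{r..<m}. \<Sum>j<l. (E $$ (a, j))\<^sup>2)"
      by (rule sing_val_tail_le[OF C E(1) CC]) (use r in \<open>auto simp: l_def\<close>)
    also have "\<dots> = X2" unfolding X2_def
      by (auto simp: E_def power_mult_distrib power_mult[symmetric] mult.commute intro!: sum.cong)
    finally show ?thesis .
  qed
  \<comment> \<open>\<open>N\<close> annihilates \<open>Q\<close>, so \<open>R\<close> disappears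
    and only the residual guaranteed for the sketch is left.\<close>
  have NC: "frob_norm (N * C) \<le> frob_norm E2"
  proof -
    have "N * (Q * R - C) = N * (Q * R) - N * C"
      using N(1) Q(1) R C by (intro mult_minus_distrib_mat) auto
    also have "N * (Q * R) = (N * Q) * R" using N(1) Q(1) R by (intro assoc_mult_mat[symmetric]) auto
    also have "\<dots> = 0\<^sub>m m l" unfolding N(2) using R by simp
    also have "0\<^sub>m m l - N * C = - (N * C)" using N(1) C by (intro eq_matI) auto
    finally have "frob_norm (N * C) = frob_norm (N * (Q * R - C))"
      using frob_norm_uminus[of "N * C" m l] N(1) C by simp
    also have "\<dots> \<le> frob_norm (Q * R - C)" using Q R C by (intro N(3)[of _ l]) auto
    also have "\<dots> \<le> sqrt X2" using QR real_sqrt_le_mono[OF tail] by linarith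
    also have "\<dots> = frob_norm E2" using E2sq frob_norm_nonneg by (metis real_sqrt_unique)
    finally show ?thesis .
  qed
  have NU: "P \<in> carrier_mat m m" unfolding P_def using N(1) U(1) by simp
  have "frob_norm (P * E1) \<le> frob_norm (N * C) + frob_norm (N * (U * E2))"
  proof -
    have "C = U * E1 + U * E2" unfolding CUE E12 using U E by (intro mult_add_distrib_mat) auto
    moreover have "N * (U * E1 + U * E2) = N * (U * E1) + N * (U * E2)"
      using N(1) U(1) E by (intro mult_add_distrib_mat) auto
    ultimately have "N * (U * E1) = N * C + - (N * (U * E2))"
      using N(1) U(1) E by (intro eq_matI) auto
    moreover have "P * E1 = N * (U * E1)" unfolding P_def using N(1) U(1) E by (intro assoc_mult_mat) auto
    ultimately have "frob_norm (P * E1) \<le> frob_norm (N * C) + frob_norm (- (N * (U * E2)))"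
      using N(1) U(1) E C by (simp add: frob_norm_triangle[of _ m l] mult_carrier_mat[of _ m m _ l])
    also have "frob_norm (- (N * (U * E2))) = frob_norm (N * (U * E2))"
      using N(1) U(1) E by (intro frob_norm_uminus[of _ m l]) (auto intro!: mult_carrier_mat[of _ m m])
    finally show ?thesis .
  qed
  also have "frob_norm (N * (U * E2)) \<le> frob_norm E2"
    using N(3)[of "U * E2" l] U E orthonormal_mult_frob_norm(2)[OF U E(3)] by simp
  finally have "frob_norm (P * E1) \<le> 2 * frob_norm E2" using NC by simp
  then have "(frob_norm (P * E1))\<^sup>2 \<le> (2 * frob_norm E2)\<^sup>2"
    using frob_norm_nonneg by (intro power_mono) auto
  then have up: "(frob_norm (P * E1))\<^sup>2 \<le> 4 * X2" by (simp add: power_mult_distrib E2sq)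
  \<comment> \<open>The singular value hypothesis is applied to each row of \<open>P\<close>, scaled
    by the leading powers of \<open>\<tau>\<close>.\<close>
  have lo: "s\<^sup>2 * (\<Sum>i<r. \<tau> i ^ (2 * q) * \<nu> i) \<le> (frob_norm (P * E1))\<^sup>2"
  proof -
    have "s\<^sup>2 * (\<Sum>i<r. \<tau> i ^ (2 * q) * \<nu> i) = (\<Sum>a<m. s\<^sup>2 * (\<Sum>i<r. (P $$ (a, i) * \<tau> i ^ q)\<^sup>2))"
      unfolding \<nu>_def sum_distrib_left
      by (subst sum.swap) (simp add: power_mult_distrib power_mult[symmetric] mult.commute ac_simps)
    also have "\<dots> \<le> (\<Sum>a<m. \<Sum>j<l. (\<Sum>i<r. P $$ (a, i) * \<tau> i ^ q * W $$ (i, j))\<^sup>2)"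
      unfolding W_def l_def by (intro sum_mono lower)
    also have "\<dots> = (\<Sum>a<m. \<Sum>j<l. ((P * E1) $$ (a, j))\<^sup>2)"
    proof (intro sum.cong refl arg_cong[where f = "\<lambda>x. x\<^sup>2"])
      fix a j assume aj: "a \<in> {..<m}" "j \<in> {..<l}"
      have "(P * E1) $$ (a, j) = (\<Sum>i<m. P $$ (a, i) * E1 $$ (i, j))"
        using aj NU E by (simp add: scalar_prod_lessThan)
      also have "\<dots> = (\<Sum>i<r. P $$ (a, i) * \<tau> i ^ q * W $$ (i, j))"
        using aj r by (intro sum.mono_neutral_cong_right) (auto simp: E1_def)
      finally show "(\<Sum>i<r. P $$ (a, i) * \<tau> i ^ q * W $$ (i, j)) = (P * E1) $$ (a, j)" ..
    qed
    also have "\<dots> = (frob_norm (P * E1))\<^sup>2"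
      unfolding frob_norm_sq using NU E by (simp)
    finally show ?thesis .
  qed
  have NBsq: "(frob_norm (B - Q * Q\<^sup>T * B))\<^sup>2 = (\<Sum>i<m. \<tau> i * \<nu> i)"
  proof -
    have QQc: "Q * Q\<^sup>T \<in> carrier_mat m m" using Q by simp
    have NB: "B - Q * Q\<^sup>T * B = N * B"
      unfolding N_def using B QQc by (simp add: minus_mult_distrib_mat[of _ m m _ _ d])
    have BT: "B\<^sup>T \<in> carrier_mat d m" using B by simp
    have gram: "(B\<^sup>T)\<^sup>T * B\<^sup>T = U * mat_diag m \<tau> * U\<^sup>T" using BB by simp
    have "(frob_norm (N * B))\<^sup>2 = (\<Sum>a<m. \<Sum>j<d. (\<Sum>k<m. B\<^sup>T $$ (j, k) * N $$ (a, k))\<^sup>2)"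
      unfolding frob_norm_sq using N(1) B by (auto simp: scalar_prod_lessThan ac_simps intro!: sum.cong)
    also have "\<dots> = (\<Sum>a<m. \<Sum>k<m. \<tau> k * (\<Sum>s<m. U $$ (s, k) * N $$ (a, s))\<^sup>2)"
      by (intro sum.cong refl gram_quadratic_form[OF BT U(1) gram])
    also have "\<dots> = (\<Sum>a<m. \<Sum>k<m. \<tau> k * (P $$ (a, k))\<^sup>2)"
      unfolding P_def using N(1) U(1) by (auto simp: scalar_prod_lessThan ac_simps intro!: sum.cong)
    also have "\<dots> = (\<Sum>i<m. \<tau> i * \<nu> i)"
      unfolding \<nu>_def sum_distrib_left by (rule sum.swap)
    finally show ?thesis unfolding NB .
  qed
  have \<nu>1: "\<nu> i \<le> 1" if i: "i < m" for i
  proof -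
    define ui where "ui = Matrix.mat m 1 (\<lambda>(a, _). U $$ (a, i))"
    have ui: "ui \<in> carrier_mat m 1" by (simp add: ui_def)
    have "(frob_norm ui)\<^sup>2 = (\<Sum>a<m. U $$ (a, i) * U $$ (a, i))"
      unfolding frob_norm_sq by (simp add: ui_def power2_eq_square)
    also have "\<dots> = 1" using orthogonal_fam_of_mat[OF U] i by (auto simp: orthogonal_fam_def)
    finally have "(frob_norm ui)\<^sup>2 = 1" .
    moreover have "(frob_norm (N * ui))\<^sup>2 = \<nu> i"
      unfolding frob_norm_sq \<nu>_def P_def using N(1) U(1) i
      by (auto simp: ui_def scalar_prod_def intro!: sum.cong)
    moreover have "(frob_norm (N * ui))\<^sup>2 \<le> (frob_norm ui)\<^sup>2"
      using N(3)[OF ui] frob_norm_nonneg by (intro power_mono) auto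
    ultimately show ?thesis by simp
  qed
  have \<nu>0: "0 \<le> \<nu> i" for i by (simp add: \<nu>_def sum_nonneg)
  show ?thesis
    by (rule that[of \<nu>]) (use \<nu>0 \<nu>1 NBsq order_trans[OF lo up] in \<open>auto simp: X2_def W_def l_def\<close>)
qed

text \<open>For \<open>i < r\<close> one has \<open>\<tau> i \<ge> \<sigma>\<^sup>2\<close>, so
  dividing by the power 2 (2q - 1) of \<open>\<sigma>\<close> turns the sketched weights
  \<open>\<tau> i ^ (2 * q)\<close> back into the weights \<open>\<tau> i\<close> of the error. The
  indices from \<open>r\<close> on give the square root on the right.\<close>

lemma range_finder_error:
  fixes B Q G U :: "real mat" and \<tau> :: "nat \<Rightarrow> real"
  assumes B: "B \<in> carrier_mat m d" and G: "G \<in> carrier_mat m (r + K)"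
    and U: "U \<in> carrier_mat m m" "U\<^sup>T * U = 1\<^sub>m m"
    and BB: "B * B\<^sup>T = U * mat_diag m \<tau> * U\<^sup>T"
    and \<tau>: "\<And>i. i < m \<Longrightarrow> 0 \<le> \<tau> i" "\<And>i j. i \<le> j \<Longrightarrow> j < m \<Longrightarrow> \<tau> j \<le> \<tau> i"
    and r: "0 < r" "r + K < m" and q: "1 \<le> q"
    and alg: "power_sketch_factor B r K q G Q"
    and s: "0 < s"
    and lower: "\<And>x. s\<^sup>2 * (\<Sum>i<r. (x i)\<^sup>2) \<le> (\<Sum>j<r + K. (\<Sum>i<r. x i * (U\<^sup>T * G) $$ (i, j))\<^sup>2)"
    and X: "(\<Sum>i\<in>{r..<m}. \<Sum>j<r + K. \<tau> i ^ (2 * q) * ((U\<^sup>T * G) $$ (i, j))\<^sup>2) \<le> X\<^sup>2" "0 \<le> X"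
    and \<sigma>: "0 \<le> \<sigma>" "\<tau> (r - 1) = \<sigma>\<^sup>2" and X0: "\<sigma> = 0 \<Longrightarrow> X = 0"
  shows "frob_norm (B - Q * Q\<^sup>T * B) \<le> 2 * X / (s * \<sigma> ^ (2 * q - 1)) + sqrt (\<Sum>i\<in>{r..<m}. \<tau> i)"
proof -
  obtain \<nu> where \<nu>: "\<And>i. i < m \<Longrightarrow> 0 \<le> \<nu> i" "\<And>i. i < m \<Longrightarrow> \<nu> i \<le> 1"
    and NB: "(frob_norm (B - Q * Q\<^sup>T * B))\<^sup>2 = (\<Sum>i<m. \<tau> i * \<nu> i)"
    and *: "s\<^sup>2 * (\<Sum>i<r. \<tau> i ^ (2 * q) * \<nu> i)
      \<le> 4 * (\<Sum>i\<in>{r..<m}. \<Sum>j<r + K. \<tau> i ^ (2 * q) * ((U\<^sup>T * G) $$ (i, j))\<^sup>2)"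
    by (rule range_finder_residual[OF B G U BB \<tau>(1) less_imp_le[OF r(2)] alg s lower]) iprover+
  have rm: "r \<le> m" using r by simp
  define D where "D = 2 * X / (s * \<sigma> ^ (2 * q - 1))"
  define S where "S = (\<Sum>i<r. \<tau> i ^ (2 * q) * \<nu> i)"
  have D0: "0 \<le> D" using X(2) s \<sigma>(1) by (simp add: D_def)
  have "s\<^sup>2 * S \<le> 4 * X\<^sup>2" using * X(1) unfolding S_def by linarith
  then have S: "S \<le> (2 * X / s)\<^sup>2"
    using s by (simp add: power_divide power_mult_distrib pos_le_divide_eq mult.commute)
  have head: "(\<Sum>i<r. \<tau> i * \<nu> i) \<le> D\<^sup>2"
  \<comment> \<open>For \<open>\<sigma> = 0\<close> the quotient \<open>D\<close> is 0 by the
    convention for division, so the head has to vanish exactly; this is what \<open>X = 0\<close> is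
    for.\<close>
  proof (cases "\<sigma> = 0")
    case True
    then have "S \<le> 0" using S X0 by simp
    moreover have t: "0 \<le> \<tau> i ^ (2 * q) * \<nu> i" if "i < r" for i
      using that \<nu>(1)[of i] \<tau>(1)[of i] rm by simp
    then have "0 \<le> S" unfolding S_def by (intro sum_nonneg) auto
    ultimately have "\<forall>i\<in>{..<r}. \<tau> i ^ (2 * q) * \<nu> i = 0"
      using t unfolding S_def by (subst sum_nonneg_eq_0_iff[symmetric]) auto
    then have "\<forall>i\<in>{..<r}. \<tau> i * \<nu> i = 0" by auto
    then have "(\<Sum>i<r. \<tau> i * \<nu> i) = 0" by (rule sum.neutral)
    then show ?thesis by simp
  next
    case False
    then have \<sigma>: "0 < \<sigma>" "\<tau> (r - 1) = \<sigma>\<^sup>2" using \<sigma> by auto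
    define c where "c = (\<sigma>\<^sup>2) ^ (2 * q - 1)"
    have c: "0 < c" using \<sigma> by (simp add: c_def)
    have "c * (\<tau> i * \<nu> i) \<le> \<tau> i ^ (2 * q) * \<nu> i" if i: "i < r" for i
    proof -
      have "\<sigma>\<^sup>2 \<le> \<tau> i" using \<tau>(2)[of i "r - 1"] i r \<sigma> by simp
      then have "c \<le> \<tau> i ^ (2 * q - 1)" unfolding c_def by (intro power_mono) auto
      then have "c * \<tau> i \<le> \<tau> i ^ (2 * q - 1) * \<tau> i"
        using \<tau>(1)[of i] i r by (intro mult_right_mono) auto
      also have "\<dots> = \<tau> i ^ (2 * q)" using q power_minus_mult[of "2 * q" "\<tau> i"] by simp
      finally show ?thesis using \<nu>(1)[of i] i r by (simp add: mult.assoc[symmetric] mult_right_mono)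
    qed
    then have "c * (\<Sum>i<r. \<tau> i * \<nu> i) \<le> S"
      unfolding S_def sum_distrib_left by (intro sum_mono) auto
    then have "c * (\<Sum>i<r. \<tau> i * \<nu> i) \<le> (2 * X / s)\<^sup>2" using S by linarith
    then have "(\<Sum>i<r. \<tau> i * \<nu> i) \<le> (2 * X / s)\<^sup>2 / c" using c by (simp only: pos_le_divide_eq mult.commute)
    also have "\<dots> = D\<^sup>2" unfolding D_def c_def
      by (simp add: power_divide power_mult_distrib power_mult[symmetric] mult.commute)
    finally show ?thesis .
  qed
  have tail: "(\<Sum>i\<in>{r..<m}. \<tau> i * \<nu> i) \<le> (\<Sum>i\<in>{r..<m}. \<tau> i)"
    using \<nu> \<tau>(1) by (intro sum_mono) (simp add: mult_left_le)
  have "(frob_norm (B - Q * Q\<^sup>T * B))\<^sup>2 \<le> D\<^sup>2 + (\<Sum>i\<in>{r..<m}. \<tau> i)"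
    unfolding NB using head tail sum.atLeastLessThan_concat[of 0 r m "\<lambda>i. \<tau> i * \<nu> i"] rm
    by (simp add: lessThan_atLeast0)
  then have "frob_norm (B - Q * Q\<^sup>T * B) \<le> sqrt (D\<^sup>2 + (\<Sum>i\<in>{r..<m}. \<tau> i))"
    by (rule real_le_rsqrt)
  also have "\<dots> \<le> sqrt (D\<^sup>2) + sqrt (\<Sum>i\<in>{r..<m}. \<tau> i)"
    using \<tau>(1) by (intro sqrt_add_le_add_sqrt) (auto intro!: sum_nonneg)
  also have "sqrt (D\<^sup>2) = D" using D0 by simp
  finally show ?thesis unfolding D_def .
qed

section \<open>Rotation invariance of Gaussian vectors\<close>

abbreviation std_gauss :: "real measure" where
  "std_gauss \<equiv> density lborel (\<lambda>x. ennreal (std_normal_density x))"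

abbreviation lebJ :: "'i set \<Rightarrow> ('i \<Rightarrow> real) measure" where
  "lebJ J \<equiv> PiM J (\<lambda>_. lborel)"

definition gauss :: "'i set \<Rightarrow> ('i \<Rightarrow> real) measure" where
  "gauss J = PiM J (\<lambda>_. std_gauss)"

lemmas coordinate_measurable = borel_measurable_add borel_measurable_uminus borel_measurable_sum
  borel_measurable_times borel_measurable_power measurable_component_singleton

lemma sets_gauss [measurable_cong, simp]: "sets (gauss J) = sets (PiM J (\<lambda>_. borel))"
  unfolding gauss_def by (intro sets_PiM_cong) auto

lemma prob_space_std_normal: "prob_space std_gauss"
  by (rule prob_space_normal_density) simp

lemma prob_space_gauss: "prob_space (gauss J)"
  unfolding gauss_def by (intro prob_space_PiM prob_space_std_normal)

lemma product_sigma_finite_std_normal: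
  "product_sigma_finite (\<lambda>_. std_gauss)"
  by (intro product_sigma_finite.intro prob_space_imp_sigma_finite prob_space_std_normal)

lemma product_sigma_finite_lborel: "product_sigma_finite (\<lambda>_::'i. lborel :: real measure)"
  by (intro product_sigma_finite.intro sigma_finite_lborel)

lemma gauss_eq_density:
  assumes J: "finite (J :: 'i set)"
  shows "gauss J = density (lebJ J) (\<lambda>x. ennreal (\<Prod>i\<in>J. std_normal_density (x i)))"
proof -
  let ?D = "density (lebJ J) (\<lambda>x. ennreal (\<Prod>i\<in>J. std_normal_density (x i)))"
  interpret L: product_sigma_finite "\<lambda>_::'i. lborel :: real measure" by (rule product_sigma_finite_lborel)
  interpret S: product_sigma_finite "\<lambda>_::'i. std_gauss"
    by (rule product_sigma_finite_std_normal)
  show ?thesis unfolding gauss_def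
  proof (rule S.PiM_eqI[OF J, symmetric])
    show "sets ?D
        = sets (PiM J (\<lambda>_. std_gauss))"
      by (simp, intro sets_PiM_cong) auto
    fix A :: "'i \<Rightarrow> real set"
    assume A: "\<And>i. i \<in> J \<Longrightarrow> A i \<in> sets std_gauss"
    have PE: "Pi\<^sub>E J A \<in> sets (lebJ J)" using A J by (intro sets_PiM_I_finite) auto
    have "emeasure ?D (Pi\<^sub>E J A)
      = (\<integral>\<^sup>+x. ennreal (\<Prod>i\<in>J. std_normal_density (x i)) * indicator (Pi\<^sub>E J A) x \<partial>lebJ J)"
      using PE by (subst emeasure_density) auto
    also have "\<dots> = (\<integral>\<^sup>+x. (\<Prod>i\<in>J. ennreal (std_normal_density (x i)) * indicator (A i) (x i)) \<partial>lebJ J)"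
    proof (rule nn_integral_cong)
      fix x assume x: "x \<in> space (PiM J (\<lambda>_. lborel :: real measure))"
      have "indicator (Pi\<^sub>E J A) x = (\<Prod>i\<in>J. indicator (A i) (x i) :: ennreal)"
        using x J by (auto simp: indicator_def space_PiM PiE_iff prod_zero_iff split: if_splits)
      then show "ennreal (\<Prod>i\<in>J. std_normal_density (x i)) * indicator (Pi\<^sub>E J A) x
          = (\<Prod>i\<in>J. ennreal (std_normal_density (x i)) * indicator (A i) (x i))"
        by (simp add: prod.distrib prod_ennreal)
    qed
    also have "\<dots> = (\<Prod>i\<in>J. \<integral>\<^sup>+x. ennreal (std_normal_density x) * indicator (A i) x \<partial>lborel)"
      using A J by (intro L.product_nn_integral_prod) auto
    also have "\<dots> = (\<Prod>i\<in>J. emeasure std_gauss (A i))"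
      using A by (intro prod.cong refl) (simp add: emeasure_density)
    finally show "emeasure ?D (Pi\<^sub>E J A)
      = (\<Prod>i\<in>J. emeasure std_gauss (A i))" .
  qed
qed

lemma prod_std_normal_density:
  "(\<Prod>i\<in>J. std_normal_density (x i)) = (1 / sqrt (2 * pi)) ^ card J * exp (- (\<Sum>i\<in>J. (x i)\<^sup>2) / 2)"
proof (cases "finite J")
  case True
  have "exp (- (\<Sum>i\<in>J. (x i)\<^sup>2) / 2) = exp (\<Sum>i\<in>J. - (x i)\<^sup>2 / 2)"
    by (simp add: sum_divide_distrib sum_negf)
  also have "\<dots> = (\<Prod>i\<in>J. exp (- (x i)\<^sup>2 / 2))" by (rule exp_sum[OF True])
  finally show ?thesis
    unfolding std_normal_density_def prod.distrib by simp
qed simp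

lemma nn_integral_PiM_lborel_translate:
  assumes J: "finite (J :: 'i set)" and f: "f \<in> borel_measurable (lebJ J)"
  shows "(\<integral>\<^sup>+y. f (\<lambda>i\<in>J. y i + a i) \<partial>lebJ J) = (\<integral>\<^sup>+y. f y \<partial>lebJ J)"
proof -
  let ?T = "\<lambda>y. \<lambda>i\<in>J. y i + a i"
  interpret L: product_sigma_finite "\<lambda>_::'i. lborel :: real measure" by (rule product_sigma_finite_lborel)
  have T: "?T \<in> measurable (lebJ J) (lebJ J)"
    by (intro measurable_restrict) (auto intro!: coordinate_measurable)
  have "distr (lebJ J) (lebJ J) ?T = lebJ J"
  proof (rule L.PiM_eqI[OF J])
    fix A :: "'i \<Rightarrow> real set" assume A: "\<And>i. i \<in> J \<Longrightarrow> A i \<in> sets lborel"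
    have PE: "Pi\<^sub>E J A \<in> sets (lebJ J)" using A J by (intro sets_PiM_I_finite) auto
    have "?T -` Pi\<^sub>E J A \<inter> space (lebJ J) = Pi\<^sub>E J (\<lambda>i. (+) (a i) -` A i)"
      by (auto simp: space_PiM PiE_iff add.commute restrict_def extensional_def)
    then have "emeasure (distr (lebJ J) (lebJ J) ?T) (Pi\<^sub>E J A)
        = (\<Prod>i\<in>J. emeasure lborel ((+) (a i) -` A i))"
      using A J measurable_sets_borel[of "(+) (a _)" lborel]
      by (subst emeasure_distr[OF T PE]) (auto intro!: L.emeasure_PiM measurable_sets_borel[of _ borel])
    also have "\<dots> = (\<Prod>i\<in>J. emeasure lborel (A i))"
    proof (rule prod.cong[OF refl])
      fix i assume "i \<in> J"
      then show "emeasure lborel ((+) (a i) -` A i) = emeasure lborel (A i)"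
        using A[of i] by (subst (2) lborel_distr_plus[of "a i", symmetric], subst emeasure_distr) auto
    qed
    finally show "emeasure (distr (lebJ J) (lebJ J) ?T) (Pi\<^sub>E J A) = (\<Prod>i\<in>J. emeasure lborel (A i))" .
  qed simp
  then have "(\<integral>\<^sup>+y. f y \<partial>lebJ J) = (\<integral>\<^sup>+y. f y \<partial>distr (lebJ J) (lebJ J) ?T)" by simp
  also have "\<dots> = (\<integral>\<^sup>+y. f (\<lambda>i\<in>J. y i + a i) \<partial>lebJ J)"
    by (rule nn_integral_distr[OF T]) (use f in simp)
  finally show ?thesis ..
qed

lemma nn_integral_shear_snd:
  assumes J: "finite (J :: 'i set)" and F: "(\<lambda>(x, y). F x y) \<in> borel_measurable (lebJ J \<Otimes>\<^sub>M lebJ J)"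
  shows "(\<integral>\<^sup>+x. \<integral>\<^sup>+y. F x (\<lambda>i\<in>J. y i + a x i) \<partial>lebJ J \<partial>lebJ J) = (\<integral>\<^sup>+x. \<integral>\<^sup>+y. F x y \<partial>lebJ J \<partial>lebJ J)"
proof (rule nn_integral_cong)
  fix x assume "x \<in> space (lebJ J :: ('i \<Rightarrow> real) measure)"
  then have "F x \<in> borel_measurable (lebJ J)"
    using measurable_Pair2[OF F] by simp
  then show "(\<integral>\<^sup>+y. F x (\<lambda>i\<in>J. y i + a x i) \<partial>lebJ J) = (\<integral>\<^sup>+y. F x y \<partial>lebJ J)"
    by (rule nn_integral_PiM_lborel_translate[OF J])
qed

lemma nn_integral_shear_fst:
  assumes J: "finite (J :: 'i set)" and F: "(\<lambda>(x, y). F x y) \<in> borel_measurable (lebJ J \<Otimes>\<^sub>M lebJ J)"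
    and a: "(\<lambda>(x, y). F (\<lambda>i\<in>J. x i + a y i) y) \<in> borel_measurable (lebJ J \<Otimes>\<^sub>M lebJ J)"
  shows "(\<integral>\<^sup>+x. \<integral>\<^sup>+y. F (\<lambda>i\<in>J. x i + a y i) y \<partial>lebJ J \<partial>lebJ J) = (\<integral>\<^sup>+x. \<integral>\<^sup>+y. F x y \<partial>lebJ J \<partial>lebJ J)"
proof -
  interpret L: product_sigma_finite "\<lambda>_::'i. lborel :: real measure" by (rule product_sigma_finite_lborel)
  interpret pair_sigma_finite "lebJ J :: ('i \<Rightarrow> real) measure" "lebJ J :: ('i \<Rightarrow> real) measure"
    by (intro pair_sigma_finite.intro L.sigma_finite J)
  have "(\<integral>\<^sup>+x. \<integral>\<^sup>+y. F (\<lambda>i\<in>J. x i + a y i) y \<partial>lebJ J \<partial>lebJ J)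
      = (\<integral>\<^sup>+y. \<integral>\<^sup>+x. F (\<lambda>i\<in>J. x i + a y i) y \<partial>lebJ J \<partial>lebJ J)"
    using Fubini'[OF a] by simp
  also have "\<dots> = (\<integral>\<^sup>+y. \<integral>\<^sup>+x. F x y \<partial>lebJ J \<partial>lebJ J)"
  proof (rule nn_integral_cong)
    fix y assume "y \<in> space (lebJ J :: ('i \<Rightarrow> real) measure)"
    then have "(\<lambda>x. F x y) \<in> borel_measurable (lebJ J)"
      using measurable_Pair1[OF F] by simp
    then show "(\<integral>\<^sup>+x. F (\<lambda>i\<in>J. x i + a y i) y \<partial>lebJ J) = (\<integral>\<^sup>+x. F x y \<partial>lebJ J)"
      by (rule nn_integral_PiM_lborel_translate[OF J])
  qed
  also have "\<dots> = (\<integral>\<^sup>+x. \<integral>\<^sup>+y. F x y \<partial>lebJ J \<partial>lebJ J)"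
    using Fubini'[OF F] by simp
  finally show ?thesis .
qed

lemma measurable_lin [measurable]:
  assumes "finite J"
  shows "(\<lambda>x. \<lambda>i\<in>J. \<Sum>j\<in>J. u i j * x j) \<in> measurable (lebJ J) (lebJ J)"
  by (intro measurable_restrict) (auto intro!: coordinate_measurable)

lemma sets_lebJ [simp]: "sets (lebJ J) = sets (PiM J (\<lambda>_. borel))"
  by (intro sets_PiM_cong) auto

text \<open>The map \<open>(x, y) \<mapsto> (- u\<^sup>T y, u x)\<close> is a product of three block shears, each of which
  preserves Lebesgue measure by translation invariance; so no determinant is needed.\<close>

lemma nn_integral_gauss_orthogonal:
  fixes u :: "'i \<Rightarrow> 'i \<Rightarrow> real"
  assumes J: "finite J" and u: "orthogonal_fam J u"
    and f: "f \<in> borel_measurable (PiM J (\<lambda>_. borel))"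
  shows "(\<integral>\<^sup>+x. f (\<lambda>i\<in>J. \<Sum>j\<in>J. u i j * x j) \<partial>gauss J) = (\<integral>\<^sup>+x. f x \<partial>gauss J)"
proof -
  let ?L = "lebJ J"
  define U where "U x i = (\<Sum>j\<in>J. u i j * x j)" for x :: "'i \<Rightarrow> real" and i
  define V where "V y i = (\<Sum>j\<in>J. - u j i * y j)" for y :: "'i \<Rightarrow> real" and i
  define \<rho> where "\<rho> x = (\<Prod>i\<in>J. std_normal_density (x i))" for x :: "'i \<Rightarrow> real"
  have fL: "f \<in> borel_measurable ?L" using f by (subst measurable_cong_sets[OF sets_lebJ refl])
  have \<rho>m: "\<rho> \<in> borel_measurable ?L"
    unfolding \<rho>_def by (auto intro!: borel_measurable_prod measurable_compose[OF measurable_component_singleton])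
  have \<rho>0: "0 \<le> \<rho> x" for x unfolding \<rho>_def by (intro prod_nonneg) auto
  have \<rho>_eq: "\<rho> x = \<rho> y" if "(\<Sum>i\<in>J. (x i)\<^sup>2) = (\<Sum>i\<in>J. (y i)\<^sup>2)" for x y
    unfolding \<rho>_def prod_std_normal_density that ..
  have comp: "(\<lambda>p. fst p i) \<in> borel_measurable (?L \<Otimes>\<^sub>M ?L)" "(\<lambda>p. snd p i) \<in> borel_measurable (?L \<Otimes>\<^sub>M ?L)"
    if "i \<in> J" for i
    using that by (auto intro!: measurable_compose[OF measurable_fst] measurable_compose[OF measurable_snd]
        measurable_component_singleton)
  define S1 where "S1 = (\<lambda>(x, y). (x, \<lambda>i\<in>J. y i + U x i))"
  define S2 where "S2 = (\<lambda>(x, y). (\<lambda>i\<in>J. x i + V y i, y :: 'i \<Rightarrow> real))"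
  have S1m: "S1 \<in> measurable (?L \<Otimes>\<^sub>M ?L) (?L \<Otimes>\<^sub>M ?L)"
    unfolding S1_def case_prod_beta U_def
    by (intro measurable_Pair measurable_fst measurable_restrict)
       (auto intro!: borel_measurable_add borel_measurable_sum borel_measurable_times comp)
  have S2m: "S2 \<in> measurable (?L \<Otimes>\<^sub>M ?L) (?L \<Otimes>\<^sub>M ?L)"
    unfolding S2_def case_prod_beta V_def
    by (intro measurable_Pair measurable_snd measurable_restrict)
       (auto intro!: borel_measurable_add borel_measurable_sum borel_measurable_times comp)
  have inv1: "(\<integral>\<^sup>+x. \<integral>\<^sup>+y. F (S1 (x, y)) \<partial>?L \<partial>?L) = (\<integral>\<^sup>+x. \<integral>\<^sup>+y. F (x, y) \<partial>?L \<partial>?L)"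
    if "F \<in> borel_measurable (?L \<Otimes>\<^sub>M ?L)" for F
    using nn_integral_shear_snd[OF J, of "\<lambda>x y. F (x, y)" U] that by (simp add: S1_def)
  have inv2: "(\<integral>\<^sup>+x. \<integral>\<^sup>+y. F (S2 (x, y)) \<partial>?L \<partial>?L) = (\<integral>\<^sup>+x. \<integral>\<^sup>+y. F (x, y) \<partial>?L \<partial>?L)"
    if "F \<in> borel_measurable (?L \<Otimes>\<^sub>M ?L)" for F
    using nn_integral_shear_fst[OF J, of "\<lambda>x y. F (x, y)" V] that measurable_compose[OF S2m that]
    by (simp add: S2_def case_prod_beta)
  \<comment> \<open>The second block is an auxiliary independent Gaussian. \<open>F\<close> passes
    only the second component to \<open>f\<close>; after \<open>S1\<close>, \<open>S2\<close>,
    \<open>S1\<close> that component is \<open>U x\<close> and the first is minus the transpose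
    applied to \<open>y\<close>. Both have unchanged length, so the product of the densities is
    preserved.\<close>
  define F where "F = (\<lambda>(x, y). f y * (ennreal (\<rho> x) * ennreal (\<rho> y)))"
  have Fm: "F \<in> borel_measurable (?L \<Otimes>\<^sub>M ?L)"
    unfolding F_def case_prod_beta
    by (intro borel_measurable_times_ennreal measurable_compose[OF measurable_snd fL]
        measurable_compose[OF measurable_fst, OF measurable_compose[OF \<rho>m measurable_ennreal]]
        measurable_compose[OF measurable_snd, OF measurable_compose[OF \<rho>m measurable_ennreal]])
  have F2m: "(\<lambda>p. F (S1 p)) \<in> borel_measurable (?L \<Otimes>\<^sub>M ?L)" by (rule measurable_compose[OF S1m Fm])
  have F3m: "(\<lambda>p. F (S1 (S2 p))) \<in> borel_measurable (?L \<Otimes>\<^sub>M ?L)" by (rule measurable_compose[OF S2m F2m])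
  have UV: "U (\<lambda>i\<in>J. x i + V (\<lambda>i\<in>J. y i + U x i) i) i = - y i" if "i \<in> J" for x y i
  proof -
    have "V (\<lambda>i\<in>J. y i + U x i) j = - (\<Sum>r\<in>J. u r j * y r) - x j" if "j \<in> J" for j
    proof -
      have "V (\<lambda>i\<in>J. y i + U x i) j = - (\<Sum>r\<in>J. u r j * y r) - (\<Sum>r\<in>J. u r j * U x r)"
        unfolding V_def by (simp add: algebra_simps sum.distrib sum_negf sum_subtractf)
      also have "(\<Sum>r\<in>J. u r j * U x r) = x j"
        unfolding U_def by (rule orthogonal_fam_inverse[OF orthogonal_fam_transpose[OF u] J that])
      finally show ?thesis .
    qed
    then have "U (\<lambda>i\<in>J. x i + V (\<lambda>i\<in>J. y i + U x i) i) i = (\<Sum>j\<in>J. u i j * - (\<Sum>r\<in>J. u r j * y r))"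
      unfolding U_def by (intro sum.cong) auto
    also have "\<dots> = - y i"
      using orthogonal_fam_inverse[OF u J that, of y] by (simp add: sum_negf)
    finally show ?thesis .
  qed
  have T: "F (S1 (S2 (S1 (x, y)))) = f (\<lambda>i\<in>J. U x i) * ennreal (\<rho> x) * ennreal (\<rho> y)" for x y
  proof -
    let ?x = "\<lambda>i\<in>J. x i + V (\<lambda>i\<in>J. y i + U x i) i"
    have y: "(\<lambda>i\<in>J. (\<lambda>i\<in>J. y i + U x i) i + U ?x i) = (\<lambda>i\<in>J. U x i)"
      using UV[of _ x y] by (intro restrict_ext) simp
    have "\<rho> (\<lambda>i\<in>J. U x i) = \<rho> x"
      by (rule \<rho>_eq) (use orthogonal_fam_parseval[OF u J, of x] in \<open>simp add: U_def\<close>)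
    moreover have "\<rho> ?x = \<rho> y"
    proof (rule \<rho>_eq)
      have "(\<Sum>i\<in>J. (?x i)\<^sup>2) = (\<Sum>i\<in>J. (U ?x i)\<^sup>2)"
        unfolding U_def[of ?x] by (rule orthogonal_fam_parseval[OF u J, symmetric])
      also have "\<dots> = (\<Sum>i\<in>J. (y i)\<^sup>2)" using UV by (intro sum.cong) auto
      finally show "(\<Sum>i\<in>J. (?x i)\<^sup>2) = (\<Sum>i\<in>J. (y i)\<^sup>2)" .
    qed
    ultimately show ?thesis
      unfolding S1_def S2_def F_def split y by (simp add: ac_simps)
  qed
  have Um: "(\<lambda>x. \<lambda>i\<in>J. U x i) \<in> measurable ?L ?L" unfolding U_def by (rule measurable_lin[OF J])
  have one: "(\<integral>\<^sup>+x. ennreal (\<rho> x) \<partial>?L) = 1"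
  proof -
    have "(\<integral>\<^sup>+x. ennreal (\<rho> x) \<partial>?L) = emeasure (gauss J) (space (gauss J))"
      unfolding gauss_eq_density[OF J] \<rho>_def[symmetric] using \<rho>m sets.top[of ?L] by (subst emeasure_density) auto
    then show ?thesis using prob_space.emeasure_space_1[OF prob_space_gauss] by simp
  qed
  have g: "(\<integral>\<^sup>+x. h x \<partial>gauss J) = (\<integral>\<^sup>+x. ennreal (\<rho> x) * h x \<partial>?L)" if "h \<in> borel_measurable ?L" for h
    unfolding gauss_eq_density[OF J] \<rho>_def[symmetric] using \<rho>m that by (intro nn_integral_density) auto
  have \<rho>e: "(\<lambda>x. ennreal (\<rho> x)) \<in> borel_measurable ?L" using \<rho>m by simp
  have fU: "(\<lambda>x. f (\<lambda>i\<in>J. U x i)) \<in> borel_measurable ?L" by (rule measurable_compose[OF Um fL])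
  have "(\<integral>\<^sup>+x. f (\<lambda>i\<in>J. U x i) \<partial>gauss J) = (\<integral>\<^sup>+x. f (\<lambda>i\<in>J. U x i) * ennreal (\<rho> x) \<partial>?L)"
    by (subst g[OF fU]) (simp add: mult.commute)
  also have "\<dots> = (\<integral>\<^sup>+x. \<integral>\<^sup>+y. f (\<lambda>i\<in>J. U x i) * ennreal (\<rho> x) * ennreal (\<rho> y) \<partial>?L \<partial>?L)"
    using \<rho>e by (simp add: nn_integral_cmult one)
  also have "\<dots> = (\<integral>\<^sup>+x. \<integral>\<^sup>+y. F (x, y) \<partial>?L \<partial>?L)"
    unfolding T[symmetric] by (simp only: inv1[OF F3m] inv2[OF F2m] inv1[OF Fm])
  also have "\<dots> = (\<integral>\<^sup>+x. ennreal (\<rho> x) * (\<integral>\<^sup>+y. ennreal (\<rho> y) * f y \<partial>?L) \<partial>?L)"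
    unfolding F_def using \<rho>e fL
    by (intro nn_integral_cong, subst nn_integral_cmult[symmetric]) (auto simp: ac_simps)
  also have "\<dots> = (\<integral>\<^sup>+y. ennreal (\<rho> y) * f y \<partial>?L)"
    using \<rho>e by (simp add: nn_integral_multc one)
  also have "\<dots> = (\<integral>\<^sup>+x. f x \<partial>gauss J)" by (rule g[OF fL, symmetric])
  finally show ?thesis unfolding U_def .
qed

section \<open>Gaussian integrals\<close>

lemma nn_integral_std_gauss_exp_sq:
  assumes c: "c > - 1 / 2"
  shows "(\<integral>\<^sup>+x. ennreal (exp (- c * x\<^sup>2)) \<partial>std_gauss) = ennreal (1 / sqrt (1 + 2 * c))"
proof -
  define s where "s = 1 / sqrt (1 + 2 * c)"
  have s: "s > 0" and s2: "1 / s\<^sup>2 = 1 + 2 * c" using c by (auto simp: s_def power_divide)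
  have eq: "std_normal_density x * exp (- c * x\<^sup>2) = s * normal_density 0 s x" for x
  proof -
    have "std_normal_density x * exp (- c * x\<^sup>2) = 1 / sqrt (2 * pi) * exp (- x\<^sup>2 / 2 + - c * x\<^sup>2)"
      by (simp add: std_normal_density_def exp_add[symmetric])
    also have "- x\<^sup>2 / 2 + - c * x\<^sup>2 = - (x - 0)\<^sup>2 / 2 * (1 / s\<^sup>2)"
      unfolding s2 by (simp add: algebra_simps)
    also have "\<dots> = - (x - 0)\<^sup>2 / (2 * s\<^sup>2)" by simp
    also have "1 / sqrt (2 * pi) = s * (1 / sqrt (2 * pi * s\<^sup>2))"
      using s by (simp add: real_sqrt_mult)
    finally show ?thesis by (simp add: normal_density_def)
  qed
  have one: "(\<integral>\<^sup>+x. ennreal (normal_density 0 s x) \<partial>lborel) = 1"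
    using s by (subst nn_integral_eq_integral) auto
  have "(\<integral>\<^sup>+x. ennreal (exp (- c * x\<^sup>2)) \<partial>std_gauss)
      = (\<integral>\<^sup>+x. ennreal s * ennreal (normal_density 0 s x) \<partial>lborel)"
  proof (subst nn_integral_density)
    show "(\<integral>\<^sup>+x. ennreal (std_normal_density x) * ennreal (exp (- c * x\<^sup>2)) \<partial>lborel)
        = (\<integral>\<^sup>+x. ennreal s * ennreal (normal_density 0 s x) \<partial>lborel)"
    proof (rule nn_integral_cong)
      fix x :: real
      have "ennreal (std_normal_density x) * ennreal (exp (- c * x\<^sup>2)) = ennreal (std_normal_density x * exp (- c * x\<^sup>2))"
        by (rule ennreal_mult[symmetric]) auto
      also have "\<dots> = ennreal s * ennreal (normal_density 0 s x)"
        unfolding eq using s by (intro ennreal_mult) auto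
      finally show "ennreal (std_normal_density x) * ennreal (exp (- c * x\<^sup>2)) = ennreal s * ennreal (normal_density 0 s x)" .
    qed
  qed auto
  also have "\<dots> = ennreal s" by (subst nn_integral_cmult) (auto simp: one)
  finally show ?thesis unfolding s_def .
qed

lemma nn_integral_gauss_exp_sq:
  assumes J: "finite J" and c: "\<And>i. i \<in> J \<Longrightarrow> c i > - 1 / 2"
  shows "(\<integral>\<^sup>+x. ennreal (exp (- (\<Sum>i\<in>J. c i * (x i)\<^sup>2))) \<partial>gauss J) = ennreal (\<Prod>i\<in>J. 1 / sqrt (1 + 2 * c i))"
proof -
  interpret S: product_sigma_finite "\<lambda>_. std_gauss" by (rule product_sigma_finite_std_normal)
  have "(\<integral>\<^sup>+x. ennreal (exp (- (\<Sum>i\<in>J. c i * (x i)\<^sup>2))) \<partial>gauss J)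
      = (\<integral>\<^sup>+x. (\<Prod>i\<in>J. ennreal (exp (- c i * (x i)\<^sup>2))) \<partial>PiM J (\<lambda>_. std_gauss))"
    unfolding gauss_def using J by (simp add: prod_ennreal exp_sum sum_negf[symmetric])
  also have "\<dots> = (\<Prod>i\<in>J. \<integral>\<^sup>+x. ennreal (exp (- c i * x\<^sup>2)) \<partial>std_gauss)"
    by (rule S.product_nn_integral_prod[OF J, of "\<lambda>i x. ennreal (exp (- c i * x\<^sup>2))"]) auto
  also have "\<dots> = (\<Prod>i\<in>J. ennreal (1 / sqrt (1 + 2 * c i)))"
    using c by (intro prod.cong refl nn_integral_std_gauss_exp_sq) auto
  also have "\<dots> = ennreal (\<Prod>i\<in>J. 1 / sqrt (1 + 2 * c i))"
  proof (rule prod_ennreal)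
    fix i assume "i \<in> J"
    then have "0 \<le> 1 + 2 * c i" using c[of i] by linarith
    then show "0 \<le> 1 / sqrt (1 + 2 * c i)" by simp
  qed
  finally show ?thesis .
qed

text \<open>t^(k/2) exp(- \<open>\<theta>\<close> t) is maximal at t = k / (2
  \<open>\<theta>\<close>). Measured in units of this point the bound is the tangent inequality
  \<open>y \<le> exp (y - 1)\<close>, so the constant is sharp.\<close>

lemma sqrt_power_le_exp:
  assumes t: "0 \<le> t" and \<theta>: "0 < \<theta>" and k: "0 < k"
  shows "sqrt t ^ k \<le> (real k / (2 * exp 1 * \<theta>)) powr (real k / 2) * exp (\<theta> * t)"
proof (cases "t = 0")
  case True
  then show ?thesis by (simp add: zero_power[OF k])
next
  case False
  with t have t: "t > 0" by simp
  define y where "y = 2 * \<theta> * t / real k"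
  have y: "y > 0" using t \<theta> k by (simp add: y_def)
  have "y \<le> exp (y - 1)" using exp_ge_add_one_self[of "y - 1"] by simp
  then have "y powr (real k / 2) \<le> exp (y - 1) powr (real k / 2)" using y by (intro powr_mono2) auto
  also have "\<dots> = exp (\<theta> * t - real k / 2)"
    using k by (simp add: powr_def y_def field_simps)
  finally have a: "y powr (real k / 2) \<le> exp (\<theta> * t - real k / 2)" .
  have "sqrt t ^ k = t powr (real k / 2)"
    using t by (simp add: powr_half_sqrt[symmetric] powr_realpow[symmetric] powr_powr)
  also have "\<dots> = (y * (real k / (2 * \<theta>))) powr (real k / 2)" using \<theta> k by (simp add: y_def)
  also have "\<dots> = y powr (real k / 2) * (real k / (2 * \<theta>)) powr (real k / 2)"
    using y \<theta> by (intro powr_mult)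
  also have "\<dots> \<le> exp (\<theta> * t - real k / 2) * (real k / (2 * \<theta>)) powr (real k / 2)"
    using a by (intro mult_right_mono) auto
  also have "\<dots> = (real k / (2 * \<theta>)) powr (real k / 2) * (1 / exp 1) powr (real k / 2) * exp (\<theta> * t)"
  proof -
    have "(1 / exp 1) powr (real k / 2) = exp (- (real k / 2))" by (simp add: powr_def ln_div)
    moreover have "exp (\<theta> * t - real k / 2) = exp (\<theta> * t) * exp (- (real k / 2))"
      by (simp add: exp_add[symmetric])
    ultimately show ?thesis by simp
  qed
  also have "(real k / (2 * \<theta>)) powr (real k / 2) * (1 / exp 1) powr (real k / 2)
      = (real k / (2 * exp 1 * \<theta>)) powr (real k / 2)"
    using \<theta> by (subst powr_mult[symmetric]) (auto simp: field_simps)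
  finally show ?thesis .
qed

text \<open>Power moments through the exponential moment, which factorises over the coordinates.
  \<open>\<theta>\<close> stays free to be optimised in each application.\<close>

lemma nn_integral_gauss_norm_power_le:
  assumes J: "finite J" and c: "\<And>i. i \<in> J \<Longrightarrow> 0 \<le> c i" "\<And>i. i \<in> J \<Longrightarrow> 2 * \<theta> * c i < 1"
    and \<theta>: "0 < \<theta>" and k: "0 < k"
  shows "(\<integral>\<^sup>+x. ennreal (sqrt (\<Sum>i\<in>J. c i * (x i)\<^sup>2) ^ k) \<partial>gauss J)
    \<le> ennreal ((real k / (2 * exp 1 * \<theta>)) powr (real k / 2) * (\<Prod>i\<in>J. 1 / sqrt (1 - 2 * \<theta> * c i)))"
proof -
  let ?G = "\<lambda>x. ennreal (exp (- (\<Sum>i\<in>J. - \<theta> * c i * (x i)\<^sup>2)))"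
    and ?S = "\<lambda>x. \<Sum>i\<in>J. c i * (x i)\<^sup>2"
  let ?B = "(real k / (2 * exp 1 * \<theta>)) powr (real k / 2)"
  have "(\<integral>\<^sup>+x. ennreal (sqrt (?S x) ^ k) \<partial>gauss J)
      \<le> (\<integral>\<^sup>+x. ennreal ?B * ?G x \<partial>gauss J)"
  proof (rule nn_integral_mono)
    fix x :: "'a \<Rightarrow> real"
    have "sqrt (?S x) ^ k \<le> ?B * exp (\<theta> * (?S x))"
      using c \<theta> k by (intro sqrt_power_le_exp sum_nonneg) auto
    then show "ennreal (sqrt (?S x) ^ k) \<le> ennreal ?B * ?G x"
      by (simp add: ennreal_mult[symmetric] sum_distrib_left sum_negf mult.assoc del: mult_minus_left minus_mult_minus)
  qed
  also have "\<dots> = ennreal ?B * (\<integral>\<^sup>+x. ?G x \<partial>gauss J)"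
    by (intro nn_integral_cmult) (auto intro!: measurable_compose[OF _ measurable_ennreal] borel_measurable_exp
        coordinate_measurable simp: measurable_cong_sets[OF sets_gauss refl])
  also have "(\<integral>\<^sup>+x. ?G x \<partial>gauss J) = ennreal (\<Prod>i\<in>J. 1 / sqrt (1 + 2 * (- \<theta> * c i)))"
    using c by (intro nn_integral_gauss_exp_sq[OF J]) (auto simp: field_simps)
  finally show ?thesis by (simp add: ennreal_mult' mult.assoc)
qed

text \<open>At \<open>x = \<surd>k + y\<close> the exponent \<open>k\<^sup>2/(2x\<^sup>2) + x\<^sup>2/2 = k + (x - k/x)\<^sup>2/2\<close> is at most
  \<open>k + 2y\<^sup>2\<close>; this loses only a factor 2 against the exact value \<open>exp (- k)\<close>.\<close>

lemma nn_integral_std_gauss_inverse_sq_ge: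
  assumes k: "0 < k"
  shows "ennreal (exp (- k) / 2) \<le> (\<integral>\<^sup>+x. (if x\<^sup>2 = 0 then 0 else ennreal (exp (- (k\<^sup>2 / 2) / x\<^sup>2))) \<partial>std_gauss)"
proof -
  \<comment> \<open>The value at 0 is set by hand: with division by zero the exponential would be 1
    there, whereas its limit is 0.\<close>
  define g where "g x = (if x\<^sup>2 = 0 then 0 else ennreal (std_normal_density x * exp (- (k\<^sup>2 / 2) / x\<^sup>2)))" for x
  \<comment> \<open>Of the exponent 2 y^2 the density accounts for y^2 / 2. The remaining
    coefficient 3/2 integrates to 1 / sqrt (1 + 3) = 1/2, the source of the factor 2.\<close>
  define h where "h y = ennreal (exp (- k)) * ennreal (std_normal_density y * exp (- (3 / 2) * y\<^sup>2))" for y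
  have gm[measurable]: "g \<in> borel_measurable borel" unfolding g_def by measurable
  have hm[measurable]: "h \<in> borel_measurable borel" unfolding h_def by measurable
  define r where "r = sqrt k"
  have r: "r > 0" "r * r = k" using k by (auto simp: r_def)
  have le: "h y \<le> g x" if y: "0 \<le> y" and x: "x\<^sup>2 = (r + y)\<^sup>2" for x y
  proof -
    have pos: "r + y > 0" using r y by simp
    then have x0: "x\<^sup>2 > 0" by (simp add: x)
    define w where "w = r + y"
    have w: "w > 0" using pos by (simp add: w_def)
    have "r - y \<le> k / w"
    proof -
      have "(r - y) * w \<le> k" using r by (simp add: w_def algebra_simps)
      then show ?thesis using w by (simp add: pos_le_divide_eq)
    qed
    then have a: "w - k / w \<le> 2 * y" by (simp add: w_def)
    have "k \<le> w * w" using r y mult_mono[of r w r w] by (simp add: w_def)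
    then have b: "0 \<le> w - k / w" using w by (simp add: divide_le_eq)
    have "(w - k / w)\<^sup>2 \<le> (2 * y)\<^sup>2" using a b by (intro power_mono) auto
    moreover have "(w - k / w)\<^sup>2 = w\<^sup>2 - 2 * k + k\<^sup>2 / w\<^sup>2"
      using w by (simp add: power2_diff power_divide)
    ultimately have "k\<^sup>2 / w\<^sup>2 / 2 + w\<^sup>2 / 2 \<le> k + 2 * y\<^sup>2" by (simp add: power_mult_distrib)
    then have "- k + (- y\<^sup>2 / 2 + - (3 / 2) * y\<^sup>2) \<le> - w\<^sup>2 / 2 + - (k\<^sup>2 / 2) / w\<^sup>2" by (simp add: field_simps)
    then have "exp (- k + (- y\<^sup>2 / 2 + - (3 / 2) * y\<^sup>2)) \<le> exp (- w\<^sup>2 / 2 + - (k\<^sup>2 / 2) / w\<^sup>2)" by simp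
    then have "exp (- k) * (exp (- y\<^sup>2 / 2) * exp (- (3 / 2) * y\<^sup>2)) \<le> exp (- x\<^sup>2 / 2) * exp (- (k\<^sup>2 / 2) / x\<^sup>2)"
      unfolding exp_add x w_def .
    from mult_left_mono[OF this, of "1 / sqrt (2 * pi)"]
    have "exp (- k) * (std_normal_density y * exp (- (3 / 2) * y\<^sup>2)) \<le> std_normal_density x * exp (- (k\<^sup>2 / 2) / x\<^sup>2)"
      by (simp add: std_normal_density_def mult_ac)
    then show ?thesis using x0 unfolding h_def g_def by (simp add: ennreal_mult[symmetric] ennreal_leI)
  qed
  have he: "h (- y) = h y" for y by (simp add: h_def std_normal_density_def)
  have "ennreal (exp (- k) / 2) = ennreal (exp (- k)) * ennreal (1 / sqrt (1 + 2 * (3 / 2)))"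
    by (subst ennreal_mult[symmetric]) auto
  also have "ennreal (1 / sqrt (1 + 2 * (3 / 2))) = (\<integral>\<^sup>+y. ennreal (exp (- (3 / 2) * y\<^sup>2)) \<partial>std_gauss)"
    by (rule nn_integral_std_gauss_exp_sq[symmetric]) simp
  also have "ennreal (exp (- k)) * \<dots> = (\<integral>\<^sup>+y. h y \<partial>lborel)"
    unfolding h_def by (subst nn_integral_density, simp, simp, subst nn_integral_cmult[symmetric]) (auto simp: ennreal_mult)
  also have "\<dots> \<le> (\<integral>\<^sup>+y. h y * indicator {0..} y + h y * indicator {..0} y \<partial>lborel)"
    by (intro nn_integral_mono) (auto simp: indicator_def)
  also have "\<dots> = (\<integral>\<^sup>+y. h y * indicator {0..} y \<partial>lborel) + (\<integral>\<^sup>+y. h y * indicator {..0} y \<partial>lborel)"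
    by (intro nn_integral_add) auto
  \<comment> \<open>The half lines \<open>y \<ge> 0\<close> and \<open>y \<le> 0\<close> are shifted
    outwards to \<open>x \<ge> r\<close> and \<open>x \<le> - r\<close>, which are disjoint because
    \<open>r > 0\<close>.\<close>
  also have "\<dots> \<le> (\<integral>\<^sup>+y. g (r + 1 * y) * indicator {r..} (r + 1 * y) \<partial>lborel)
      + (\<integral>\<^sup>+y. g (- r + 1 * y) * indicator {..- r} (- r + 1 * y) \<partial>lborel)"
  proof (intro add_mono nn_integral_mono)
    fix y :: real
    show "h y * indicator {0..} y \<le> g (r + 1 * y) * indicator {r..} (r + 1 * y)"
      using le[of y "r + y"] by (auto simp: indicator_def)
    have "(- r + y)\<^sup>2 = (r + - y)\<^sup>2" by (simp add: power2_eq_square algebra_simps)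
    then show "h y * indicator {..0} y \<le> g (- r + 1 * y) * indicator {..- r} (- r + 1 * y)"
      using le[of "- y" "- r + y"] by (auto simp: indicator_def he)
  qed
  also have "\<dots> = (\<integral>\<^sup>+x. g x * indicator {r..} x \<partial>lborel) + (\<integral>\<^sup>+x. g x * indicator {..- r} x \<partial>lborel)"
    using nn_integral_real_affine[of "\<lambda>x. g x * indicator {r..} x" 1 r]
      nn_integral_real_affine[of "\<lambda>x. g x * indicator {..- r} x" 1 "- r"] by simp
  also have "\<dots> = (\<integral>\<^sup>+x. g x * indicator {r..} x + g x * indicator {..- r} x \<partial>lborel)"
    by (intro nn_integral_add[symmetric]) auto
  also have "\<dots> \<le> (\<integral>\<^sup>+x. g x \<partial>lborel)"
    using r by (intro nn_integral_mono) (auto simp: indicator_def)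
  also have "\<dots> = (\<integral>\<^sup>+x. (if x\<^sup>2 = 0 then 0 else ennreal (exp (- (k\<^sup>2 / 2) / x\<^sup>2))) \<partial>std_gauss)"
    by (subst nn_integral_density) (auto simp: g_def ennreal_mult intro!: nn_integral_cong)
  finally show ?thesis .
qed

lemma sum_eq_head:
  fixes F :: "nat \<Rightarrow> real"
  assumes "0 < n" "\<And>i. 1 \<le> i \<Longrightarrow> i < n \<Longrightarrow> F i = 0"
  shows "(\<Sum>i<n. F i) = F 0"
  using assms by (subst sum.mono_neutral_right[of _ "{0}"]) (auto simp: Suc_le_eq)

text \<open>If all members of an orthogonal family but the first are orthogonal to the unit vector
  \<open>x\<close>, the first is \<open>x\<close> up to sign. The undetermined sign is the reason
  for the square; rotating by the family makes the inner product a coordinate.\<close>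

lemma nn_integral_gauss_inner_sq:
  fixes x :: "nat \<Rightarrow> real" and f :: "real \<Rightarrow> ennreal"
  assumes n: "0 < n" and x: "(\<Sum>i<n. (x i)\<^sup>2) = 1" and f: "f \<in> borel_measurable borel"
  shows "(\<integral>\<^sup>+h. f ((\<Sum>i<n. x i * h i)\<^sup>2) \<partial>gauss {..<n}) = (\<integral>\<^sup>+y. f (y\<^sup>2) \<partial>std_gauss)"
proof -
  obtain u where u: "orthogonal_fam {..<n} u"
    and ux: "\<And>i j. 1 \<le> i \<Longrightarrow> i < n \<Longrightarrow> j < (1::nat) \<Longrightarrow> (\<Sum>r<n. u i r * x r) = 0"
    using orthogonal_fam_kernel[of n 1 "\<lambda>_. x"] by blast
  define a where "a = (\<Sum>r<n. u 0 r * x r)"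
  have "1 = (\<Sum>i<n. (\<Sum>r<n. u i r * x r)\<^sup>2)" using x orthogonal_fam_parseval[OF u, of x] by simp
  also have "\<dots> = a\<^sup>2" unfolding a_def using ux by (intro sum_eq_head[OF n]) simp
  finally have a: "a\<^sup>2 = 1" by simp
  have ip: "(\<Sum>i<n. x i * h i) = a * (\<Sum>j<n. u 0 j * h j)" for h
  proof -
    have xr: "x r = u 0 r * a" if "r < n" for r
    proof -
      have "x r = (\<Sum>i<n. u i r * (\<Sum>j<n. u i j * x j))"
        using orthogonal_fam_inverse[OF orthogonal_fam_transpose[OF u], of r x] that by simp
      also have "\<dots> = u 0 r * a" unfolding a_def using ux by (intro sum_eq_head[OF n]) simp
      finally show ?thesis .
    qed
    show ?thesis by (simp add: xr sum_distrib_left ac_simps)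
  qed
  have m: "(\<lambda>h. f ((h 0)\<^sup>2)) \<in> borel_measurable (PiM {..<n} (\<lambda>_. borel))"
    using n f by (auto intro!: measurable_compose[OF _ f] coordinate_measurable)
  have "(\<integral>\<^sup>+h. f ((\<Sum>i<n. x i * h i)\<^sup>2) \<partial>gauss {..<n})
      = (\<integral>\<^sup>+h. (\<lambda>h. f ((h 0)\<^sup>2)) (\<lambda>i\<in>{..<n}. \<Sum>j<n. u i j * h j) \<partial>gauss {..<n})"
    using n by (simp add: ip power_mult_distrib a)
  also have "\<dots> = (\<integral>\<^sup>+h. f ((h 0)\<^sup>2) \<partial>gauss {..<n})"
    by (rule nn_integral_gauss_orthogonal[OF _ u m]) simp
  also have "\<dots> = (\<integral>\<^sup>+y. f (y\<^sup>2) \<partial>distr (gauss {..<n}) std_gauss (\<lambda>h. h 0))"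
    unfolding gauss_def using n f
    by (subst nn_integral_distr) (auto intro!: measurable_component_singleton measurable_compose[OF _ f])
  also have "distr (gauss {..<n}) std_gauss (\<lambda>h. h 0) = std_gauss"
    unfolding gauss_def using n by (intro distr_PiM_component prob_space_std_normal) auto
  finally show ?thesis .
qed

section \<open>Smallest singular value of a Gaussian matrix\<close>

text \<open>Kronecker product of \<open>u\<close> with the identity: left multiplication of a matrix
  by \<open>u\<close>, read as an orthogonal map on its entries.\<close>

lemma orthogonal_fam_tensor_id:
  assumes u: "orthogonal_fam I u" and fin: "finite I" "finite S"
  shows "orthogonal_fam (I \<times> S) (\<lambda>p q. if snd p = snd q then u (fst p) (fst q) else 0)"
proof -
  have red: "(\<Sum>q\<in>I \<times> S. (if E q then v (fst q) else 0) * (if E' q then v' (fst q) else 0))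
      = (if j = j' then \<Sum>r\<in>I. v r * v' r else 0)"
    if "j \<in> S" "\<And>q. E q \<longleftrightarrow> snd q = j" "\<And>q. E' q \<longleftrightarrow> snd q = j'" for j j' E E' and v v' :: "'a \<Rightarrow> real"
  proof -
    have "(\<Sum>q\<in>I \<times> S. (if E q then v (fst q) else 0) * (if E' q then v' (fst q) else 0))
        = (\<Sum>r\<in>I. \<Sum>s\<in>S. if s = j then (if j = j' then v r * v' r else 0) else 0)"
      unfolding sum.cartesian_product by (rule sum.cong[OF refl]) (auto simp: that(2,3))
    then show ?thesis using that(1) fin by (simp add: sum.delta)
  qed
  show ?thesis
    unfolding orthogonal_fam_def
  proof (intro conjI ballI)
    fix p q assume pq: "p \<in> I \<times> S" "q \<in> I \<times> S"
    have "(\<Sum>r\<in>I \<times> S. (if snd p = snd r then u (fst p) (fst r) else 0) * (if snd q = snd r then u (fst q) (fst r) else 0))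
        = (if snd p = snd q then \<Sum>r\<in>I. u (fst p) r * u (fst q) r else 0)"
      using pq by (intro red[where v = "u (fst p)" and v' = "u (fst q)"]) auto
    then show "(\<Sum>r\<in>I \<times> S. (if snd p = snd r then u (fst p) (fst r) else 0) * (if snd q = snd r then u (fst q) (fst r) else 0))
        = (if p = q then 1 else 0)"
      using pq u by (auto simp: orthogonal_fam_def prod_eq_iff)
    have "(\<Sum>r\<in>I \<times> S. (if snd r = snd p then u (fst r) (fst p) else 0) * (if snd r = snd q then u (fst r) (fst q) else 0))
        = (if snd p = snd q then \<Sum>r\<in>I. u r (fst p) * u r (fst q) else 0)"
      using pq by (intro red[where v = "\<lambda>r. u r (fst p)" and v' = "\<lambda>r. u r (fst q)"]) auto
    then show "(\<Sum>r\<in>I \<times> S. (if snd r = snd p then u (fst r) (fst p) else 0) * (if snd r = snd q then u (fst r) (fst q) else 0))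
        = (if p = q then 1 else 0)"
      using pq u by (auto simp: orthogonal_fam_def prod_eq_iff)
  qed
qed

lemma nn_integral_gauss_rotate_rows:
  fixes u :: "'a \<Rightarrow> 'a \<Rightarrow> real"
  assumes u: "orthogonal_fam I u" and fin: "finite I" "finite S"
    and f: "f \<in> borel_measurable (PiM (I \<times> S) (\<lambda>_. borel))"
  shows "(\<integral>\<^sup>+w. f (\<lambda>(i, j)\<in>I \<times> S. \<Sum>r\<in>I. u i r * w (r, j)) \<partial>gauss (I \<times> S)) = (\<integral>\<^sup>+w. f w \<partial>gauss (I \<times> S))"
proof -
  have "(\<Sum>r\<in>I. u i r * w (r, j)) = (\<Sum>q\<in>I \<times> S. (if j = snd q then u i (fst q) else 0) * w q)"
    if "j \<in> S" for i j and w :: "'a \<times> 'b \<Rightarrow> real"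
  proof -
    have "(\<Sum>q\<in>I \<times> S. (if j = snd q then u i (fst q) else 0) * w q)
        = (\<Sum>r\<in>I. \<Sum>s\<in>S. if s = j then u i r * w (r, j) else 0)"
      unfolding sum.cartesian_product by (rule sum.cong[OF refl]) auto
    then show ?thesis using that fin by (simp add: sum.delta)
  qed
  note row_sum = this
  have "(\<lambda>(i, j)\<in>I \<times> S. \<Sum>r\<in>I. u i r * w (r, j))
      = (\<lambda>p\<in>I \<times> S. \<Sum>q\<in>I \<times> S. (if snd p = snd q then u (fst p) (fst q) else 0) * w q)" for w
  proof (rule restrict_ext)
    fix p assume "p \<in> I \<times> S"
    then have "snd p \<in> S" by auto
    from row_sum[OF this, of "fst p" w]
    show "(case p of (i, j) \<Rightarrow> \<Sum>r\<in>I. u i r * w (r, j))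
        = (\<Sum>q\<in>I \<times> S. (if snd p = snd q then u (fst p) (fst q) else 0) * w q)"
      by (simp only: case_prod_beta)
  qed
  then show ?thesis
    using nn_integral_gauss_orthogonal[OF finite_cartesian_product[OF fin] orthogonal_fam_tensor_id[OF u fin] f]
    by simp
qed

text \<open>The squared length of \<open>W\<^sub>1\<^sup>T z\<close>. Its minimum over unit vectors
  is the square of the smallest singular value \<open>s\<close> of the upper block.\<close>

definition row_form :: "nat \<Rightarrow> nat \<Rightarrow> (nat \<times> nat \<Rightarrow> real) \<Rightarrow> (nat \<Rightarrow> real) \<Rightarrow> real" where
  "row_form \<mu> l w z = (\<Sum>j<l. (\<Sum>i<\<mu>. z i * w (i, j))\<^sup>2)"

text \<open>Up to the monotone map \<open>t \<mapsto> exp (- c t)\<close> this is the infimum of \<open>row_form \<mu> l w\<close> on the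
  hyperplane \<open>\<langle>z, h\<rangle> = 1\<close>. By homogeneity integer vectors suffice, which makes it measurable.\<close>

definition sup_kernel :: "nat \<Rightarrow> nat \<Rightarrow> real \<Rightarrow> (nat \<times> nat \<Rightarrow> real) \<Rightarrow> (nat \<Rightarrow> real) \<Rightarrow> ennreal" where
  "sup_kernel \<mu> l c w h = (SUP z\<in>(\<Pi>\<^sub>E i\<in>{..<\<mu>}. range real_of_int).
     if (\<Sum>i<\<mu>. z i * h i)\<^sup>2 = 0 then 0
     else ennreal (exp (- c * row_form \<mu> l w z / (\<Sum>i<\<mu>. z i * h i)\<^sup>2)))"

text \<open>The parameter varies along with the matrix and the probe, because later it is a function
  of the lower rows of the same matrix.\<close>

lemma measurable_sup_kernel:
  assumes W: "\<And>i j. i < \<mu> \<Longrightarrow> j < l \<Longrightarrow> (\<lambda>p. W p (i, j)) \<in> borel_measurable M"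
    and H: "\<And>i. i < \<mu> \<Longrightarrow> (\<lambda>p. H p i) \<in> borel_measurable M"
    and C: "C \<in> borel_measurable M"
  shows "(\<lambda>p. sup_kernel \<mu> l (C p) (W p) (H p)) \<in> borel_measurable M"
  unfolding sup_kernel_def
proof (rule borel_measurable_SUP)
  show "countable (\<Pi>\<^sub>E i\<in>{..<\<mu>}. range real_of_int)" by (intro countable_PiE) auto
  fix z
  have [measurable]: "(\<lambda>p. \<Sum>i<\<mu>. z i * H p i) \<in> borel_measurable M"
    using H by (intro borel_measurable_sum borel_measurable_times) auto
  have [measurable]: "(\<lambda>p. row_form \<mu> l (W p) z) \<in> borel_measurable M"
    unfolding row_form_def using W
    by (intro borel_measurable_sum borel_measurable_power borel_measurable_times) auto
  note C[measurable]
  show "(\<lambda>p. if (\<Sum>i<\<mu>. z i * H p i)\<^sup>2 = 0 then 0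
     else ennreal (exp (- C p * row_form \<mu> l (W p) z / (\<Sum>i<\<mu>. z i * H p i)\<^sup>2))) \<in> borel_measurable M"
    by measurable
qed

text \<open>The quotient of \<open>row_form\<close> by the squared inner product is homogeneous of
  degree 0, so rounding \<open>n * x\<close> down gives an integer vector with the same quotient as
  \<open>y n\<close>. As \<open>y n\<close> tends to \<open>x\<close>, continuity where <x, h> is
  nonzero finishes the proof.\<close>

lemma sup_kernel_ge:
  fixes x :: "nat \<Rightarrow> real"
  assumes x: "(\<Sum>i<\<mu>. x i * h i) \<noteq> 0"
  shows "ennreal (exp (- c * row_form \<mu> l w x / (\<Sum>i<\<mu>. x i * h i)\<^sup>2)) \<le> sup_kernel \<mu> l c w h"
proof -
  define ip where "ip z = (\<Sum>i<\<mu>. z i * h i)" for z :: "nat \<Rightarrow> real"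
  define f where "f z = ennreal (exp (- c * row_form \<mu> l w z / (ip z)\<^sup>2))" for z
  define zi where "zi n i = real_of_int \<lfloor>real n * x i\<rfloor>" for n :: nat and i :: nat
  define y where "y n i = zi n i / real n" for n i
  have ylim: "(\<lambda>n. y n i) \<longlonglongrightarrow> x i" for i
  proof (rule tendsto_sandwich)
    have bounds: "real n * x i - 1 \<le> zi n i" "zi n i \<le> real n * x i" for n
      unfolding zi_def using floor_correct[of "real n * x i"] by auto
    show "eventually (\<lambda>n. x i - 1 / real n \<le> y n i) sequentially"
      using eventually_gt_at_top[of "0::nat"]
    proof eventually_elim
      case (elim n)
      have "x i - 1 / real n = (real n * x i - 1) / real n" using elim by (simp add: diff_divide_distrib)
      also have "\<dots> \<le> y n i" unfolding y_def using bounds(1) by (rule divide_right_mono) simp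
      finally show ?case .
    qed
    show "eventually (\<lambda>n. y n i \<le> x i) sequentially"
      using eventually_gt_at_top[of "0::nat"]
    proof eventually_elim
      case (elim n)
      have "y n i \<le> (real n * x i) / real n" unfolding y_def using bounds(2) by (rule divide_right_mono) simp
      then show ?case using elim by simp
    qed
    show "(\<lambda>n. x i - 1 / real n) \<longlonglongrightarrow> x i"
      using tendsto_diff[OF tendsto_const lim_1_over_n, of "x i"] by simp
    show "(\<lambda>_. x i) \<longlonglongrightarrow> x i" by (rule tendsto_const)
  qed
  have iplim: "(\<lambda>n. ip (y n)) \<longlonglongrightarrow> ip x" unfolding ip_def by (intro tendsto_intros ylim)
  have rlim: "(\<lambda>n. row_form \<mu> l w (y n)) \<longlonglongrightarrow> row_form \<mu> l w x"
    unfolding row_form_def by (intro tendsto_intros ylim)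
  have "(\<lambda>n. - c * row_form \<mu> l w (y n) / (ip (y n))\<^sup>2) \<longlonglongrightarrow> - c * row_form \<mu> l w x / (ip x)\<^sup>2"
    using x by (intro tendsto_divide tendsto_mult[OF tendsto_const rlim] tendsto_power[OF iplim]) (simp add: ip_def)
  then have "(\<lambda>n. f (y n)) \<longlonglongrightarrow> f x"
    unfolding f_def by (intro tendsto_ennrealI tendsto_exp)
  moreover have ipne: "eventually (\<lambda>n. ip (y n) \<noteq> 0) sequentially"
    using x by (intro tendsto_imp_eventually_ne[OF iplim]) (simp add: ip_def)
  have "eventually (\<lambda>n. f (y n) \<le> sup_kernel \<mu> l c w h) sequentially"
    using eventually_gt_at_top[of "0::nat"] ipne
  proof eventually_elim
    case (elim n)
    define z where "z = restrict (zi n) {..<\<mu>}"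
    have ipz: "ip z = real n * ip (y n)" using elim
      by (simp add: ip_def z_def y_def sum_distrib_left)
    have "(\<Sum>i<\<mu>. z i * w (i, j)) = real n * (\<Sum>i<\<mu>. y n i * w (i, j))" for j
      unfolding sum_distrib_left using elim by (intro sum.cong) (auto simp: z_def y_def)
    then have rz: "row_form \<mu> l w z = (real n)\<^sup>2 * row_form \<mu> l w (y n)"
      unfolding row_form_def sum_distrib_left[of "(real n)\<^sup>2"] by (simp add: power_mult_distrib)
    have n0: "(real n)\<^sup>2 \<noteq> 0" using elim by simp
    have "f (y n) = (if (\<Sum>i<\<mu>. z i * h i)\<^sup>2 = 0 then 0
       else ennreal (exp (- c * row_form \<mu> l w z / (\<Sum>i<\<mu>. z i * h i)\<^sup>2)))"
      unfolding ip_def[symmetric] ipz rz f_def power_mult_distrib using n0 elim(2) by simp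
    also have "\<dots> \<le> sup_kernel \<mu> l c w h"
      unfolding sup_kernel_def
    proof (rule SUP_upper)
      show "z \<in> (\<Pi>\<^sub>E i\<in>{..<\<mu>}. range real_of_int)"
        unfolding z_def by (subst restrict_PiE_iff) (simp add: zi_def)
    qed
    finally show ?case .
  qed
  ultimately have "f x \<le> sup_kernel \<mu> l c w h" by (rule tendsto_upperbound) simp
  then show ?thesis unfolding f_def ip_def .
qed

text \<open>The supremum dominates the value at \<open>x\<close>, and <x, h> is a standard Gaussian
  since \<open>x\<close> is a unit vector. Here \<open>w\<close> is fixed, so \<open>x\<close> may
  depend on it in any way, in particular be the minimising direction.\<close>

lemma sup_kernel_integral_ge:
  assumes n: "0 < \<mu>" and x: "(\<Sum>i<\<mu>. (x i)\<^sup>2) = 1" and k: "0 < k"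
    and c: "c * row_form \<mu> l w x \<le> k\<^sup>2 / 2"
  shows "ennreal (exp (- k) / 2) \<le> (\<integral>\<^sup>+h. sup_kernel \<mu> l c w h \<partial>gauss {..<\<mu>})"
proof -
  define f where "f t = (if t = 0 then 0 else ennreal (exp (- (k\<^sup>2 / 2) / t)))" for t
  have f: "f \<in> borel_measurable borel" unfolding f_def by measurable
  have "ennreal (exp (- k) / 2) \<le> (\<integral>\<^sup>+y. f (y\<^sup>2) \<partial>std_gauss)"
    using nn_integral_std_gauss_inverse_sq_ge[OF k] unfolding f_def .
  also have "\<dots> = (\<integral>\<^sup>+h. f ((\<Sum>i<\<mu>. x i * h i)\<^sup>2) \<partial>gauss {..<\<mu>})"
    by (rule nn_integral_gauss_inner_sq[OF n x f, symmetric])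
  also have "\<dots> \<le> (\<integral>\<^sup>+h. sup_kernel \<mu> l c w h \<partial>gauss {..<\<mu>})"
  proof (rule nn_integral_mono)
    fix h :: "nat \<Rightarrow> real"
    define s where "s = (\<Sum>i<\<mu>. x i * h i)"
    show "f ((\<Sum>i<\<mu>. x i * h i)\<^sup>2) \<le> sup_kernel \<mu> l c w h"
    proof (cases "s = 0")
      case True
      then show ?thesis by (simp add: f_def s_def)
    next
      case False
      have "- (k\<^sup>2 / 2) / s\<^sup>2 \<le> - c * row_form \<mu> l w x / s\<^sup>2"
        using c by (intro divide_right_mono) auto
      then have "f (s\<^sup>2) \<le> ennreal (exp (- c * row_form \<mu> l w x / s\<^sup>2))"
        using False by (simp add: f_def ennreal_leI)
      also have "\<dots> \<le> sup_kernel \<mu> l c w h"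
        using False unfolding s_def by (rule sup_kernel_ge)
      finally show ?thesis unfolding s_def .
    qed
  qed
  finally show ?thesis .
qed


text \<open>The \<open>p b\<close> with \<open>b \<ge> \<mu> - 1\<close> are orthogonal to every row
  but row 0. Projecting a combination of the rows onto them leaves \<open>y 0\<close> times row 0;
  for independent rows the sum is the squared distance of row 0 from the span of the others.\<close>

lemma row_form_ge_projection:
  assumes n: "0 < \<mu>" and p: "orthogonal_fam {..<l} p"
    and pw: "\<And>b i. \<mu> - 1 \<le> b \<Longrightarrow> b < l \<Longrightarrow> 1 \<le> i \<Longrightarrow> i < \<mu> \<Longrightarrow> (\<Sum>j<l. p b j * w (i, j)) = 0"
  shows "(y 0)\<^sup>2 * (\<Sum>b\<in>{\<mu> - 1..<l}. (\<Sum>j<l. p b j * w (0, j))\<^sup>2) \<le> row_form \<mu> l w y"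
proof -
  let ?D = "\<Sum>b\<in>{\<mu> - 1..<l}. (\<Sum>j<l. p b j * w (0, j))\<^sup>2"
  have "(\<Sum>j<l. p b j * (\<Sum>i<\<mu>. y i * w (i, j))) = y 0 * (\<Sum>j<l. p b j * w (0, j))"
    if "\<mu> - 1 \<le> b" "b < l" for b
  proof -
    have "(\<Sum>j<l. p b j * (\<Sum>i<\<mu>. y i * w (i, j))) = (\<Sum>i<\<mu>. y i * (\<Sum>j<l. p b j * w (i, j)))"
      unfolding sum_distrib_left by (subst sum.swap) (simp add: ac_simps)
    also have "\<dots> = y 0 * (\<Sum>j<l. p b j * w (0, j))"
      using pw[OF that] by (intro sum_eq_head[OF n]) simp
    finally show ?thesis .
  qed
  then have "(y 0)\<^sup>2 * ?D
      = (\<Sum>b\<in>{\<mu> - 1..<l}. (\<Sum>j<l. p b j * (\<Sum>i<\<mu>. y i * w (i, j)))\<^sup>2)"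
    by (simp add: sum_distrib_left[of "(y 0)\<^sup>2"] power_mult_distrib)
  also have "\<dots> \<le> (\<Sum>b<l. (\<Sum>j<l. p b j * (\<Sum>i<\<mu>. y i * w (i, j)))\<^sup>2)"
    by (intro sum_mono2) auto
  also have "\<dots> = row_form \<mu> l w y"
    unfolding row_form_def by (rule orthogonal_fam_parseval[OF p finite_lessThan])
  finally show ?thesis .
qed

text \<open>Rotation by \<open>p\<close> makes the projections independent standard Gaussians,
  \<open>l - b0\<close> in number, each contributing one square root. The row number 0 is kept in
  the index set because the row is obtained by splitting the index set of a whole matrix.\<close>

lemma nn_integral_gauss_row_projection:
  assumes p: "orthogonal_fam {..<l} p" and s: "0 \<le> s" and b0: "b0 \<le> l"
  shows "(\<integral>\<^sup>+y. ennreal (exp (- (s * (\<Sum>b\<in>{b0..<l}. (\<Sum>j<l. p b j * y (0, j))\<^sup>2)))) \<partial>gauss ({0::nat} \<times> {..<l}))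
    = ennreal ((1 / sqrt (1 + 2 * s)) ^ (l - b0))"
proof -
  let ?J = "{0::nat} \<times> {..<l}"
  define u where "u = (\<lambda>(i::nat, b) (r::nat, j). p b j)"
  have red: "(\<Sum>q\<in>?J. F q) = (\<Sum>j<l. F (0, j))" for F :: "nat \<times> nat \<Rightarrow> real"
    by (rule sum.reindex_bij_witness[of _ "\<lambda>j. (0, j)" snd]) auto
  have u: "orthogonal_fam ?J u"
    unfolding orthogonal_fam_def red using p by (auto simp: u_def orthogonal_fam_def)
  define f where "f y = ennreal (exp (- (\<Sum>q\<in>?J. (if b0 \<le> snd q then s else 0) * (y q)\<^sup>2)))" for y :: "nat \<times> nat \<Rightarrow> real"
  have fm: "f \<in> borel_measurable (PiM ?J (\<lambda>_. borel))"
    unfolding f_def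
    by (intro measurable_compose[OF _ measurable_ennreal] borel_measurable_exp coordinate_measurable) auto
  have f_eq: "f y = ennreal (exp (- (s * (\<Sum>b\<in>{b0..<l}. (y (0, b))\<^sup>2))))" for y
  proof -
    have "(\<Sum>q\<in>?J. (if b0 \<le> snd q then s else 0) * (y q)\<^sup>2) = s * (\<Sum>b\<in>{b0..<l}. (y (0, b))\<^sup>2)"
      unfolding red sum_distrib_left by (rule sum.mono_neutral_cong_right) auto
    then show ?thesis by (simp add: f_def)
  qed
  have "(\<integral>\<^sup>+y. ennreal (exp (- (s * (\<Sum>b\<in>{b0..<l}. (\<Sum>j<l. p b j * y (0, j))\<^sup>2)))) \<partial>gauss ?J)
      = (\<integral>\<^sup>+y. f (\<lambda>q\<in>?J. \<Sum>q'\<in>?J. u q q' * y q') \<partial>gauss ?J)"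
    unfolding f_eq red by (intro nn_integral_cong) (simp add: u_def)
  also have "\<dots> = (\<integral>\<^sup>+y. f y \<partial>gauss ?J)"
    by (rule nn_integral_gauss_orthogonal[OF _ u fm]) simp
  also have "\<dots> = ennreal (\<Prod>q\<in>?J. 1 / sqrt (1 + 2 * (if b0 \<le> snd q then s else 0)))"
    unfolding f_def using s by (intro nn_integral_gauss_exp_sq) auto
  also have "(\<Prod>q\<in>?J. 1 / sqrt (1 + 2 * (if b0 \<le> snd q then s else 0)))
      = (\<Prod>j<l. 1 / sqrt (1 + 2 * (if b0 \<le> j then s else 0)))"
    by (rule prod.reindex_bij_witness[of _ "\<lambda>j. (0, j)" snd]) auto
  also have "\<dots> = (\<Prod>j\<in>{b0..<l}. 1 / sqrt (1 + 2 * s))"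
    by (rule prod.mono_neutral_cong_right) auto
  also have "\<dots> = (1 / sqrt (1 + 2 * s)) ^ (l - b0)" by simp
  finally show ?thesis .
qed

text \<open>In coordinates with \<open>h\<close> along axis 0, the inner product of \<open>z\<close>
  and \<open>h\<close> is, up to sign, \<open>y 0\<close> times the length of \<open>h\<close>. So
  the square of \<open>y 0\<close> cancels from the quotient, and one bound holds for all
  \<open>z\<close>.\<close>

lemma sup_kernel_rotated_le:
  assumes n: "0 < \<mu>" and u: "orthogonal_fam {..<\<mu>} u"
    and uh: "\<And>i. 1 \<le> i \<Longrightarrow> i < \<mu> \<Longrightarrow> (\<Sum>r<\<mu>. u i r * h r) = 0"
    and w': "\<And>i j. i < \<mu> \<Longrightarrow> j < l \<Longrightarrow> w' (i, j) = (\<Sum>r<\<mu>. u r i * w (r, j))"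
    and p: "orthogonal_fam {..<l} p"
    and pw: "\<And>b i. \<mu> - 1 \<le> b \<Longrightarrow> b < l \<Longrightarrow> 1 \<le> i \<Longrightarrow> i < \<mu> \<Longrightarrow> (\<Sum>j<l. p b j * w (i, j)) = 0"
    and c: "0 \<le> c"
  shows "sup_kernel \<mu> l c w' h
    \<le> ennreal (exp (- (c / (\<Sum>i<\<mu>. (h i)\<^sup>2) * (\<Sum>b\<in>{\<mu> - 1..<l}. (\<Sum>j<l. p b j * w (0, j))\<^sup>2))))"
  unfolding sup_kernel_def
proof (rule SUP_least)
  fix z :: "nat \<Rightarrow> real"
  define D where "D = (\<Sum>b\<in>{\<mu> - 1..<l}. (\<Sum>j<l. p b j * w (0, j))\<^sup>2)"
  define ip where "ip = (\<Sum>i<\<mu>. z i * h i)"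
  define H where "H = (\<Sum>i<\<mu>. (h i)\<^sup>2)"
  define y where "y a = (\<Sum>r<\<mu>. u a r * z r)" for a
  define a where "a = (\<Sum>r<\<mu>. u 0 r * h r)"
  have "H = (\<Sum>i<\<mu>. (\<Sum>r<\<mu>. u i r * h r)\<^sup>2)"
    unfolding H_def by (rule orthogonal_fam_parseval[OF u finite_lessThan, symmetric])
  also have "\<dots> = a\<^sup>2" unfolding a_def using uh by (intro sum_eq_head[OF n]) simp
  finally have H: "H = a\<^sup>2" .
  have zi: "z i = (\<Sum>r<\<mu>. u r i * y r)" if "i < \<mu>" for i
    unfolding y_def using orthogonal_fam_inverse[OF orthogonal_fam_transpose[OF u], of i z] that by simp
  have "ip = (\<Sum>i<\<mu>. \<Sum>r<\<mu>. y r * (u r i * h i))"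
    unfolding ip_def by (intro sum.cong refl) (simp add: zi sum_distrib_left sum_distrib_right ac_simps)
  also have "\<dots> = (\<Sum>r<\<mu>. y r * (\<Sum>i<\<mu>. u r i * h i))"
    unfolding sum_distrib_left by (rule sum.swap)
  also have "\<dots> = y 0 * a" unfolding a_def using uh by (intro sum_eq_head[OF n]) simp
  finally have ip: "ip\<^sup>2 = (y 0)\<^sup>2 * H" by (simp add: H power_mult_distrib)
  have "row_form \<mu> l w' z = row_form \<mu> l w y"
    unfolding row_form_def
  proof (rule sum.cong[OF refl])
    fix j assume j: "j \<in> {..<l}"
    have "(\<Sum>i<\<mu>. z i * w' (i, j)) = (\<Sum>i<\<mu>. \<Sum>r<\<mu>. w (r, j) * (u r i * z i))"
      using j by (intro sum.cong refl) (simp add: w' sum_distrib_left ac_simps)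
    also have "\<dots> = (\<Sum>r<\<mu>. w (r, j) * y r)"
      unfolding y_def sum_distrib_left by (rule sum.swap)
    finally show "(\<Sum>i<\<mu>. z i * w' (i, j))\<^sup>2 = (\<Sum>i<\<mu>. y i * w (i, j))\<^sup>2" by (simp add: mult.commute)
  qed
  then have rf: "(y 0)\<^sup>2 * D \<le> row_form \<mu> l w' z"
    using row_form_ge_projection[OF n p pw, of y] unfolding D_def by simp
  show "(if (\<Sum>i<\<mu>. z i * h i)\<^sup>2 = 0 then 0
         else ennreal (exp (- c * row_form \<mu> l w' z / (\<Sum>i<\<mu>. z i * h i)\<^sup>2)))
      \<le> ennreal (exp (- (c / (\<Sum>i<\<mu>. (h i)\<^sup>2) * (\<Sum>b\<in>{\<mu> - 1..<l}. (\<Sum>j<l. p b j * w (0, j))\<^sup>2))))"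
    unfolding ip_def[symmetric] H_def[symmetric] D_def[symmetric]
  proof (cases "ip\<^sup>2 = 0")
    case False
    then have y0: "(y 0)\<^sup>2 > 0" and H0: "H > 0" using H by (auto simp: ip zero_less_power2)
    have "c / H * D = c * ((y 0)\<^sup>2 * D) / ip\<^sup>2" using y0 H0 unfolding ip by (simp add: field_simps)
    also have "\<dots> \<le> c * row_form \<mu> l w' z / ip\<^sup>2"
      using rf c by (intro divide_right_mono mult_left_mono) auto
    finally have "- c * row_form \<mu> l w' z / ip\<^sup>2 \<le> - (c / H * D)" by simp
    then show "(if ip\<^sup>2 = 0 then 0 else ennreal (exp (- c * row_form \<mu> l w' z / ip\<^sup>2))) \<le> ennreal (exp (- (c / H * D)))"
      using False by (simp add: ennreal_leI del: mult_minus_left)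
  qed simp
qed

text \<open>For a fixed probe the matrix can be rotated into the coordinates of \<open>h\<close>.
  Row 0 is then independent of the other \<open>\<mu> - 1\<close> rows, which leave it
  \<open>l - (\<mu> - 1)\<close> free directions.\<close>

lemma nn_integral_sup_kernel_le:
  assumes n: "0 < \<mu>" "\<mu> \<le> l" and c: "0 \<le> c"
  shows "(\<integral>\<^sup>+w. sup_kernel \<mu> l c w h \<partial>gauss ({..<\<mu>} \<times> {..<l}))
    \<le> ennreal ((1 / sqrt (1 + 2 * (c / (\<Sum>i<\<mu>. (h i)\<^sup>2)))) ^ (l - (\<mu> - 1)))"
proof -
  let ?J = "{..<\<mu>} \<times> {..<l}" and ?I1 = "{1..<\<mu>} \<times> {..<l}" and ?I2 = "{0::nat} \<times> {..<l}"
  define s where "s = c / (\<Sum>i<\<mu>. (h i)\<^sup>2)"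
  let ?B = "ennreal ((1 / sqrt (1 + 2 * s)) ^ (l - (\<mu> - 1)))"
  have s: "0 \<le> s" using c by (auto simp: s_def intro!: divide_nonneg_nonneg sum_nonneg)
  interpret S: product_sigma_finite "\<lambda>_. std_gauss" by (rule product_sigma_finite_std_normal)
  obtain u where u: "orthogonal_fam {..<\<mu>} u"
    and uh: "\<And>i j. 1 \<le> i \<Longrightarrow> i < \<mu> \<Longrightarrow> j < (1::nat) \<Longrightarrow> (\<Sum>r<\<mu>. u i r * h r) = 0"
    using orthogonal_fam_kernel[of \<mu> 1 "\<lambda>_. h"] by blast
  define \<Phi> where "\<Phi> w = sup_kernel \<mu> l c w h" for w
  have \<Phi>m: "\<Phi> \<in> borel_measurable (PiM ?J (\<lambda>_. borel))"
    unfolding \<Phi>_def by (rule measurable_sup_kernel) (auto intro: measurable_component_singleton)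
  define R where "R w = (\<lambda>(i, j)\<in>?J. \<Sum>r<\<mu>. u r i * w (r, j))" for w :: "nat \<times> nat \<Rightarrow> real"
  have "(\<lambda>w. \<Phi> (R w)) \<in> borel_measurable (PiM ?J (\<lambda>_. borel))"
  proof (rule measurable_compose[OF _ \<Phi>m])
    show "R \<in> measurable (PiM ?J (\<lambda>_. borel)) (PiM ?J (\<lambda>_. borel))"
      unfolding R_def
      by (rule measurable_restrict) (auto intro!: coordinate_measurable)
  qed
  moreover have J: "?J = ?I1 \<union> ?I2" using n by auto
  ultimately have \<Phi>Rm: "(\<lambda>w. \<Phi> (R w)) \<in> borel_measurable (PiM (?I1 \<union> ?I2) (\<lambda>_. std_gauss))"
    by (subst measurable_cong_sets[OF sets_PiM_cong[OF refl] refl, of _ _ "\<lambda>_. borel"]) simp_all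
  have "(\<integral>\<^sup>+w. \<Phi> w \<partial>gauss ?J) = (\<integral>\<^sup>+w. \<Phi> (R w) \<partial>gauss ?J)"
    unfolding R_def
    by (rule nn_integral_gauss_rotate_rows[OF orthogonal_fam_transpose[OF u] _ _ \<Phi>m, symmetric]) auto
  also have "\<dots> = (\<integral>\<^sup>+x. \<integral>\<^sup>+y. \<Phi> (R (merge ?I1 ?I2 (x, y))) \<partial>gauss ?I2 \<partial>gauss ?I1)"
    unfolding gauss_def J by (rule S.product_nn_integral_fold[OF _ _ _ \<Phi>Rm]) auto
  also have "\<dots> \<le> (\<integral>\<^sup>+x. ?B \<partial>gauss ?I1)"
  proof (rule nn_integral_mono)
    fix x :: "nat \<times> nat \<Rightarrow> real"
    \<comment> \<open>\<open>p\<close> is chosen after the rows \<open>x\<close> have been fixed.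
      The inner integral has the same bound for every \<open>x\<close>, so no measurability of this
      choice enters.\<close>
    obtain p where p: "orthogonal_fam {..<l} p"
      and px: "\<And>b i. \<mu> - 1 \<le> b \<Longrightarrow> b < l \<Longrightarrow> i < \<mu> - 1 \<Longrightarrow> (\<Sum>j<l. p b j * x (Suc i, j)) = 0"
      using orthogonal_fam_kernel[of l "\<mu> - 1" "\<lambda>i j. x (Suc i, j)"] by blast
    let ?D = "\<lambda>w. \<Sum>b\<in>{\<mu> - 1..<l}. (\<Sum>j<l. p b j * w (0, j))\<^sup>2"
    have "\<Phi> (R (merge ?I1 ?I2 (x, y)))
        \<le> ennreal (exp (- (s * ?D y)))" for y
    proof -
      define w where "w = merge ?I1 ?I2 (x, y)"
      have w0: "w (0, j) = y (0, j)" if "j < l" for j using that by (simp add: w_def merge_def)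
      have wi: "w (i, j) = x (i, j)" if "1 \<le> i" "i < \<mu>" "j < l" for i j using that by (simp add: w_def merge_def)
      have "\<Phi> (R w) \<le> ennreal (exp (- (s * ?D w)))"
        unfolding \<Phi>_def s_def
      proof (rule sup_kernel_rotated_le[OF n(1) u _ _ p _ c])
        show "(\<Sum>r<\<mu>. u i r * h r) = 0" if "1 \<le> i" "i < \<mu>" for i using uh that by blast
        show "R w (i, j) = (\<Sum>r<\<mu>. u r i * w (r, j))" if "i < \<mu>" "j < l" for i j using that by (simp add: R_def)
        show "(\<Sum>j<l. p b j * w (i, j)) = 0" if "\<mu> - 1 \<le> b" "b < l" "1 \<le> i" "i < \<mu>" for b i
          using px[of b "i - 1"] that by (simp add: wi)
      qed
      then show ?thesis unfolding w_def[symmetric] by (simp add: w0)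
    qed
    then have "(\<integral>\<^sup>+y. \<Phi> (R (merge ?I1 ?I2 (x, y))) \<partial>gauss ?I2)
        \<le> (\<integral>\<^sup>+y. ennreal (exp (- (s * ?D y))) \<partial>gauss ?I2)"
      by (intro nn_integral_mono)
    also have "\<dots> = ?B"
      using n by (intro nn_integral_gauss_row_projection[OF p s]) auto
    finally show "(\<integral>\<^sup>+y. \<Phi> (R (merge ?I1 ?I2 (x, y))) \<partial>gauss ?I2) \<le> ?B" .
  qed
  also have "\<dots> = ?B"
    using prob_space.emeasure_space_1[OF prob_space_gauss[of ?I1]] by simp
  finally show ?thesis unfolding \<Phi>_def s_def .
qed


lemma row_form_cong:
  "(\<And>i j. i < \<mu> \<Longrightarrow> j < l \<Longrightarrow> w (i, j) = w' (i, j)) \<Longrightarrow> row_form \<mu> l w = row_form \<mu> l w'"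
  unfolding row_form_def by (intro ext sum.cong arg_cong[where f = "\<lambda>x. x\<^sup>2"]) auto

lemma sup_kernel_cong:
  "(\<And>i j. i < \<mu> \<Longrightarrow> j < l \<Longrightarrow> w (i, j) = w' (i, j)) \<Longrightarrow> sup_kernel \<mu> l c w h = sup_kernel \<mu> l c w' h"
  unfolding sup_kernel_def by (simp add: row_form_cong[of \<mu> l w w'])

lemma sup_kernel_zero:
  assumes "(\<Sum>i<\<mu>. (h i)\<^sup>2) = 0"
  shows "sup_kernel \<mu> l c w h = 0"
proof -
  have "\<forall>i<\<mu>. h i = 0" using assms by (subst (asm) sum_nonneg_eq_0_iff) auto
  then show ?thesis unfolding sup_kernel_def by (auto intro!: antisym SUP_least)
qed

lemma AE_std_gauss_nonzero: "AE x in std_gauss. x \<noteq> 0"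
  by (subst AE_density) (use AE_lborel_singleton[of "0::real"] in auto)

text \<open>The order of integration is exchanged because the two estimates look in opposite
  directions: the lower one fixes the matrix and averages over the probe, this upper one fixes the
  probe and averages over the matrix.\<close>

lemma nn_integral_sup_kernel_product_le:
  assumes n: "0 < \<mu>" "\<mu> \<le> l" and c: "0 < c"
    and Bh: "(\<integral>\<^sup>+h. ennreal (sqrt (\<Sum>i<\<mu>. (h i)\<^sup>2) ^ (l - (\<mu> - 1))) \<partial>gauss {..<\<mu>}) \<le> ennreal Bh"
  shows "(\<integral>\<^sup>+w. \<integral>\<^sup>+h. sup_kernel \<mu> l c w h \<partial>gauss {..<\<mu>} \<partial>gauss ({..<\<mu>} \<times> {..<l}))
    \<le> ennreal ((1 / sqrt (2 * c)) ^ (l - (\<mu> - 1))) * ennreal Bh"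
proof -
  define k where "k = l - (\<mu> - 1)"
  let ?n = "\<lambda>h. ennreal (sqrt (\<Sum>i<\<mu>. (h i)\<^sup>2) ^ k)"
    and ?c = "ennreal ((1 / sqrt (2 * c)) ^ k)"
  interpret pair_sigma_finite "gauss ({..<\<mu>} \<times> {..<l})" "gauss {..<\<mu>}"
    by (intro pair_sigma_finite.intro prob_space_imp_sigma_finite prob_space_gauss)
  have "(\<lambda>p. sup_kernel \<mu> l c (fst p) (snd p)) \<in> borel_measurable (gauss ({..<\<mu>} \<times> {..<l}) \<Otimes>\<^sub>M gauss {..<\<mu>})"
    by (rule measurable_sup_kernel)
       (auto intro!: measurable_compose[OF measurable_fst] measurable_compose[OF measurable_snd]
         measurable_component_singleton simp: measurable_cong_sets[OF sets_gauss refl])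
  then have m: "(\<lambda>(w, h). sup_kernel \<mu> l c w h) \<in> borel_measurable (gauss ({..<\<mu>} \<times> {..<l}) \<Otimes>\<^sub>M gauss {..<\<mu>})"
    by (simp add: case_prod_beta)
  have hm: "(\<lambda>h. ?n h) \<in> borel_measurable (gauss {..<\<mu>})"
    unfolding measurable_cong_sets[OF sets_gauss refl]
    by (intro measurable_compose[OF _ measurable_ennreal] borel_measurable_power
        measurable_compose[OF _ borel_measurable_sqrt] coordinate_measurable) auto
  have "(\<integral>\<^sup>+w. \<integral>\<^sup>+h. sup_kernel \<mu> l c w h \<partial>gauss {..<\<mu>} \<partial>gauss ({..<\<mu>} \<times> {..<l}))
      = (\<integral>\<^sup>+h. \<integral>\<^sup>+w. sup_kernel \<mu> l c w h \<partial>gauss ({..<\<mu>} \<times> {..<l}) \<partial>gauss {..<\<mu>})"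
    using Fubini'[OF m] by simp
  also have "\<dots> \<le> (\<integral>\<^sup>+h. ?c * ?n h \<partial>gauss {..<\<mu>})"
  proof (rule nn_integral_mono)
    fix h :: "nat \<Rightarrow> real"
    define H where "H = (\<Sum>i<\<mu>. (h i)\<^sup>2)"
    have H0: "0 \<le> H" by (simp add: H_def sum_nonneg)
    show "(\<integral>\<^sup>+w. sup_kernel \<mu> l c w h \<partial>gauss ({..<\<mu>} \<times> {..<l}))
        \<le> ?c * ?n h"
    \<comment> \<open>At \<open>h = 0\<close> the bound for a fixed probe degenerates to 1, since
      \<open>c / 0\<close> is 0, while the claim demands 0. There the kernel itself
      vanishes.\<close>
    proof (cases "H = 0")
      case True
      then show ?thesis using sup_kernel_zero[of h \<mu> l c] by (simp add: H_def)
    next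
      case False
      then have H: "0 < H" using H0 by simp
      \<comment> \<open>Dropping the summand 1 makes the bound a product of a power of
        \<open>c\<close> and a power of the length of \<open>h\<close>.\<close>
      have "1 / sqrt (1 + 2 * r) \<le> 1 / sqrt (2 * r)" if "0 < r" for r :: real
        using that by (intro divide_left_mono) auto
      then have "1 / sqrt (1 + 2 * (c / H)) \<le> 1 / sqrt (2 * (c / H))"
        using divide_pos_pos[OF c H] by blast
      also have "\<dots> = 1 / sqrt (2 * c) * sqrt H" using c H by (simp add: real_sqrt_divide real_sqrt_mult)
      finally have "(1 / sqrt (1 + 2 * (c / H))) ^ k \<le> (1 / sqrt (2 * c) * sqrt H) ^ k"
        using c H by (intro power_mono) auto
      then have "ennreal ((1 / sqrt (1 + 2 * (c / H))) ^ k) \<le> ennreal ((1 / sqrt (2 * c)) ^ k * sqrt H ^ k)"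
        by (intro ennreal_leI) (simp only: power_mult_distrib)
      then show ?thesis
        using nn_integral_sup_kernel_le[OF n, of c h] c H
        unfolding H_def[symmetric] k_def[symmetric] by (simp add: ennreal_mult)
    qed
  qed
  also have "\<dots> = ?c * (\<integral>\<^sup>+h. ?n h \<partial>gauss {..<\<mu>})"
    by (rule nn_integral_cmult[OF hm])
  also have "\<dots> \<le> ?c * ennreal Bh"
    using Bh unfolding k_def by (rule mult_left_mono) simp
  finally show ?thesis unfolding k_def .
qed

text \<open>With \<open>d i\<close> equal to \<open>\<tau> i ^ (2 * q)\<close> divided by the square
  of \<open>\<Delta>(q)\<close>, this is the squared ratio of \<open>X\<close> to
  \<open>\<Delta>(q)\<close>. Weights of total 1 keep the tail bound free of the spectrum.\<close>

definition weighted_sq :: "nat \<Rightarrow> nat \<Rightarrow> nat \<Rightarrow> (nat \<Rightarrow> real) \<Rightarrow> (nat \<times> nat \<Rightarrow> real) \<Rightarrow> real" where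
  "weighted_sq \<mu> m l d w = (\<Sum>(i, j)\<in>{\<mu>..<m} \<times> {..<l}. d i * (w (i, j))\<^sup>2)"

text \<open>The bad event asserts the existence of a direction. Bounding the integral of a
  measurable majorant \<open>\<Psi>\<close> of its indicator avoids asking whether that event is
  measurable.\<close>

lemma gauss_row_ratio_tail:
  assumes n: "0 < \<mu>" "\<mu> \<le> l" "\<mu> \<le> m"
    and d: "\<And>i. 0 \<le> d i" "(\<Sum>i\<in>{\<mu>..<m}. d i) = 1" and Y: "0 < Y"
    and k: "k = l - (\<mu> - 1)"
    and Bh: "(\<integral>\<^sup>+h. ennreal (sqrt (\<Sum>i<\<mu>. (h i)\<^sup>2) ^ k) \<partial>gauss {..<\<mu>}) \<le> ennreal Bh"
    and Bc: "(\<integral>\<^sup>+w. ennreal (sqrt (weighted_sq \<mu> m l d w) ^ k) \<partial>gauss ({\<mu>..<m} \<times> {..<l})) \<le> ennreal Bc"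
  obtains \<Psi> where "\<Psi> \<in> borel_measurable (PiM ({..<m} \<times> {..<l}) (\<lambda>_. borel))"
    and "\<And>w x. (\<Sum>i<\<mu>. (x i)\<^sup>2) = 1 \<Longrightarrow> Y * row_form \<mu> l w x \<le> weighted_sq \<mu> m l d w \<Longrightarrow> 1 \<le> \<Psi> w"
    and "(\<integral>\<^sup>+w. \<Psi> w \<partial>gauss ({..<m} \<times> {..<l}))
      \<le> ennreal (2 * exp (real k)) * ennreal (1 / (real k * sqrt Y) ^ k) * ennreal Bh * ennreal Bc"
proof -
  let ?J = "{..<m} \<times> {..<l}" and ?I1 = "{..<\<mu>} \<times> {..<l}" and ?I2 = "{\<mu>..<m} \<times> {..<l}"
    and ?C = "ennreal (1 / (real k * sqrt Y) ^ k) * ennreal Bh" and ?e = "ennreal (2 * exp (real k))"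
  have k0: "0 < real k" using n k by auto
  interpret S: product_sigma_finite "\<lambda>_. std_gauss" by (rule product_sigma_finite_std_normal)
  interpret gh: prob_space "gauss {..<\<mu>}" by (rule prob_space_gauss)
  define chi2 where "chi2 = weighted_sq \<mu> m l d"
  \<comment> \<open>On the bad event this makes \<open>c w * row_form \<mu> l w x\<close> at most
    \<open>k\<^sup>2 / 2\<close>, the level at which exp(a) / a^k with \<open>a = k\<close> is
    minimal. \<open>c\<close> depends on the lower rows only, hence is a constant once these are
    fixed.\<close>
  define c where "c w = (real k)\<^sup>2 * Y / (2 * chi2 w)" for w
  define T where "T w = (\<integral>\<^sup>+h. sup_kernel \<mu> l (c w) w h \<partial>gauss {..<\<mu>})" for w
  \<comment> \<open>The factor \<open>2 * exp k\<close> normalises the lower bound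
    \<open>exp (- k) / 2\<close> of the probe average to 1.\<close>
  define \<Psi> where "\<Psi> w = ?e * T w" for w
  have chi2_nonneg: "0 \<le> chi2 w" for w
    unfolding chi2_def weighted_sq_def using d(1) by (intro sum_nonneg) auto
  have chi2_m: "chi2 \<in> borel_measurable (PiM K (\<lambda>_. borel))" if "?I2 \<subseteq> K" for K
    unfolding chi2_def weighted_sq_def case_prod_beta using that
    by (intro coordinate_measurable) auto
  have J: "?J = ?I2 \<union> ?I1" using n by auto
  have cm: "c \<in> borel_measurable (PiM ?J (\<lambda>_. borel))"
    unfolding c_def using chi2_m[of ?J] J by (intro borel_measurable_divide borel_measurable_times) auto
  have "(\<lambda>p. sup_kernel \<mu> l (c (fst p)) (fst p) (snd p)) \<in> borel_measurable (PiM ?J (\<lambda>_. borel) \<Otimes>\<^sub>M gauss {..<\<mu>})"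
    using n
    by (intro measurable_sup_kernel measurable_compose[OF measurable_fst cm])
       (auto intro!: measurable_compose[OF measurable_fst] measurable_compose[OF measurable_snd]
         measurable_component_singleton simp: measurable_cong_sets[OF sets_gauss refl])
  then have Tm: "T \<in> borel_measurable (PiM ?J (\<lambda>_. borel))"
    unfolding T_def by (intro gh.borel_measurable_nn_integral) (simp add: case_prod_beta)
  then have \<Psi>m: "\<Psi> \<in> borel_measurable (PiM ?J (\<lambda>_. borel))"
    unfolding \<Psi>_def by (intro borel_measurable_times_ennreal) auto
  have bad: "1 \<le> \<Psi> w" if x: "(\<Sum>i<\<mu>. (x i)\<^sup>2) = 1" and le: "Y * row_form \<mu> l w x \<le> weighted_sq \<mu> m l d w" for w x
  proof -
    have "c w * row_form \<mu> l w x \<le> (real k)\<^sup>2 / 2"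
    \<comment> \<open>If \<open>chi2 w = 0\<close>, then \<open>c w = 0\<close> by the convention
      for division and the estimate is still true.\<close>
    proof (cases "chi2 w = 0")
      case False
      then have "chi2 w > 0" using chi2_nonneg[of w] by simp
      have "c w * row_form \<mu> l w x = (real k)\<^sup>2 * (Y * row_form \<mu> l w x) / (2 * chi2 w)" by (simp add: c_def)
      also have "\<dots> \<le> (real k)\<^sup>2 * chi2 w / (2 * chi2 w)"
        using le \<open>chi2 w > 0\<close> unfolding chi2_def by (intro divide_right_mono mult_left_mono) auto
      also have "\<dots> = (real k)\<^sup>2 / 2" using \<open>chi2 w > 0\<close> by simp
      finally show ?thesis .
    qed (simp add: c_def)
    then have "ennreal (exp (- real k) / 2) \<le> T w"
      unfolding T_def by (intro sup_kernel_integral_ge[OF n(1) x k0])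
    then have "?e * ennreal (exp (- real k) / 2) \<le> \<Psi> w"
      unfolding \<Psi>_def by (rule mult_left_mono) simp
    also have "?e * ennreal (exp (- real k) / 2) = 1"
      by (subst ennreal_mult[symmetric]) (auto simp: exp_minus)
    finally show ?thesis .
  qed
  have T_le: "(\<integral>\<^sup>+y. T (merge ?I2 ?I1 (x, y)) \<partial>gauss ?I1)
      \<le> ?C * ennreal (sqrt (chi2 x) ^ k)"
    if x: "chi2 x \<noteq> 0" for x
  proof -
    have pos: "chi2 x > 0" using chi2_nonneg[of x] x by simp
    have chi_eq: "chi2 (merge ?I2 ?I1 (x, y)) = chi2 x" for y
      unfolding chi2_def weighted_sq_def by (intro sum.cong) (auto simp: merge_def)
    then have c_eq: "c (merge ?I2 ?I1 (x, y)) = c x" for y by (simp add: c_def)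
    have w_eq: "merge ?I2 ?I1 (x, y) (i, j) = y (i, j)" if "i < \<mu>" "j < l" for y i j
      using that by (simp add: merge_def)
    have c0: "0 < c x" using pos k0 Y by (simp add: c_def)
    have "(\<integral>\<^sup>+y. T (merge ?I2 ?I1 (x, y)) \<partial>gauss ?I1)
        = (\<integral>\<^sup>+y. \<integral>\<^sup>+h. sup_kernel \<mu> l (c x) y h \<partial>gauss {..<\<mu>} \<partial>gauss ?I1)"
      unfolding T_def c_eq by (intro nn_integral_cong sup_kernel_cong w_eq)
    also have "\<dots> \<le> ennreal ((1 / sqrt (2 * c x)) ^ k) * ennreal Bh"
      unfolding k by (rule nn_integral_sup_kernel_product_le[OF n(1,2) c0]) (use Bh k in simp)
    also have "(1 / sqrt (2 * c x)) ^ k = 1 / (real k * sqrt Y) ^ k * sqrt (chi2 x) ^ k"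
    proof -
      have "sqrt (2 * c x) = real k * sqrt Y / sqrt (chi2 x)"
        using pos by (simp add: c_def real_sqrt_divide real_sqrt_mult)
      then show ?thesis by (simp add: power_divide)
    qed
    also have "ennreal (1 / (real k * sqrt Y) ^ k * sqrt (chi2 x) ^ k) * ennreal Bh
        = ?C * ennreal (sqrt (chi2 x) ^ k)"
      using Y chi2_nonneg[of x] by (subst ennreal_mult) (auto simp: ac_simps)
    finally show ?thesis .
  qed
  have "(\<integral>\<^sup>+w. T w \<partial>gauss ?J) = (\<integral>\<^sup>+x. \<integral>\<^sup>+y. T (merge ?I2 ?I1 (x, y)) \<partial>gauss ?I1 \<partial>gauss ?I2)"
    unfolding gauss_def J
  proof (rule S.product_nn_integral_fold)
    show "T \<in> borel_measurable (PiM (?I2 \<union> ?I1) (\<lambda>_. std_gauss))"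
      using Tm unfolding J by (subst measurable_cong_sets[OF sets_PiM_cong[OF refl] refl, of _ _ "\<lambda>_. borel"]) simp_all
  qed auto
  also have "\<dots> \<le> (\<integral>\<^sup>+x. ?C * ennreal (sqrt (chi2 x) ^ k) \<partial>gauss ?I2)"
  proof (rule nn_integral_mono_AE)
    \<comment> \<open>The upper estimate requires a positive parameter, hence
      \<open>chi2 > 0\<close>. Some weight is positive, and an entry in its row is almost surely
      nonzero.\<close>
    have "\<exists>i0\<in>{\<mu>..<m}. d i0 \<noteq> 0"
    proof (rule ccontr)
      assume "\<not> ?thesis"
      then have "(\<Sum>i\<in>{\<mu>..<m}. d i) = 0" by (intro sum.neutral) auto
      then show False using d(2) by simp
    qed
    then obtain i0 where i0: "i0 \<in> {\<mu>..<m}" "d i0 > 0" using d(1) by (metis less_eq_real_def)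
    then have "AE x in gauss ?I2. x (i0, 0) \<noteq> 0"
      unfolding gauss_def using n by (intro AE_PiM_component AE_std_gauss_nonzero prob_space_std_normal) auto
    then show "AE x in gauss ?I2. (\<integral>\<^sup>+y. T (merge ?I2 ?I1 (x, y)) \<partial>gauss ?I1)
        \<le> ?C * ennreal (sqrt (chi2 x) ^ k)"
    proof eventually_elim
      case (elim x)
      have "0 < chi2 x" unfolding chi2_def weighted_sq_def
        using i0 n d(1) elim by (intro sum_pos2[of _ "(i0, 0)"]) auto
      then show ?case by (intro T_le) simp
    qed
  qed
  also have "\<dots> = ?C * (\<integral>\<^sup>+x. ennreal (sqrt (chi2 x) ^ k) \<partial>gauss ?I2)"
    using chi2_m[of ?I2]
    by (intro nn_integral_cmult) (auto simp: measurable_cong_sets[OF sets_gauss refl])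
  also have "\<dots> \<le> ?C * ennreal Bc"
    using Bc unfolding chi2_def by (rule mult_left_mono) simp
  finally have "(\<integral>\<^sup>+w. T w \<partial>gauss ?J) \<le> ?C * ennreal Bc" .
  from mult_left_mono[OF this, of "?e"]
  have "(\<integral>\<^sup>+w. \<Psi> w \<partial>gauss ?J)
      \<le> ?e * ennreal (1 / (real k * sqrt Y) ^ k) * ennreal Bh * ennreal Bc"
    unfolding \<Psi>_def using Tm
    by (subst nn_integral_cmult) (auto simp: measurable_cong_sets[OF sets_gauss refl] mult.assoc)
  then show ?thesis using that[of \<Psi>] \<Psi>m bad by blast
qed

section \<open>Explicit constants in the moment bounds\<close>

lemma ln_le_half_diff_inverse:
  fixes y :: real
  assumes y: "1 \<le> y"
  shows "ln y \<le> (y - 1 / y) / 2"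
proof -
  define g where "g t = (t - 1 / t) / 2 - ln t" for t :: real
  have "g 1 \<le> g y"
  proof (rule DERIV_nonneg_imp_nondecreasing[OF y])
    fix t :: real assume t: "1 \<le> t" "t \<le> y"
    have "(g has_real_derivative (1 + 1 / t\<^sup>2) / 2 - 1 / t) (at t)"
      unfolding g_def using t by (auto intro!: derivative_eq_intros simp: power2_eq_square)
    moreover have "(1 + 1 / t\<^sup>2) / 2 - 1 / t = (1 - 1 / t)\<^sup>2 / 2"
      by (simp add: power2_diff power_divide field_simps)
    ultimately show "\<exists>D. (g has_real_derivative D) (at t) \<and> D \<ge> 0"
      by (metis zero_le_divide_iff zero_le_numeral zero_le_power2)
  qed
  then show ?thesis by (simp add: g_def)
qed

text \<open>\<open>t\<close> minimises (k / (2 e t))^(k/2) (1 - 2t)^(-n/2), the exponential moment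
  bound on the \<open>k\<close>-th moment of a chi variable with \<open>n\<close> degrees of
  freedom.\<close>

lemma chi_moment_const:
  fixes n k :: real
  assumes n: "0 < n" and k: "0 < k"
  defines "t \<equiv> k / (2 * (n + k))"
  shows "k / (2 * exp 1 * t) = (n + k) / exp 1" "1 - 2 * t = n / (n + k)" "0 < t" "2 * t < 1"
  using n k by (auto simp: t_def field_simps)

text \<open>Logarithm of the optimised bound in the two forms in which it is used: the first keeps
  the gain k^2 / (4 (n + k)) for the probe, the second serves the lower block. Both come from
  \<open>ln_le_half_diff_inverse\<close> at the point (n + k) / n.\<close>

lemma ln_chi_moment:
  fixes n k :: real
  assumes n: "0 < n" and k: "0 < k"
  shows "k / 2 * ln ((n + k) / exp 1) + n / 2 * ln ((n + k) / n)
    \<le> k / 2 * ln (n + k) - k\<^sup>2 / (4 * (n + k))"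
    and "k \<le> n \<Longrightarrow> k / 2 * ln ((n + k) / exp 1) + n / 2 * ln ((n + k) / n) \<le> k / 2 * (ln n + 1 / 2)"
proof -
  define L where "L = ln ((n + k) / n)"
  have "1 \<le> (n + k) / n" using n k by simp
  then have L: "L \<le> ((n + k) / n - n / (n + k)) / 2"
    unfolding L_def using ln_le_half_diff_inverse[of "(n + k) / n"] by simp
  have q: "(n + k) / n - n / (n + k) = k * (2 * n + k) / (n * (n + k))"
    using n k by (subst diff_frac_eq) (auto simp: algebra_simps)
  have e: "ln ((n + k) / exp 1) = ln (n + k) - 1" using n k by (simp add: ln_div)
  have "n / 2 * L \<le> n / 2 * (((n + k) / n - n / (n + k)) / 2)"
    using L n by (intro mult_left_mono) auto
  also have "\<dots> = k / 2 - k\<^sup>2 / (4 * (n + k))"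
    unfolding q using n k by (simp add: divide_simps power2_eq_square) (simp add: algebra_simps)
  finally show "k / 2 * ln ((n + k) / exp 1) + n / 2 * ln ((n + k) / n)
    \<le> k / 2 * ln (n + k) - k\<^sup>2 / (4 * (n + k))"
    unfolding e L_def[symmetric] by (simp add: algebra_simps)
  assume kn: "k \<le> n"
  have "(n + k) / 2 * L \<le> (n + k) / 2 * (((n + k) / n - n / (n + k)) / 2)"
    using L n k by (intro mult_left_mono) auto
  also have "\<dots> = k / 2 * (1 + k / (2 * n))"
    unfolding q using n k by (simp add: divide_simps)
  also have "\<dots> \<le> k / 2 * (3 / 2)" using kn n k by (intro mult_left_mono) (auto simp: field_simps)
  finally have "(n + k) / 2 * L \<le> k / 2 * (3 / 2)" .
  moreover have "ln (n + k) = ln n + L" unfolding L_def using n k by (simp add: ln_div)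
  ultimately show "k / 2 * ln ((n + k) / exp 1) + n / 2 * ln ((n + k) / n) \<le> k / 2 * (ln n + 1 / 2)"
    unfolding e L_def[symmetric] by (simp add: algebra_simps add_divide_distrib)
qed

lemma chi_moment_const_exp:
  fixes k n :: nat
  assumes n: "0 < n" and k: "0 < k"
  shows "((real n + real k) / exp 1) powr (real k / 2) * (1 / sqrt (real n / (real n + real k))) ^ n
    = exp (real k / 2 * ln ((real n + real k) / exp 1) + real n / 2 * ln ((real n + real k) / real n))"
proof -
  have "(1 / sqrt (real n / (real n + real k))) ^ n = sqrt ((real n + real k) / real n) ^ n"
    using n by (simp add: real_sqrt_divide)
  also have "\<dots> = ((real n + real k) / real n) powr (real n / 2)"
    using n by (simp add: powr_half_sqrt[symmetric] powr_realpow[symmetric] powr_powr)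
  finally show ?thesis using n by (simp add: powr_def exp_add)
qed

text \<open>The gain k^2 / (4 (\<open>\<mu>\<close> + k)) pays for lowering the base from
  \<open>\<mu> + k\<close> to \<open>\<mu> + k - 1\<close>, which will be exactly the number of
  columns. The comparison with ln (s / (s - 1)) is where \<open>k \<ge> 3\<close> enters.\<close>

lemma gauss_norm_moment_le:
  assumes \<mu>: "0 < \<mu>" and k: "3 \<le> k"
  shows "(\<integral>\<^sup>+h. ennreal (sqrt (\<Sum>i<\<mu>. (h i)\<^sup>2) ^ k) \<partial>gauss {..<\<mu>}) \<le> ennreal (real (\<mu> + k - 1) powr (real k / 2))"
proof -
  define t where "t = real k / (2 * (real \<mu> + real k))"
  have pos: "0 < real \<mu>" "0 < real k" using \<mu> k by auto
  note t = chi_moment_const[OF pos, folded t_def]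
  have "(\<integral>\<^sup>+h. ennreal (sqrt (\<Sum>i<\<mu>. (h i)\<^sup>2) ^ k) \<partial>gauss {..<\<mu>})
      \<le> ennreal ((real k / (2 * exp 1 * t)) powr (real k / 2) * (\<Prod>i<\<mu>. 1 / sqrt (1 - 2 * t * 1)))"
    using nn_integral_gauss_norm_power_le[of "{..<\<mu>}" "\<lambda>_. 1" t k] t k by simp
  also have "\<dots> = ennreal (exp (real k / 2 * ln ((real \<mu> + real k) / exp 1) + real \<mu> / 2 * ln ((real \<mu> + real k) / real \<mu>)))"
    using chi_moment_const_exp[of \<mu> k] \<mu> k by (simp add: t)
  also have "\<dots> \<le> ennreal (exp (real k / 2 * ln (real (\<mu> + k - 1))))"
  proof (intro ennreal_leI, subst exp_le_cancel_iff)
    define s where "s = real \<mu> + real k"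
    have s: "4 \<le> s" using \<mu> k by (simp add: s_def)
    have "ln (s / (s - 1)) \<le> s / (s - 1) - 1" using s by (intro ln_le_minus_one) auto
    also have "\<dots> = 1 / (s - 1)" using s by (simp add: field_simps)
    also have "\<dots> \<le> 3 / (2 * s)" using s by (simp add: field_simps)
    also have "\<dots> \<le> real k / (2 * s)" using s k by (intro divide_right_mono) auto
    finally have "real k / 2 * ln (s / (s - 1)) \<le> real k / 2 * (real k / (2 * s))"
      by (intro mult_left_mono) auto
    then have "real k / 2 * ln s - (real k)\<^sup>2 / (4 * s) \<le> real k / 2 * ln (s - 1)"
      using s by (simp add: ln_div algebra_simps power2_eq_square)
    moreover have "real (\<mu> + k - 1) = s - 1" using \<mu> by (simp add: s_def of_nat_diff)
    ultimately show "real k / 2 * ln ((real \<mu> + real k) / exp 1) + real \<mu> / 2 * ln ((real \<mu> + real k) / real \<mu>)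
        \<le> real k / 2 * ln (real (\<mu> + k - 1))"
      using ln_chi_moment(1)[OF pos] unfolding s_def[symmetric] by simp
  qed
  also have "exp (real k / 2 * ln (real (\<mu> + k - 1))) = real (\<mu> + k - 1) powr (real k / 2)"
    using \<mu> k by (simp add: powr_def)
  finally show ?thesis .
qed

text \<open>Concentrating the weight on one row is the worst case: by the Weierstrass inequality the
  product of the \<open>1 - 2 * t * d i\<close> is at least \<open>1 - 2 * t\<close>. So the bound
  is that of a chi variable with \<open>l\<close> degrees of freedom, whatever the weights.\<close>

lemma gauss_weighted_moment_le:
  assumes k: "0 < k" "k \<le> l" and d: "\<And>i. 0 \<le> d i" "(\<Sum>i\<in>{\<mu>..<m}. d i) = 1"
  shows "(\<integral>\<^sup>+w. ennreal (sqrt (weighted_sq \<mu> m l d w) ^ k) \<partial>gauss ({\<mu>..<m} \<times> {..<l}))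
    \<le> ennreal ((sqrt (exp 1) * real l) powr (real k / 2))"
proof -
  let ?J = "{\<mu>..<m} \<times> {..<l}"
  define t where "t = real k / (2 * (real l + real k))"
  let ?w = "1 / sqrt (real l / (real l + real k))"
    and ?P = "\<Prod>p\<in>?J. 1 / sqrt (1 - 2 * t * d (fst p))"
    and ?p = "\<Prod>i\<in>{\<mu>..<m}. 1 - 2 * t * d i"
  have pos: "0 < real l" "0 < real k" using k by auto
  note t = chi_moment_const[OF pos, folded t_def]
  have d1: "d i \<le> 1" if "i \<in> {\<mu>..<m}" for i
    using d that by (metis finite_atLeastLessThan member_le_sum)
  have td: "2 * t * d i \<le> 2 * t" if "i \<in> {\<mu>..<m}" for i
    using d1[OF that] t(3) by (simp add: mult_left_le)
  then have td1: "2 * t * d i < 1" if "i \<in> {\<mu>..<m}" for i using that t(4) by (meson le_less_trans)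
  have "(\<integral>\<^sup>+w. ennreal (sqrt (weighted_sq \<mu> m l d w) ^ k) \<partial>gauss ?J)
      = (\<integral>\<^sup>+w. ennreal (sqrt (\<Sum>p\<in>?J. d (fst p) * (w p)\<^sup>2) ^ k) \<partial>gauss ?J)"
    by (simp add: weighted_sq_def case_prod_beta)
  also have "\<dots> \<le> ennreal ((real k / (2 * exp 1 * t)) powr (real k / 2) * ?P)"
    using d t k td1 by (intro nn_integral_gauss_norm_power_le) auto
  also have "\<dots> \<le> ennreal (((real l + real k) / exp 1) powr (real k / 2) * ?w ^ l)"
  proof (intro ennreal_leI, subst t(1), rule mult_left_mono)
    have "?P = (\<Prod>i\<in>{\<mu>..<m}. \<Prod>j<l. 1 / sqrt (1 - 2 * t * d i))"
      by (subst prod.cartesian_product) (simp add: case_prod_beta)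
    also have "\<dots> = (1 / sqrt ?p) ^ l"
    proof -
      have "sqrt (\<Prod>i\<in>S. f i) = (\<Prod>i\<in>S. sqrt (f i))" for f :: "nat \<Rightarrow> real" and S
        by (induction S rule: infinite_finite_induct) (auto simp: real_sqrt_mult)
      then show ?thesis by (simp add: prod_dividef prod_power_distrib power_divide)
    qed
    also have "\<dots> \<le> (1 / sqrt (1 - 2 * t)) ^ l"
    proof (intro power_mono divide_left_mono)
      have "1 - (\<Sum>i\<in>{\<mu>..<m}. 2 * t * d i) \<le> ?p"
        using td1 d t(3) by (intro Weierstrass_prod_ineq) (auto intro: less_imp_le)
      then have *: "1 - 2 * t \<le> ?p"
        using d(2) by (simp add: sum_distrib_left[symmetric])
      then show "sqrt (1 - 2 * t) \<le> sqrt ?p" by simp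
      show "0 < sqrt ?p * sqrt (1 - 2 * t)" using * t(4) by simp
      show "0 \<le> 1 / sqrt ?p" using * t(4) by simp
    qed simp
    finally show "?P \<le> ?w ^ l"
      by (simp only: t(2))
  qed simp
  also have "\<dots> = ennreal (exp (real k / 2 * ln ((real l + real k) / exp 1) + real l / 2 * ln ((real l + real k) / real l)))"
    using chi_moment_const_exp[of l k] k by simp
  also have "\<dots> \<le> ennreal (exp (real k / 2 * (ln (real l) + 1 / 2)))"
    using ln_chi_moment(2)[OF pos] k by (intro ennreal_leI) simp
  also have "exp (real k / 2 * (ln (real l) + 1 / 2)) = (sqrt (exp 1) * real l) powr (real k / 2)"
    using pos by (simp add: powr_def ln_mult ln_sqrt algebra_simps)
  finally show ?thesis .
qed

text \<open>sqrt e / 8 is what remains of the moment bases \<open>l\<close> and sqrt e * l after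
  division by 8 l^2. After squaring, with \<open>\<pi> < 4\<close>, the claim is that 32 k r^k is at
  most 1: true at k = 3, and preserved because (k + 1) r is at most k. At k = 2 the inequality is
  false.\<close>

lemma tail_constant_bound:
  assumes k: "3 \<le> (k::nat)"
  shows "2 * sqrt (2 * pi * real k) * (sqrt (exp 1) / 8) powr (real k / 2) \<le> 1"
proof -
  define r where "r = sqrt (exp 1 :: real) / 8"
  have "sqrt (exp 1 :: real) \<le> 1.65"
    by (rule real_le_lsqrt) (use e_less_272 in \<open>auto simp: power2_eq_square\<close>)
  then have r: "0 < r" "r \<le> 1.65 / 8" by (auto simp: r_def)
  have "8 * 4 * real k * r ^ k \<le> 1" using k
  proof (induction k rule: dec_induct)
    case base
    have "r ^ 3 \<le> (1.65 / 8) ^ 3" using r by (intro power_mono) auto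
    then show ?case by (simp add: power3_eq_cube)
  next
    case (step n)
    have "real (Suc n) * r \<le> real n"
      using r step.hyps mult_left_mono[of r "1.65 / 8" "real (Suc n)"] by simp
    then have "8 * 4 * (real (Suc n) * r) * r ^ n \<le> 8 * 4 * real n * r ^ n"
      using r by (intro mult_right_mono mult_left_mono) auto
    then show ?case using step.IH by (simp add: mult_ac)
  qed
  moreover have "8 * pi * real k * r ^ k \<le> 8 * 4 * real k * r ^ k"
    using pi_less_4 r by (intro mult_right_mono mult_left_mono) auto
  ultimately have "8 * pi * real k * r ^ k \<le> 1" by linarith
  moreover have "(2 * sqrt (2 * pi * real k) * r powr (real k / 2))\<^sup>2 = 8 * pi * real k * r ^ k"
  proof -
    have "(r powr (real k / 2))\<^sup>2 = r ^ k"
      using r by (simp add: power2_eq_square powr_add[symmetric] powr_realpow)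
    then show ?thesis by (simp add: power_mult_distrib)
  qed
  ultimately have "(2 * sqrt (2 * pi * real k) * r powr (real k / 2))\<^sup>2 \<le> 1\<^sup>2" by simp
  then show ?thesis unfolding r_def[symmetric] by (rule power2_le_imp_le) simp
qed

lemma gauss_row_ratio_tail_bound:
  assumes \<mu>: "0 < \<mu>" and K: "2 \<le> K" and l: "l = \<mu> + K" "l \<le> m"
    and d: "\<And>i. 0 \<le> d i" "(\<Sum>i\<in>{\<mu>..<m}. d i) = 1" and Y: "8 * (real l)\<^sup>2 \<le> Y"
  obtains \<Psi> where "\<Psi> \<in> borel_measurable (PiM ({..<m} \<times> {..<l}) (\<lambda>_. borel))"
    and "\<And>w x. (\<Sum>i<\<mu>. (x i)\<^sup>2) = 1 \<Longrightarrow> Y * row_form \<mu> l w x \<le> weighted_sq \<mu> m l d w \<Longrightarrow> 1 \<le> \<Psi> w"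
    and "(\<integral>\<^sup>+w. \<Psi> w \<partial>gauss ({..<m} \<times> {..<l}))
      \<le> ennreal (1 / sqrt (2 * pi * (real K + 1)) * (exp 1 / (real K + 1)) ^ (K + 1))"
proof -
  define k where "k = K + 1"
  let ?P = "real l powr (real k / 2)" and ?Q = "(sqrt (exp 1) * real l) powr (real k / 2)"
    and ?R = "(8 * (real l)\<^sup>2) powr (real k / 2)"
  \<comment> \<open>\<open>k = K + 1\<close> counts the directions that the other
    \<open>\<mu> - 1\<close> rows leave to row 0. The identity \<open>\<mu> + k - 1 = l\<close> lets
    the probe moment and the moment of the lower block be compared with the same power of
    \<open>l\<close>.\<close>
  have k3: "3 \<le> k" and kl: "k \<le> l" and kd: "k = l - (\<mu> - 1)" and lk: "\<mu> + k - 1 = l"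
    using \<mu> K l by (auto simp: k_def)
  have l0: "0 < real l" using \<mu> l by simp
  have Y0: "0 < Y" using Y l0 by (smt (verit) zero_less_power2)
  have Bh: "(\<integral>\<^sup>+h. ennreal (sqrt (\<Sum>i<\<mu>. (h i)\<^sup>2) ^ k) \<partial>gauss {..<\<mu>}) \<le> ennreal (?P)"
    using gauss_norm_moment_le[OF \<mu> k3] unfolding lk .
  have Bc: "(\<integral>\<^sup>+w. ennreal (sqrt (weighted_sq \<mu> m l d w) ^ k) \<partial>gauss ({\<mu>..<m} \<times> {..<l}))
      \<le> ennreal (?Q)"
    using k3 by (intro gauss_weighted_moment_le kl d) auto
  obtain \<Psi> where \<Psi>: "\<Psi> \<in> borel_measurable (PiM ({..<m} \<times> {..<l}) (\<lambda>_. borel))"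
    "\<And>w x. (\<Sum>i<\<mu>. (x i)\<^sup>2) = 1 \<Longrightarrow> Y * row_form \<mu> l w x \<le> weighted_sq \<mu> m l d w \<Longrightarrow> 1 \<le> \<Psi> w"
    and I: "(\<integral>\<^sup>+w. \<Psi> w \<partial>gauss ({..<m} \<times> {..<l}))
      \<le> ennreal (2 * exp (real k)) * ennreal (1 / (real k * sqrt Y) ^ k)
        * ennreal (?P) * ennreal (?Q)"
    using gauss_row_ratio_tail[OF \<mu> _ _ d Y0 kd Bh Bc] l by auto
  note I
  also have "ennreal (2 * exp (real k)) * ennreal (1 / (real k * sqrt Y) ^ k)
        * ennreal (?P) * ennreal (?Q)
      = ennreal (2 * exp (real k) * (1 / (real k * sqrt Y) ^ k)
        * ?P * ?Q)"
  proof -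
    have "ennreal a * ennreal b * ennreal c * ennreal e = ennreal (a * b * c * e)"
      if "0 \<le> a" "0 \<le> b" "0 \<le> c" "0 \<le> e" for a b c e
      using that by (simp add: ennreal_mult)
    then show ?thesis using Y0 by simp
  qed
  also have "\<dots> \<le> ennreal (1 / sqrt (2 * pi * real k) * (exp 1 / real k) ^ k)"
  proof (rule ennreal_leI)
    have "?R \<le> Y powr (real k / 2)"
      using Y by (intro powr_mono2) auto
    also have "\<dots> = sqrt Y ^ k"
      using Y0 by (simp add: powr_half_sqrt[symmetric] powr_realpow[symmetric] powr_powr)
    finally have sY: "?R \<le> sqrt Y ^ k" .
    have "1 / (real k * sqrt Y) ^ k \<le> 1 / (real k ^ k * ?R)"
      unfolding power_mult_distrib using sY l0 k3 Y0 by (intro divide_left_mono mult_left_mono) auto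
    then have "2 * exp (real k) * (1 / (real k * sqrt Y) ^ k) * (?P * ?Q)
      \<le> 2 * exp (real k) * (1 / (real k ^ k * ?R))
        * (?P * ?Q)"
      by (intro mult_right_mono mult_left_mono) auto
    also have "\<dots> = 2 * (exp 1 / real k) ^ k *
        ((?P * ?Q) / ?R)"
      by (simp add: power_divide exp_of_nat_mult[symmetric] exp_of_nat2_mult[symmetric])
    also have "(?P * ?Q) / ?R
        = (sqrt (exp 1) / 8) powr (real k / 2)"
      using l0 by (subst powr_mult[symmetric], simp, simp, subst powr_divide[symmetric]) (auto simp: power2_eq_square)
    also have "2 * (exp 1 / real k) ^ k * (sqrt (exp 1) / 8) powr (real k / 2)
        \<le> 1 / sqrt (2 * pi * real k) * (exp 1 / real k) ^ k"
    proof -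
      have "2 * (sqrt (exp 1) / 8) powr (real k / 2) \<le> 1 / sqrt (2 * pi * real k)"
        using tail_constant_bound[OF k3] k3 by (simp add: field_simps)
      from mult_right_mono[OF this, of "(exp 1 / real k) ^ k"]
      show ?thesis by (simp add: mult_ac)
    qed
    finally show "2 * exp (real k) * (1 / (real k * sqrt Y) ^ k) * ?P * ?Q
        \<le> 1 / sqrt (2 * pi * real k) * (exp 1 / real k) ^ k" by (simp only: mult.assoc)
  qed
  also have "\<dots> = ennreal (1 / sqrt (2 * pi * (real K + 1)) * (exp 1 / (real K + 1)) ^ (K + 1))"
    by (simp add: k_def add.commute)
  finally show ?thesis using that \<Psi> by blast
qed

section \<open>Failure probability for one mode\<close>

lemma weighted_sq_cong:
  "(\<And>i j. i < m \<Longrightarrow> j < l \<Longrightarrow> w (i, j) = w' (i, j)) \<Longrightarrow> weighted_sq \<mu> m l d w = weighted_sq \<mu> m l d w'"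
  unfolding weighted_sq_def by (intro sum.cong refl) auto

lemma standard_gaussian_mat_distr:
  assumes M: "prob_space M" and G: "standard_gaussian_mat M m l G" and ml: "0 < m" "0 < l"
  defines "J \<equiv> {..<m} \<times> {..<l}"
  shows "(\<lambda>\<omega>. \<lambda>p\<in>J. G \<omega> $$ p) \<in> measurable M (PiM J (\<lambda>_. borel))"
    and "distr M (PiM J (\<lambda>_. borel)) (\<lambda>\<omega>. \<lambda>p\<in>J. G \<omega> $$ p) = gauss J"
proof -
  interpret prob_space M by (rule M)
  have dist: "distributed M lborel (\<lambda>\<omega>. G \<omega> $$ p) std_normal_density" if "p \<in> J" for p
    using G that by (auto simp: standard_gaussian_mat_def J_def)
  have rv: "random_variable borel (\<lambda>\<omega>. G \<omega> $$ p)" if "p \<in> J" for p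
    using distributed_measurable[OF dist[OF that]] by simp
  have ind: "indep_vars (\<lambda>_. borel) (\<lambda>p \<omega>. G \<omega> $$ p) J"
    using G by (simp add: standard_gaussian_mat_def J_def case_prod_unfold)
  show "(\<lambda>\<omega>. \<lambda>p\<in>J. G \<omega> $$ p) \<in> measurable M (PiM J (\<lambda>_. borel))"
    using rv by (intro measurable_restrict)
  have "J \<noteq> {}" using ml by (auto simp: J_def)
  then have "distr M (PiM J (\<lambda>_. borel)) (\<lambda>\<omega>. \<lambda>p\<in>J. G \<omega> $$ p) = PiM J (\<lambda>p. distr M borel (\<lambda>\<omega>. G \<omega> $$ p))"
    using indep_vars_iff_distr_eq_PiM'[where I = J and M' = "\<lambda>_. borel" and X = "\<lambda>p \<omega>. G \<omega> $$ p"] rv ind by simp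
  also have "\<dots> = gauss J"
    unfolding gauss_def
  proof (rule PiM_cong[OF refl])
    fix p assume "p \<in> J"
    have "distr M borel (\<lambda>\<omega>. G \<omega> $$ p) = distr M lborel (\<lambda>\<omega>. G \<omega> $$ p)"
      by (intro distr_cong) auto
    then show "distr M borel (\<lambda>\<omega>. G \<omega> $$ p) = std_gauss"
      using distributed_distr_eq_density[OF dist[OF \<open>p \<in> J\<close>]] by simp
  qed
  finally show "distr M (PiM J (\<lambda>_. borel)) (\<lambda>\<omega>. \<lambda>p\<in>J. G \<omega> $$ p) = gauss J" .
qed

text \<open>The eigenvector for the smallest eigenvalue, which is the last one in decreasing order
  and so has index \<open>r - 1\<close>.\<close>

lemma row_form_minimizer:
  assumes r: "0 < r"
  obtains x where "(\<Sum>i<r. (x i)\<^sup>2) = 1" "\<And>y. row_form r l w x * (\<Sum>i<r. (y i)\<^sup>2) \<le> row_form r l w y"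
proof -
  define B where "B = Matrix.mat r l w"
  have B: "B \<in> carrier_mat r l" "B\<^sup>T \<in> carrier_mat l r" by (auto simp: B_def)
  obtain U \<tau> where U: "U \<in> carrier_mat r r" "U\<^sup>T * U = 1\<^sub>m r"
    and eq: "B * B\<^sup>T = U * mat_diag r \<tau> * U\<^sup>T"
    and \<tau>: "\<And>i j. i \<le> j \<Longrightarrow> j < r \<Longrightarrow> \<tau> j \<le> \<tau> i"
    using left_singular_vectors[OF B(1)] by metis
  have u: "orthogonal_fam {..<r} (\<lambda>i s. U $$ (s, i))" by (rule orthogonal_fam_of_mat[OF U])
  have rf: "row_form r l w y = (\<Sum>k<r. \<tau> k * (\<Sum>s<r. U $$ (s, k) * y s)\<^sup>2)" for y
  proof -
    have "row_form r l w y = (\<Sum>a<l. (\<Sum>s<r. B\<^sup>T $$ (a, s) * y s)\<^sup>2)"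
      unfolding row_form_def by (auto simp: B_def mult.commute intro!: sum.cong)
    also have "\<dots> = (\<Sum>k<r. \<tau> k * (\<Sum>s<r. U $$ (s, k) * y s)\<^sup>2)"
      using eq by (intro gram_quadratic_form[OF B(2) U(1)]) simp
    finally show ?thesis .
  qed
  define x where "x s = U $$ (s, r - 1)" for s
  have ux: "(\<Sum>s<r. U $$ (s, k) * x s) = (if k = r - 1 then 1 else 0)" if "k < r" for k
    using u that r by (auto simp: x_def orthogonal_fam_def)
  have "(\<Sum>i<r. (x i)\<^sup>2) = 1" using ux[of "r - 1"] r by (simp add: x_def power2_eq_square)
  moreover have "row_form r l w x = \<tau> (r - 1)"
  proof -
    have "row_form r l w x = (\<Sum>k<r. if k = r - 1 then \<tau> (r - 1) else 0)"
      unfolding rf by (intro sum.cong) (auto simp: ux)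
    then show ?thesis using r by simp
  qed
  moreover have "\<tau> (r - 1) * (\<Sum>i<r. (y i)\<^sup>2) \<le> row_form r l w y" for y
  proof -
    have "\<tau> (r - 1) * (\<Sum>i<r. (y i)\<^sup>2) = (\<Sum>k<r. \<tau> (r - 1) * (\<Sum>s<r. U $$ (s, k) * y s)\<^sup>2)"
      using orthogonal_fam_parseval[OF u finite_lessThan, of y] by (simp add: sum_distrib_left[symmetric])
    also have "\<dots> \<le> row_form r l w y"
      unfolding rf using \<tau> by (intro sum_mono mult_right_mono) auto
    finally show ?thesis .
  qed
  ultimately show ?thesis using that[of x] by simp
qed

text \<open>Transfers the tail bound to the probability space: rotation invariance absorbs
  \<open>U\<^sup>T\<close>, and Markov's inequality for the majorant bounds any measurable event on
  which a bad direction exists.\<close>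

lemma gaussian_mat_row_ratio_prob:
  assumes M: "prob_space M" and G: "standard_gaussian_mat M m l G"
    and U: "U \<in> carrier_mat m m" "U\<^sup>T * U = 1\<^sub>m m"
    and r: "0 < r" and K: "2 \<le> K" and l: "l = r + K" "l \<le> m"
    and d: "\<And>i. 0 \<le> d i" "(\<Sum>i\<in>{r..<m}. d i) = 1" and Y: "8 * (real l)\<^sup>2 \<le> Y"
    and E: "E \<in> sets M"
    and bad: "\<And>\<omega>. \<omega> \<in> E \<Longrightarrow> \<exists>x. (\<Sum>i<r. (x i)\<^sup>2) = 1 \<and>
      Y * row_form r l (\<lambda>p. (U\<^sup>T * G \<omega>) $$ p) x \<le> weighted_sq r m l d (\<lambda>p. (U\<^sup>T * G \<omega>) $$ p)"
  shows "measure M E \<le> 1 / sqrt (2 * pi * (real K + 1)) * (exp 1 / (real K + 1)) ^ (K + 1)"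
proof -
  interpret prob_space M by (rule M)
  let ?J = "{..<m} \<times> {..<l}"
  define R where "R w = (\<lambda>(i, j)\<in>?J. \<Sum>s<m. U $$ (s, i) * w (s, j))" for w :: "nat \<times> nat \<Rightarrow> real"
  define X where "X \<omega> = (\<lambda>p\<in>?J. G \<omega> $$ p)" for \<omega>
  have ml: "0 < m" "0 < l" using r l by auto
  note X = standard_gaussian_mat_distr[OF M G ml, folded X_def]
  obtain \<Psi> where \<Psi>: "\<Psi> \<in> borel_measurable (PiM ?J (\<lambda>_. borel))"
    and ge: "\<And>w x. (\<Sum>i<r. (x i)\<^sup>2) = 1 \<Longrightarrow> Y * row_form r l w x \<le> weighted_sq r m l d w \<Longrightarrow> 1 \<le> \<Psi> w"
    and I: "(\<integral>\<^sup>+w. \<Psi> w \<partial>gauss ?J)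
      \<le> ennreal (1 / sqrt (2 * pi * (real K + 1)) * (exp 1 / (real K + 1)) ^ (K + 1))"
    using gauss_row_ratio_tail_bound[OF r K l d Y] by blast
  have Rm: "R \<in> measurable (PiM ?J (\<lambda>_. borel)) (PiM ?J (\<lambda>_. borel))"
    unfolding R_def
    by (rule measurable_restrict) (auto intro!: coordinate_measurable)
  have UG: "(U\<^sup>T * G \<omega>) $$ (i, j) = R (X \<omega>) (i, j)" if "\<omega> \<in> space M" "i < m" "j < l" for \<omega> i j
  proof -
    have "G \<omega> \<in> carrier_mat m l" using G that by (auto simp: standard_gaussian_mat_def)
    then show ?thesis using that U by (simp add: R_def X_def scalar_prod_def lessThan_atLeast0)
  qed
  have "emeasure M E = (\<integral>\<^sup>+\<omega>. indicator E \<omega> \<partial>M)" using E by simp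
  also have "\<dots> \<le> (\<integral>\<^sup>+\<omega>. \<Psi> (R (X \<omega>)) \<partial>M)"
  proof (rule nn_integral_mono)
    fix \<omega> assume \<omega>: "\<omega> \<in> space M"
    show "indicator E \<omega> \<le> \<Psi> (R (X \<omega>))"
    proof (cases "\<omega> \<in> E")
      case True
      obtain x where x: "(\<Sum>i<r. (x i)\<^sup>2) = 1"
        "Y * row_form r l (\<lambda>p. (U\<^sup>T * G \<omega>) $$ p) x \<le> weighted_sq r m l d (\<lambda>p. (U\<^sup>T * G \<omega>) $$ p)"
        using bad[OF True] by blast
      have "row_form r l (\<lambda>p. (U\<^sup>T * G \<omega>) $$ p) = row_form r l (R (X \<omega>))"
        using UG[OF \<omega>] l by (intro row_form_cong) auto
      moreover have "weighted_sq r m l d (\<lambda>p. (U\<^sup>T * G \<omega>) $$ p) = weighted_sq r m l d (R (X \<omega>))"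
        using UG[OF \<omega>] by (intro weighted_sq_cong) auto
      ultimately have "1 \<le> \<Psi> (R (X \<omega>))" using x by (intro ge[OF x(1)]) simp
      then show ?thesis using True by simp
    qed simp
  qed
  also have "\<dots> = (\<integral>\<^sup>+w. \<Psi> (R w) \<partial>gauss ?J)"
    unfolding X(2)[symmetric]
    by (rule nn_integral_distr[symmetric, OF X(1)]) (use measurable_compose[OF Rm \<Psi>] in simp)
  also have "\<dots> = (\<integral>\<^sup>+w. \<Psi> w \<partial>gauss ?J)"
    unfolding R_def
    by (rule nn_integral_gauss_rotate_rows[OF orthogonal_fam_of_mat[OF U] _ _ \<Psi>]) auto
  also note I
  finally show ?thesis unfolding emeasure_eq_measure by (subst (asm) ennreal_le_iff) auto
qed

lemma projection_error_measurable:
  assumes Q: "random_mat M m r Q" and B: "B \<in> carrier_mat m d"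
  shows "(\<lambda>\<omega>. frob_norm (B - Q \<omega> * (Q \<omega>)\<^sup>T * B)) \<in> borel_measurable M"
proof -
  let ?q = "\<lambda>\<omega> i j. \<Sum>k<m. (\<Sum>a<r. Q \<omega> $$ (i, a) * Q \<omega> $$ (k, a)) * B $$ (k, j)"
  have "(\<lambda>\<omega>. sqrt (\<Sum>i<m. \<Sum>j<d. (B $$ (i, j) - ?q \<omega> i j)\<^sup>2))
      \<in> borel_measurable M"
    using Q by (auto simp: random_mat_def intro!: measurable_compose[OF _ borel_measurable_sqrt] borel_measurable_sum
        borel_measurable_power borel_measurable_diff borel_measurable_times)
  moreover have "frob_norm (B - Q \<omega> * (Q \<omega>)\<^sup>T * B)
      = sqrt (\<Sum>i<m. \<Sum>j<d. (B $$ (i, j) - ?q \<omega> i j)\<^sup>2)"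
    if "\<omega> \<in> space M" for \<omega>
  proof -
    have Qc: "Q \<omega> \<in> carrier_mat m r" using Q that by (simp add: random_mat_def)
    have "(B - Q \<omega> * (Q \<omega>)\<^sup>T * B) $$ (i, j)
        = B $$ (i, j) - ?q \<omega> i j"
      if "i < m" "j < d" for i j
    proof -
      have "(Q \<omega> * (Q \<omega>)\<^sup>T * B) $$ (i, j) = (\<Sum>k<m. (Q \<omega> * (Q \<omega>)\<^sup>T) $$ (i, k) * B $$ (k, j))"
        using that Qc B by (subst index_mult_mat(1)) (auto simp: scalar_prod_lessThan)
      also have "\<dots> = ?q \<omega> i j"
        using that Qc by (intro sum.cong refl) (auto simp: scalar_prod_lessThan)
      finally show ?thesis using that Qc B by simp
    qed
    then show ?thesis using Qc B by (simp add: frob_norm_def)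
  qed
  ultimately show ?thesis by (subst measurable_cong) auto
qed

text \<open>By contraposition: below the threshold \<open>Y\<close> the deterministic bound applies,
  so every failure lies in the bad event. A singular upper block is covered as well, because it
  makes \<open>row_form\<close> vanish at the minimising direction and hence meets the bad
  condition.\<close>

lemma range_finder_error_prob:
  assumes M: "prob_space M" and G: "standard_gaussian_mat M m (r + K) G" and Q: "random_mat M m r Q"
    and alg: "\<And>\<omega>. \<omega> \<in> space M \<Longrightarrow> power_sketch_factor B r K q (G \<omega>) (Q \<omega>)"
    and B: "B \<in> carrier_mat m d" and r: "0 < r" "r + K < min m d" and K: "2 \<le> K" and q: "1 \<le> q"
    and bg: "1 < \<beta>" "1 < \<gamma>"
    and c: "real r + real K \<le> c"
    and lam: "lam = (sqrt c + sqrt (real m)) * sqrt (2 * (real r + real K)) * \<gamma> * \<beta> / sing_val r B ^ (2 * q - 1)"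
  shows "measure M {\<omega> \<in> space M. \<not> frob_norm (B - Q \<omega> * (Q \<omega>)\<^sup>T * B)
      \<le> 2 * (lam * tail_norm_pow B (r + 1) q + tail_norm B (r + 1))}
    \<le> 1 / sqrt (2 * pi * (real K + 1)) * (exp 1 / (real K + 1)) ^ (K + 1)"
    (is "measure M ?E \<le> _")
proof -
  define l where "l = r + K"
  define \<Delta>q where "\<Delta>q = tail_norm_pow B (r + 1) q"
  define \<Delta> where "\<Delta> = tail_norm B (r + 1)"
  define \<sigma> where "\<sigma> = sing_val r B"
  \<comment> \<open>Chosen so that \<open>sqrt Y * \<gamma> * \<beta>\<close> is the numerator of
    \<open>lam\<close>.\<close>
  define Y where "Y = 2 * real l * (sqrt c + sqrt (real m))\<^sup>2"
  have lm: "l < m" "r < m" "l < d" using r by (auto simp: l_def)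
  have l0: "0 < l" using r by (simp add: l_def)
  have c0: "0 \<le> c" using c by linarith
  obtain U \<tau> where U: "U \<in> carrier_mat m m" "U\<^sup>T * U = 1\<^sub>m m"
    and BB: "B * B\<^sup>T = U * mat_diag m \<tau> * U\<^sup>T"
    and \<tau>: "\<And>i. i < m \<Longrightarrow> 0 \<le> \<tau> i" "\<And>i j. i \<le> j \<Longrightarrow> j < m \<Longrightarrow> \<tau> j \<le> \<tau> i"
    and \<tau>s: "\<And>i. i < min m d \<Longrightarrow> \<tau> i = (sing_val (Suc i) B)\<^sup>2"
    and \<tau>0: "\<And>i. min m d \<le> i \<Longrightarrow> i < m \<Longrightarrow> \<tau> i = 0"
    using left_singular_vectors[OF B] by metis
  have tails: "(\<Sum>i\<in>{r..<m}. f (\<tau> i)) = (\<Sum>i = r + 1..min (dim_row B) (dim_col B). f ((sing_val i B)\<^sup>2))"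
    if "f 0 = 0" for f :: "real \<Rightarrow> real"
  proof -
    have "(\<Sum>i\<in>{r..<m}. f (\<tau> i)) = (\<Sum>i\<in>{r..<min m d}. f (\<tau> i))"
      using \<tau>0 that by (intro sum.mono_neutral_right) (auto simp: not_less)
    also have "\<dots> = (\<Sum>i = r + 1..min m d. f ((sing_val i B)\<^sup>2))"
      by (rule sum.reindex_bij_witness[of _ "\<lambda>i. i - 1" Suc]) (auto simp: \<tau>s)
    finally show ?thesis using B by simp
  qed
  have \<Delta>_eq: "sqrt (\<Sum>i\<in>{r..<m}. \<tau> i) = \<Delta>"
    unfolding \<Delta>_def tail_norm_def using tails[of "\<lambda>x. x"] by simp
  have \<Delta>q_eq: "(\<Sum>i\<in>{r..<m}. \<tau> i ^ (2 * q)) = \<Delta>q\<^sup>2"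
  proof -
    have nn: "0 \<le> (\<Sum>i\<in>{r..<m}. \<tau> i ^ (2 * q))" by (intro sum_nonneg) (auto simp: \<tau>(1))
    have "(\<Sum>i\<in>{r..<m}. \<tau> i ^ (2 * q)) = (\<Sum>i = r + 1..min (dim_row B) (dim_col B). sing_val i B ^ (4 * q))"
      using tails[of "\<lambda>x. x ^ (2 * q)"] q by (simp add: power_mult[symmetric] zero_power)
    with nn show ?thesis unfolding \<Delta>q_def tail_norm_pow_def by simp
  qed
  have \<Delta>q0: "0 \<le> \<Delta>q" "0 \<le> \<Delta>"
    unfolding \<Delta>_eq[symmetric] using \<tau>(1)
    by (auto simp: \<Delta>q_def tail_norm_pow_def intro!: sum_nonneg zero_le_even_power)
  have \<sigma>: "0 \<le> \<sigma>" "\<tau> (r - 1) = \<sigma>\<^sup>2"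
  proof -
    have "r - 1 < min m d" "Suc (r - 1) = r" using r by auto
    then show "0 \<le> \<sigma>" "\<tau> (r - 1) = \<sigma>\<^sup>2"
      using sing_val_sq(2)[OF B, of "r - 1"] \<tau>s[of "r - 1"] by (auto simp: \<sigma>_def)
  qed
  have \<sigma>0: "\<Delta>q = 0" if "\<sigma> = 0"
  proof -
    have "\<tau> i = 0" if "i \<in> {r..<m}" for i
      using \<tau>(1)[of i] \<tau>(2)[of "r - 1" i] that \<sigma> \<open>\<sigma> = 0\<close> by auto
    then have "(\<Sum>i\<in>{r..<m}. \<tau> i ^ (2 * q)) = 0" using q by (intro sum.neutral) auto
    then show ?thesis using \<Delta>q_eq by simp
  qed
  \<comment> \<open>When \<open>\<Delta>q = 0\<close> there is nothing to normalise; the whole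
    weight is then put on row \<open>r\<close>. The total is still 1, and
    \<open>\<tau> i ^ (2 * q) = \<Delta>q\<^sup>2 * \<delta> i\<close> still holds, both sides being
    0.\<close>
  define \<delta> where "\<delta> i = (if \<Delta>q = 0 then (if i = r then 1 else 0) else if i < m then \<tau> i ^ (2 * q) / \<Delta>q\<^sup>2 else 0)" for i
  have \<delta>: "0 \<le> \<delta> i" for i using \<tau>(1)[of i] by (auto simp: \<delta>_def)
  have \<delta>1: "(\<Sum>i\<in>{r..<m}. \<delta> i) = 1"
  proof (cases "\<Delta>q = 0")
    case True
    then show ?thesis using lm by (simp add: \<delta>_def)
  next
    case False
    then have "(\<Sum>i\<in>{r..<m}. \<delta> i) = (\<Sum>i\<in>{r..<m}. \<tau> i ^ (2 * q)) / \<Delta>q\<^sup>2"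
      unfolding sum_divide_distrib by (intro sum.cong) (auto simp: \<delta>_def)
    then show ?thesis using False \<Delta>q_eq by simp
  qed
  have \<delta>\<tau>: "\<tau> i ^ (2 * q) = \<Delta>q\<^sup>2 * \<delta> i" if "i \<in> {r..<m}" for i
  proof (cases "\<Delta>q = 0")
    case True
    then have "(\<Sum>i\<in>{r..<m}. \<tau> i ^ (2 * q)) = 0" using \<Delta>q_eq by simp
    then have "\<forall>i\<in>{r..<m}. \<tau> i ^ (2 * q) = 0" using \<tau>(1) by (subst (asm) sum_nonneg_eq_0_iff) auto
    then show ?thesis using that True by simp
  qed (use that in \<open>auto simp: \<delta>_def\<close>)
  \<comment> \<open>Both \<open>c\<close> and \<open>m\<close> are at least \<open>l\<close>, so the
    sum of the square roots is at least 2 sqrt l, and 2 l * 4 l = 8 l^2.\<close>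
  have Y: "8 * (real l)\<^sup>2 \<le> Y"
  proof -
    have "sqrt (real l) \<le> sqrt c" "sqrt (real l) \<le> sqrt (real m)" using c lm by (auto simp: l_def)
    then have "2 * sqrt (real l) \<le> sqrt c + sqrt (real m)" by linarith
    then have "(2 * sqrt (real l))\<^sup>2 \<le> (sqrt c + sqrt (real m))\<^sup>2" by (rule power_mono) simp
    then have "2 * real l * (4 * real l) \<le> Y" unfolding Y_def by (intro mult_left_mono) (auto simp: power_mult_distrib)
    then show ?thesis by (simp add: power2_eq_square)
  qed
  have Y0: "0 < Y" using Y l0 by (smt (verit) of_nat_0_less_iff zero_less_power2)
  have sY: "sqrt Y = (sqrt c + sqrt (real m)) * sqrt (2 * (real r + real K))"
    unfolding Y_def l_def using c0 by (simp add: real_sqrt_mult)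
  note projection_error_measurable[OF Q B, measurable]
  have meas: "?E \<in> sets M" by measurable
  show ?thesis
  proof (rule gaussian_mat_row_ratio_prob[OF M G[folded l_def] U r(1) K l_def less_imp_le[OF lm(1)] \<delta> \<delta>1 Y meas])
    fix \<omega> assume \<omega>: "\<omega> \<in> ?E"
    define w where "w = (\<lambda>p. (U\<^sup>T * G \<omega>) $$ p)"
    have Gc: "G \<omega> \<in> carrier_mat m (r + K)" using G \<omega> by (auto simp: standard_gaussian_mat_def)
    obtain x where x: "(\<Sum>i<r. (x i)\<^sup>2) = 1"
      and xmin: "\<And>y. row_form r l w x * (\<Sum>i<r. (y i)\<^sup>2) \<le> row_form r l w y"
      using row_form_minimizer[OF r(1)] by blast
    have "Y * row_form r l w x \<le> weighted_sq r m l \<delta> w"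
    proof (rule ccontr)
      assume "\<not> ?thesis"
      then have lt: "weighted_sq r m l \<delta> w < Y * row_form r l w x" by simp
      have wn: "0 \<le> weighted_sq r m l \<delta> w" unfolding weighted_sq_def using \<delta> by (intro sum_nonneg) auto
      \<comment> \<open>The strict inequality forces \<open>row_form\<close> to be positive at its
        minimiser, so the upper block is nonsingular and division by \<open>s\<close> is
        legitimate.\<close>
      then have "0 < Y * row_form r l w x" using lt by simp
      then have pos: "0 < row_form r l w x" using Y0 by (simp add: zero_less_mult_iff)
      define s where "s = sqrt (row_form r l w x)"
      have s: "0 < s" "s\<^sup>2 = row_form r l w x" using pos by (auto simp: s_def)
      define X where "X = \<Delta>q * sqrt (weighted_sq r m l \<delta> w)"
      have lower: "s\<^sup>2 * (\<Sum>i<r. (y i)\<^sup>2) \<le> (\<Sum>j<r + K. (\<Sum>i<r. y i * (U\<^sup>T * G \<omega>) $$ (i, j))\<^sup>2)" for y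
        using xmin[of y] unfolding s(2) row_form_def w_def l_def .
      have X2: "(\<Sum>i\<in>{r..<m}. \<Sum>j<r + K. \<tau> i ^ (2 * q) * ((U\<^sup>T * G \<omega>) $$ (i, j))\<^sup>2) \<le> X\<^sup>2"
      proof -
        have "(\<Sum>i\<in>{r..<m}. \<Sum>j<r + K. \<tau> i ^ (2 * q) * ((U\<^sup>T * G \<omega>) $$ (i, j))\<^sup>2)
            = (\<Sum>i\<in>{r..<m}. \<Sum>j<l. \<Delta>q\<^sup>2 * (\<delta> i * (w (i, j))\<^sup>2))"
          unfolding l_def w_def by (intro sum.cong refl) (simp add: \<delta>\<tau>)
        also have "\<dots> = \<Delta>q\<^sup>2 * weighted_sq r m l \<delta> w"
          unfolding weighted_sq_def sum.cartesian_product[symmetric] sum_distrib_left ..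
        also have "\<dots> = X\<^sup>2" unfolding X_def using wn by (simp add: power_mult_distrib)
        finally show ?thesis by simp
      qed
      have X0: "0 \<le> X" unfolding X_def using \<Delta>q0 wn by simp
      have "frob_norm (B - Q \<omega> * (Q \<omega>)\<^sup>T * B) \<le> 2 * X / (s * \<sigma> ^ (2 * q - 1)) + sqrt (\<Sum>i\<in>{r..<m}. \<tau> i)"
      proof (rule range_finder_error[OF B Gc U BB \<tau> r(1) _ q _ s(1) lower X2 X0 \<sigma>])
        show "r + K < m" using r by simp
        show "power_sketch_factor B r K q (G \<omega>) (Q \<omega>)" using alg \<omega> by simp
        show "X = 0" if "\<sigma> = 0" using \<sigma>0[OF that] by (simp add: X_def)
      qed
      also have "2 * X / (s * \<sigma> ^ (2 * q - 1)) \<le> 2 * (lam * \<Delta>q)"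
      proof -
        have "weighted_sq r m l \<delta> w \<le> Y * s\<^sup>2" using lt s by simp
        then have "sqrt (weighted_sq r m l \<delta> w) \<le> sqrt (Y * s\<^sup>2)" by (rule real_sqrt_le_mono)
        also have "sqrt (Y * s\<^sup>2) = sqrt Y * s" using s(1) by (simp add: real_sqrt_mult)
        finally have "X \<le> \<Delta>q * (sqrt Y * s)" unfolding X_def using \<Delta>q0 by (intro mult_left_mono)
        then have "X / s \<le> \<Delta>q * sqrt Y" using s by (simp add: divide_le_eq mult_ac)
        also have "\<dots> \<le> \<Delta>q * (sqrt Y * (\<gamma> * \<beta>))"
        proof -
          have "1 * 1 \<le> \<gamma> * \<beta>" using bg by (intro mult_mono) auto
          then show ?thesis using \<Delta>q0 Y0 by (intro mult_left_mono) (auto simp: mult_le_cancel_left1)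
        qed
        finally have "X / s / \<sigma> ^ (2 * q - 1) \<le> \<Delta>q * (sqrt Y * (\<gamma> * \<beta>)) / \<sigma> ^ (2 * q - 1)"
          using \<sigma>(1) by (intro divide_right_mono) auto
        also have "\<dots> = lam * \<Delta>q" unfolding lam \<sigma>_def[symmetric] sY by (simp add: mult_ac)
        finally show ?thesis by simp
      qed
      finally have "frob_norm (B - Q \<omega> * (Q \<omega>)\<^sup>T * B) \<le> 2 * (lam * \<Delta>q) + \<Delta>" by (simp add: \<Delta>_eq)
      then have "frob_norm (B - Q \<omega> * (Q \<omega>)\<^sup>T * B) \<le> 2 * (lam * \<Delta>q + \<Delta>)" using \<Delta>q0 by simp
      then show False using \<omega> unfolding \<Delta>q_def \<Delta>_def by simp
    qed
    with x show "\<exists>x. (\<Sum>i<r. (x i)\<^sup>2) = 1 \<and>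
      Y * row_form r l (\<lambda>p. (U\<^sup>T * G \<omega>) $$ p) x \<le> weighted_sq r m l \<delta> (\<lambda>p. (U\<^sup>T * G \<omega>) $$ p)"
      unfolding w_def by blast
  qed
qed

section \<open>Tensors\<close>

definition unfold_idx :: "nat \<Rightarrow> (nat \<Rightarrow> nat) \<Rightarrow> nat \<Rightarrow> nat \<times> nat \<Rightarrow> nat \<Rightarrow> nat" where
  "unfold_idx N I n = (\<lambda>(r, c). \<lambda>m\<in>{1..N}. if m = n then r else (c div (\<Prod>l\<in>{1..<m} - {n}. I l)) mod I m)"

text \<open>Splitting off the top digit: a residue modulo \<open>w * I (Suc k)\<close> consists of
  the residue modulo \<open>w\<close> and the next digit. Mode \<open>n\<close> has no digit and is
  passed over.\<close>

lemma mixed_radix_digits_determine: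
  fixes I :: "nat \<Rightarrow> nat"
  assumes dig: "\<And>m. m \<in> {1..k} - {n} \<Longrightarrow>
      (c div (\<Prod>l\<in>{1..<m} - {n}. I l)) mod I m = (c' div (\<Prod>l\<in>{1..<m} - {n}. I l)) mod I m"
  shows "c mod (\<Prod>l\<in>{1..k} - {n}. I l) = c' mod (\<Prod>l\<in>{1..k} - {n}. I l)"
  using dig
proof (induction k)
  case (Suc k)
  define w where "w = (\<Prod>l\<in>{1..k} - {n}. I l)"
  have IH: "c mod w = c' mod w" unfolding w_def using Suc by auto
  show ?case
  proof (cases "Suc k = n")
    case True
    then have "{1..Suc k} - {n} = {1..k} - {n}" by auto
    then show ?thesis using IH by (simp add: w_def)
  next
    case False
    then have "{1..Suc k} - {n} = insert (Suc k) ({1..k} - {n})" by auto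
    then have p: "(\<Prod>l\<in>{1..Suc k} - {n}. I l) = w * I (Suc k)" by (simp add: w_def mult.commute)
    have "{1..<Suc k} = {1..k}" by auto
    then have "(c div w) mod I (Suc k) = (c' div w) mod I (Suc k)"
      using Suc.prems[of "Suc k"] False by (simp add: w_def)
    then show ?thesis unfolding p mod_mult2_eq using IH by simp
  qed
qed simp

lemma bij_betw_unfold_idx:
  assumes n: "n \<in> {1..N}" and I: "\<And>m. m \<in> {1..N} \<Longrightarrow> 0 < I m"
  shows "bij_betw (unfold_idx N I n) ({..<I n} \<times> {..<codim N I n}) (tensor_idx N I)"
proof -
  have inj: "inj_on (unfold_idx N I n) ({..<I n} \<times> {..<codim N I n})"
  proof (rule inj_onI, clarify)
    fix r c r' c' assume b: "r < I n" "c < codim N I n" "r' < I n" "c' < codim N I n"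
      and eq: "unfold_idx N I n (r, c) = unfold_idx N I n (r', c')"
    have r: "r = r'" using fun_cong[OF eq, of n] n by (simp add: unfold_idx_def)
    have "(c div (\<Prod>l\<in>{1..<m} - {n}. I l)) mod I m = (c' div (\<Prod>l\<in>{1..<m} - {n}. I l)) mod I m"
      if "m \<in> {1..N} - {n}" for m
      using fun_cong[OF eq, of m] that by (simp add: unfold_idx_def)
    from mixed_radix_digits_determine[of N n c I c', OF this]
    have "c mod codim N I n = c' mod codim N I n" by (simp add: codim_def)
    then show "r = r' \<and> c = c'" using b r by simp
  qed
  have into: "unfold_idx N I n ` ({..<I n} \<times> {..<codim N I n}) \<subseteq> tensor_idx N I"
    using I n by (auto simp: unfold_idx_def tensor_idx_def PiE_iff)
  have fin: "finite (tensor_idx N I)" by (simp add: tensor_idx_def finite_PiE)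
  \<comment> \<open>Surjectivity by counting: both sides have the same finite number of
    elements.\<close>
  have "card (tensor_idx N I) = (\<Prod>m\<in>{1..N}. I m)" by (simp add: tensor_idx_def card_PiE)
  also have "\<dots> = I n * codim N I n" unfolding codim_def using n by (simp add: prod.remove)
  also have "\<dots> = card (unfold_idx N I n ` ({..<I n} \<times> {..<codim N I n}))"
    using card_image[OF inj] by (simp add: card_cartesian_product)
  finally have "unfold_idx N I n ` ({..<I n} \<times> {..<codim N I n}) = tensor_idx N I"
    using into fin by (intro card_subset_eq) auto
  with inj show ?thesis by (simp add: bij_betw_def)
qed

lemma unfolding_mat_carrier: "unfolding_mat N I A n \<in> carrier_mat (I n) (codim N I n)"
  by (simp add: unfolding_mat_def)

lemma unfolding_mat_index:
  "r < I n \<Longrightarrow> c < codim N I n \<Longrightarrow> unfolding_mat N I A n $$ (r, c) = A (unfold_idx N I n (r, c))"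
  by (simp add: unfolding_mat_def unfold_idx_def)

lemma tensor_norm_unfolding:
  assumes "n \<in> {1..N}" "\<And>m. m \<in> {1..N} \<Longrightarrow> 0 < I m"
  shows "tensor_norm N I T = frob_norm (unfolding_mat N I T n)"
proof -
  have "(\<Sum>i\<in>tensor_idx N I. (T i)\<^sup>2) = (\<Sum>p\<in>{..<I n} \<times> {..<codim N I n}. (T (unfold_idx N I n p))\<^sup>2)"
    by (rule sum.reindex_bij_betw[OF bij_betw_unfold_idx[OF assms], symmetric])
  also have "\<dots> = (\<Sum>r<I n. \<Sum>c<codim N I n. (unfolding_mat N I T n $$ (r, c))\<^sup>2)"
    unfolding sum.cartesian_product by (intro sum.cong) (auto simp: unfolding_mat_index)
  finally show ?thesis
    using unfolding_mat_carrier[of N I T n] by (simp add: tensor_norm_def frob_norm_def)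
qed

lemma unfolding_mat_mode_prod:
  assumes n: "n \<in> {1..N}" and P: "P \<in> carrier_mat (I n) (I n)"
  shows "unfolding_mat N I (mode_prod n A P) n = P * unfolding_mat N I A n"
proof (rule eq_matI)
  note U = unfolding_mat_carrier[of N I A n]
  fix r c assume "r < dim_row (P * unfolding_mat N I A n)" "c < dim_col (P * unfolding_mat N I A n)"
  then have rc: "r < I n" "c < codim N I n" using U P by auto
  have "(unfold_idx N I n (r, c))(n := k) = unfold_idx N I n (k, c)" for k
    using n by (auto simp: unfold_idx_def fun_eq_iff)
  moreover have "unfold_idx N I n (r, c) n = r" using n by (simp add: unfold_idx_def)
  ultimately show "unfolding_mat N I (mode_prod n A P) n $$ (r, c) = (P * unfolding_mat N I A n) $$ (r, c)"
    using rc P U by (simp add: unfolding_mat_index mode_prod_def scalar_prod_def lessThan_atLeast0 mult.commute)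
qed (use P unfolding_mat_carrier[of N I A n] unfolding_mat_carrier[of N I "mode_prod n A P" n] in auto)

lemma unfolding_mat_diff:
  "unfolding_mat N I (\<lambda>i. A i - T i) n = unfolding_mat N I A n - unfolding_mat N I T n"
  by (rule eq_matI) (auto simp: unfolding_mat_def)

lemma tensor_norm_triangle: "tensor_norm N I (\<lambda>i. S i + T i) \<le> tensor_norm N I S + tensor_norm N I T"
  unfolding tensor_norm_def using L2_set_triangle_ineq[of S T "tensor_idx N I"] by (simp add: L2_set_def)

text \<open>The new error is split as (A - A P) + (A - T) P, with P acting in mode \<open>n\<close>.
  Thus each residual is one of the original tensor rather than of a partly projected one, and the
  projection P does not increase the earlier error.\<close>

lemma projection_error_telescope:
  assumes I: "\<And>m. m \<in> {1..N} \<Longrightarrow> 0 < I m"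
    and Q: "\<And>n. n \<in> {1..N} \<Longrightarrow> Q n \<in> carrier_mat (I n) (\<mu> n) \<and> orthonormal_mat (Q n)"
  shows "tensor_norm N I (\<lambda>i. A i - project_tensor N A Q i)
    \<le> (\<Sum>n=1..N. frob_norm (unfolding_mat N I A n - Q n * (Q n)\<^sup>T * unfolding_mat N I A n))"
proof -
  define T where "T k = fold (\<lambda>n T. mode_prod n T (Q n * (Q n)\<^sup>T)) [1..<Suc k] A" for k
  have "tensor_norm N I (\<lambda>i. A i - T k i)
      \<le> (\<Sum>n=1..k. frob_norm (unfolding_mat N I A n - Q n * (Q n)\<^sup>T * unfolding_mat N I A n))" if "k \<le> N" for k
    using that
  proof (induction k)
    case 0
    then show ?case by (simp add: T_def tensor_norm_def)
  next
    case (Suc k)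
    define n where "n = Suc k"
    define P where "P = Q n * (Q n)\<^sup>T"
    have n: "n \<in> {1..N}" using Suc.prems by (simp add: n_def)
    have Qn: "Q n \<in> carrier_mat (I n) (\<mu> n)" "orthonormal_mat (Q n)" using Q[OF n] by auto
    have P: "P \<in> carrier_mat (I n) (I n)" using Qn by (simp add: P_def)
    have TS: "T (Suc k) = mode_prod n (T k) P" by (simp add: T_def n_def P_def)
    define D where "D i = A i - T k i" for i
    have norm_unf: "tensor_norm N I S = frob_norm (unfolding_mat N I S n)" for S
      by (rule tensor_norm_unfolding[OF n]) (rule I)
    have eq: "A i - T (Suc k) i = (A i - mode_prod n A P i) + mode_prod n D P i" for i
      unfolding TS D_def by (simp add: mode_prod_def sum_subtractf left_diff_distrib)
    have "tensor_norm N I (\<lambda>i. A i - T (Suc k) i)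
        \<le> tensor_norm N I (\<lambda>i. A i - mode_prod n A P i) + tensor_norm N I (mode_prod n D P)"
      unfolding eq by (rule tensor_norm_triangle)
    also have "tensor_norm N I (\<lambda>i. A i - mode_prod n A P i)
        = frob_norm (unfolding_mat N I A n - P * unfolding_mat N I A n)"
      by (simp add: norm_unf unfolding_mat_diff unfolding_mat_mode_prod[where I = I and P = P, OF n P])
    also have "tensor_norm N I (mode_prod n D P) \<le> tensor_norm N I D"
      unfolding norm_unf unfolding_mat_mode_prod[where I = I and P = P, OF n P] unfolding P_def
      by (rule residual_projection(4)[OF Qn unfolding_mat_carrier[where I = I and n = n]])
    also have "tensor_norm N I D
        \<le> (\<Sum>n=1..k. frob_norm (unfolding_mat N I A n - Q n * (Q n)\<^sup>T * unfolding_mat N I A n))"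
      unfolding D_def using Suc by simp
    finally show ?case by (simp add: n_def P_def add.commute)
  qed
  from this[of N] show ?thesis by (simp add: T_def project_tensor_def)
qed

text \<open>The success event has to be measurable, because \<open>measure\<close> assigns 0 to sets
  outside the sigma-algebra.\<close>

lemma project_tensor_measurable:
  assumes I: "\<And>m. m \<in> {1..N} \<Longrightarrow> 0 < I m"
    and Q: "\<And>n. n \<in> {1..N} \<Longrightarrow> random_mat M (I n) (\<mu> n) (Q n)"
    and i: "i \<in> tensor_idx N I"
  shows "(\<lambda>\<omega>. project_tensor N A (\<lambda>n. Q n \<omega>) i) \<in> borel_measurable M"
proof -
  define T where "T k \<omega> = fold (\<lambda>n T. mode_prod n T (Q n \<omega> * (Q n \<omega>)\<^sup>T)) [1..<Suc k] A" for k \<omega>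
  have "(\<lambda>\<omega>. T k \<omega> i) \<in> borel_measurable M" if "k \<le> N" "i \<in> tensor_idx N I" for k i
    using that
  proof (induction k arbitrary: i)
    case 0
    then show ?case by (simp add: T_def)
  next
    case (Suc k)
    define n where "n = Suc k"
    have n: "n \<in> {1..N}" using Suc.prems by (simp add: n_def)
    have TS: "T (Suc k) \<omega> i = (\<Sum>s<I n. T k \<omega> (i(n := s)) * (\<Sum>a<\<mu> n. Q n \<omega> $$ (i n, a) * Q n \<omega> $$ (s, a)))"
      if \<omega>: "\<omega> \<in> space M" for \<omega>
    proof -
      have Qc: "Q n \<omega> \<in> carrier_mat (I n) (\<mu> n)" using Q[OF n] \<omega> by (simp add: random_mat_def)
      have "i n < I n" using Suc.prems(2) n by (auto simp: tensor_idx_def)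
      then show ?thesis using Qc
        by (simp add: T_def n_def mode_prod_def scalar_prod_def lessThan_atLeast0)
    qed
    have upd: "i(n := s) \<in> tensor_idx N I" if "s < I n" for s
      using Suc.prems(2) n that by (auto simp: tensor_idx_def PiE_iff extensional_def)
    have "i n < I n" using Suc.prems(2) n by (auto simp: tensor_idx_def)
    then have "(\<lambda>\<omega>. \<Sum>s<I n. T k \<omega> (i(n := s)) * (\<Sum>a<\<mu> n. Q n \<omega> $$ (i n, a) * Q n \<omega> $$ (s, a))) \<in> borel_measurable M"
      using Q[OF n] Suc.prems Suc.IH upd
      by (intro borel_measurable_sum borel_measurable_times) (auto simp: random_mat_def)
    then show ?case by (subst measurable_cong[OF TS]) auto
  qed
  from this[of N] i show ?thesis by (simp add: T_def project_tensor_def)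
qed

section \<open>Numerical exclusion of oversampling one\<close>

lemma pi_le_16_fifths: "pi \<le> 16 / 5"
proof -
  \<comment> \<open>With arctan t at most t and arctan (1/239) nonnegative, Machin's formula pi/4 =
    4 arctan (1/5) - arctan (1/239) gives pi/4 at most 4/5.\<close>
  have "0 - arctan 0 \<le> 1 / 5 - arctan (1 / 5 :: real)"
  proof (rule DERIV_nonneg_imp_nondecreasing[of 0 "1 / 5" "\<lambda>t. t - arctan t"])
    fix t :: real assume "0 \<le> t"
    have "((\<lambda>t. t - arctan t) has_real_derivative 1 - inverse (1 + t\<^sup>2)) (at t)"
      by (auto intro!: derivative_eq_intros)
    moreover have "0 \<le> 1 - inverse (1 + t\<^sup>2)" by (simp add: inverse_le_1_iff)
    ultimately show "\<exists>D. ((\<lambda>t. t - arctan t) has_real_derivative D) (at t) \<and> 0 \<le> D" by blast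
  qed simp
  moreover have "0 \<le> arctan (1 / 239 :: real)" by simp
  ultimately show ?thesis using machin arctan_zero_zero by linarith
qed

text \<open>After clearing denominators and squaring, the claim is 16 pi < e^4. Here 16 pi is at
  most 51.2, and e^4 is the 16th power of exp (1/4), whose quadratic Taylor polynomial 1 + 1/4 +
  1/32 exceeds 1.28; the 16th power of 1.28 is above 51.9.\<close>

lemma oversampling_one_term_gt_half: "1 / 2 < 1 / sqrt (2 * pi * (real 1 + 1)) * (exp 1 / (real 1 + 1)) ^ (1 + 1)"
proof -
  have "(1.28 :: real) \<le> exp (1 / 4)" using exp_lower_Taylor_quadratic[of "1 / 4"] by (simp add: power2_eq_square)
  then have "(1.28 :: real) ^ 16 \<le> exp (1 / 4) ^ 16" by (intro power_mono) auto
  also have "exp (1 / 4 :: real) ^ 16 = exp 1 ^ 4" by (simp add: exp_of_nat_mult[symmetric])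
  finally have e: "(1.28 :: real) ^ 16 \<le> exp 1 ^ 4" .
  have "16 * pi \<le> 16 * (16 / 5)" using pi_le_16_fifths by simp
  also have "\<dots> < (1.28 :: real) ^ 16" by (simp add: power_divide divide_simps)
  also note e
  finally have "sqrt (16 * pi) < sqrt ((exp 1 ^ 2)\<^sup>2)" by (simp add: power_mult[symmetric])
  moreover have "sqrt (16 * pi) = 4 * sqrt pi" by (simp add: real_sqrt_mult)
  moreover have "sqrt ((exp 1 ^ 2)\<^sup>2) = (exp 1 ^ 2 :: real)" by (rule real_sqrt_unique) auto
  ultimately have "4 * sqrt pi < exp 1 ^ 2" by simp
  then show ?thesis by (simp add: real_sqrt_mult field_simps power2_eq_square)
qed


theorem theorem6:
  fixes M :: "'w measure"
    and N K q :: nat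
    and I \<mu> :: "nat \<Rightarrow> nat"
    and A :: tensor
    and G Q :: "nat \<Rightarrow> 'w \<Rightarrow> real mat"
    and \<beta> \<gamma> p :: real
    and lam :: "nat \<Rightarrow> real"
  assumes M: "prob_space M"
    and K_pos: "0 < K"
    and dims: "\<And>n. n \<in> {1..N} \<Longrightarrow> 0 < I n \<and> 0 < \<mu> n \<and> \<mu> n + K < min_dim N I n"
    and beta: "1 < \<beta>"
    and gamma: "1 < \<gamma>"
    and p_eq: "p = 1 - (\<Sum>n=1..N.
        1 / (4 * (\<gamma>\<^sup>2 - 1)
             * sqrt (pi * max (real (min_dim N I n) - real (\<mu> n)) (real (\<mu> n) + real K) * \<gamma>\<^sup>2))
          * (2 * \<gamma>\<^sup>2 / exp (\<gamma>\<^sup>2 - 1))\<^sup>2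
        + 1 / sqrt (2 * pi * (real K + 1)) * (exp 1 / (real K + 1)) ^ (K + 1)
        + 1 / (4 * (\<gamma>\<^sup>2 - 1) * sqrt (pi * real (I n) * \<gamma>\<^sup>2))
          * (2 * \<gamma>\<^sup>2 / exp (\<gamma>\<^sup>2 - 1))\<^sup>2)"
    and p_nonneg: "0 \<le> p"
    and q: "1 \<le> q"
    and alg: "randomized_thosvd_power M N I A \<mu> K q G Q"
    and lam_eq: "\<And>n. n \<in> {1..N} \<Longrightarrow> lam n =
        (sqrt (max (real (min_dim N I n) - real (\<mu> n)) (real (\<mu> n) + real K)) + sqrt (real (I n)))
          * sqrt (2 * (real (\<mu> n) + real K)) * \<gamma> * \<beta>
        / sing_val (\<mu> n) (unfolding_mat N I A n) ^ (2 * q - 1)"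
  shows "measure M {\<omega> \<in> space M.
      tensor_norm N I (\<lambda>i. A i - project_tensor N A (\<lambda>n. Q n \<omega>) i)
        \<le> 2 * (\<Sum>n=1..N. lam n * tail_norm_pow (unfolding_mat N I A n) (\<mu> n + 1) q
                         + tail_norm (unfolding_mat N I A n) (\<mu> n + 1))} \<ge> p"
proof -
  interpret prob_space M by (rule M)
  define t1 where "t1 n = 1 / (4 * (\<gamma>\<^sup>2 - 1)
             * sqrt (pi * max (real (min_dim N I n) - real (\<mu> n)) (real (\<mu> n) + real K) * \<gamma>\<^sup>2))
          * (2 * \<gamma>\<^sup>2 / exp (\<gamma>\<^sup>2 - 1))\<^sup>2" for n
  define t2 where "t2 = 1 / sqrt (2 * pi * (real K + 1)) * (exp 1 / (real K + 1)) ^ (K + 1)"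
  define t3 where "t3 n = 1 / (4 * (\<gamma>\<^sup>2 - 1) * sqrt (pi * real (I n) * \<gamma>\<^sup>2))
          * (2 * \<gamma>\<^sup>2 / exp (\<gamma>\<^sup>2 - 1))\<^sup>2" for n
  have p: "p = 1 - (\<Sum>n=1..N. t1 n + t2 + t3 n)" unfolding p_eq t1_def t2_def t3_def ..
  have "1 < \<gamma>\<^sup>2" using gamma by (intro one_less_power) auto
  then have "0 \<le> t1 n" "0 \<le> t3 n" for n
    unfolding t1_def t3_def by (intro mult_nonneg_nonneg divide_nonneg_nonneg; simp add: max_def)+
  then have t: "t2 \<le> t1 n + t2 + t3 n" for n by (simp add: add_increasing)
  have p_le: "p \<le> 1 - real N * t2"
    unfolding p using sum_mono[of "{1..N}" "\<lambda>_. t2" "\<lambda>n. t1 n + t2 + t3 n"] t by simp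
  have K2: "2 \<le> K" if n: "n \<in> {1..N}" for n
  proof -
    \<comment> \<open>With a single mode the codimension is an empty product, so
      \<open>min_dim\<close> is at most 1 and leaves no room for \<open>\<mu> n + K\<close>.\<close>
    have "N \<noteq> 1"
    proof
      assume "N = 1"
      then have "codim N I n = 1" using n by (auto simp: codim_def)
      then show False using dims[OF n] by (auto simp: min_dim_def)
    qed
    then have N2: "2 \<le> N" using n by auto
    \<comment> \<open>At least two modes, each contributing more than 1/2, would make
      \<open>p\<close> negative.\<close>
    have "K \<noteq> 1"
    proof
      assume "K = 1"
      then have "1 / 2 < t2" using oversampling_one_term_gt_half unfolding t2_def by simp
      then have "2 * (1 / 2) < real N * t2" using N2 by (intro mult_le_less_imp_less) auto
      then show False using p_le p_nonneg by simp
    qed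
    then show ?thesis using K_pos by simp
  qed
  define B where "B n = unfolding_mat N I A n" for n
  define e where "e n = 2 * (lam n * tail_norm_pow (B n) (\<mu> n + 1) q + tail_norm (B n) (\<mu> n + 1))" for n
  define \<epsilon> where "\<epsilon> n \<omega> = frob_norm (B n - Q n \<omega> * (Q n \<omega>)\<^sup>T * B n)" for n \<omega>
  define F where "F n = {\<omega> \<in> space M. \<not> \<epsilon> n \<omega> \<le> e n}" for n
  have Ipos: "0 < I n" if "n \<in> {1..N}" for n using dims[OF that] by simp
  have G: "standard_gaussian_mat M (I n) (\<mu> n + K) (G n)" and Q: "random_mat M (I n) (\<mu> n) (Q n)"
    and sk: "\<And>\<omega>. \<omega> \<in> space M \<Longrightarrow> power_sketch_factor (B n) (\<mu> n) K q (G n \<omega>) (Q n \<omega>)"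
    if "n \<in> {1..N}" for n
    using alg that unfolding randomized_thosvd_power_def B_def by blast+
  have Bc: "B n \<in> carrier_mat (I n) (codim N I n)" for n unfolding B_def by (rule unfolding_mat_carrier)
  have F_le: "measure M (F n) \<le> t2" if n: "n \<in> {1..N}" for n
    unfolding F_def \<epsilon>_def e_def t2_def
  proof (rule range_finder_error_prob[OF M G[OF n] Q[OF n] sk[OF n] Bc _ _ K2[OF n] q beta gamma _ lam_eq[OF n, folded B_def]])
    show "0 < \<mu> n" "\<mu> n + K < min (I n) (codim N I n)" using dims[OF n] by (auto simp: min_dim_def)
  qed auto
  have F_meas: "F n \<in> sets M" if n: "n \<in> {1..N}" for n
  proof -
    note projection_error_measurable[OF Q[OF n] Bc, measurable]
    show ?thesis unfolding F_def \<epsilon>_def by measurable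
  qed
  let ?S = "{\<omega> \<in> space M. tensor_norm N I (\<lambda>i. A i - project_tensor N A (\<lambda>n. Q n \<omega>) i)
        \<le> 2 * (\<Sum>n=1..N. lam n * tail_norm_pow (unfolding_mat N I A n) (\<mu> n + 1) q
                         + tail_norm (unfolding_mat N I A n) (\<mu> n + 1))}"
  have S_meas: "?S \<in> sets M"
  proof -
    have "(\<lambda>\<omega>. tensor_norm N I (\<lambda>i. A i - project_tensor N A (\<lambda>n. Q n \<omega>) i)) \<in> borel_measurable M"
      unfolding tensor_norm_def using project_tensor_measurable[OF Ipos Q]
      by (intro measurable_compose[OF _ borel_measurable_sqrt] borel_measurable_sum borel_measurable_power
          borel_measurable_diff) auto
    note this[measurable]
    show ?thesis by measurable
  qed
  have sub: "space M - (\<Union>n\<in>{1..N}. F n) \<subseteq> ?S"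
  proof
    fix \<omega> assume \<omega>: "\<omega> \<in> space M - (\<Union>n\<in>{1..N}. F n)"
    have Qo: "Q n \<omega> \<in> carrier_mat (I n) (\<mu> n) \<and> orthonormal_mat (Q n \<omega>)" if "n \<in> {1..N}" for n
      using sk[OF that, of \<omega>] \<omega> Bc[of n] by (auto simp: power_sketch_factor_def Let_def)
    have "tensor_norm N I (\<lambda>i. A i - project_tensor N A (\<lambda>n. Q n \<omega>) i) \<le> (\<Sum>n=1..N. \<epsilon> n \<omega>)"
      unfolding \<epsilon>_def B_def by (rule projection_error_telescope[OF Ipos Qo])
    also have "\<dots> \<le> (\<Sum>n=1..N. e n)" using \<omega> by (intro sum_mono) (auto simp: F_def)
    also have "\<dots> = 2 * (\<Sum>n=1..N. lam n * tail_norm_pow (unfolding_mat N I A n) (\<mu> n + 1) q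
                         + tail_norm (unfolding_mat N I A n) (\<mu> n + 1))"
      by (simp add: e_def B_def sum_distrib_left)
    finally show "\<omega> \<in> ?S" using \<omega> by simp
  qed
  \<comment> \<open>A union bound, since nothing is known about the joint law of the Gaussian
    matrices of different modes.\<close>
  have "measure M (\<Union>n\<in>{1..N}. F n) \<le> (\<Sum>n\<in>{1..N}. measure M (F n))"
    using F_meas by (intro finite_measure_subadditive_finite) auto
  also have "\<dots> \<le> real N * t2" using sum_mono[of "{1..N}" "\<lambda>n. measure M (F n)" "\<lambda>_. t2"] F_le by simp
  finally have "p \<le> 1 - measure M (\<Union>n\<in>{1..N}. F n)" using p_le by linarith
  also have "\<dots> = measure M (space M - (\<Union>n\<in>{1..N}. F n))"
    using F_meas by (intro prob_compl[symmetric]) auto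
  also have "\<dots> \<le> measure M ?S" using sub S_meas by (rule finite_measure_mono)
  finally show ?thesis by simp
qed

end
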